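(* Let $(K,k)$ be a pair of fields of characteristic $3$ with $K^3\le k\le K$. Then for each of the properties stable, simple (in the model-theoretic sense), NTP$_2$, NSOP$_1$, the group $G_2(k,K)$ has the property if and only if the pair of fields $(K,k)$ (the field $K$ with a unary predicate for $k$) has it.
   Context: $G_2(k,K)$ is the subgroup of the Chevalley group $G_2(K)$ generated by the root subgroups $U_\alpha(K)$ for $\alpha$ short and $U_\alpha(k)$ for $\alpha$ long. A structure has one of these properties if its complete theory does. *)

theory Defs
  imports
    "HOL-Analysis.Finite_Cartesian_Product"
    "HOL-Analysis.Determinants"
    "HOL-Algebra.Generated_Groups"
    "HOL-Library.Infinite_Typeclass"
begin

section \<open>First-order logic\<close>

record ('f, 'r) language =
  funs :: "('f \<times> nat) set"
  rels :: "('r \<times> nat) set"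

record ('f, 'r, 'a) struct =
  dom :: "'a set"
  fn :: "'f \<Rightarrow> 'a list \<Rightarrow> 'a"
  rel :: "'r \<Rightarrow> 'a list \<Rightarrow> bool"

datatype 'f trm = Var nat | App 'f "'f trm list"

datatype ('f, 'r) form =
    Eq "'f trm" "'f trm"
  | Atom 'r "'f trm list"
  | Neg "('f, 'r) form"
  | And "('f, 'r) form" "('f, 'r) form"
  | Ex nat "('f, 'r) form"

primrec trm_vars :: "'f trm \<Rightarrow> nat set" where
  "trm_vars (Var i) = {i}"
| "trm_vars (App f ts) = \<Union> (set (map trm_vars ts))"

primrec free_vars :: "('f, 'r) form \<Rightarrow> nat set" where
  "free_vars (Eq s t) = trm_vars s \<union> trm_vars t"
| "free_vars (Atom r ts) = \<Union> (trm_vars ` set ts)"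
| "free_vars (Neg \<phi>) = free_vars \<phi>"
| "free_vars (And \<phi> \<psi>) = free_vars \<phi> \<union> free_vars \<psi>"
| "free_vars (Ex i \<phi>) = free_vars \<phi> - {i}"

primrec wf_trm :: "('f, 'r) language \<Rightarrow> 'f trm \<Rightarrow> bool" where
  "wf_trm L (Var i) \<longleftrightarrow> True"
| "wf_trm L (App f ts) \<longleftrightarrow> (f, length ts) \<in> funs L \<and> list_all (wf_trm L) ts"

primrec wf_form :: "('f, 'r) language \<Rightarrow> ('f, 'r) form \<Rightarrow> bool" where
  "wf_form L (Eq s t) \<longleftrightarrow> wf_trm L s \<and> wf_trm L t"
| "wf_form L (Atom r ts) \<longleftrightarrow> (r, length ts) \<in> rels L \<and> list_all (wf_trm L) ts"
| "wf_form L (Neg \<phi>) \<longleftrightarrow> wf_form L \<phi>"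
| "wf_form L (And \<phi> \<psi>) \<longleftrightarrow> wf_form L \<phi> \<and> wf_form L \<psi>"
| "wf_form L (Ex i \<phi>) \<longleftrightarrow> wf_form L \<phi>"

definition is_struct :: "('f, 'r) language \<Rightarrow> ('f, 'r, 'a) struct \<Rightarrow> bool" where
  "is_struct L M \<longleftrightarrow> dom M \<noteq> {} \<and>
     (\<forall>(f, n) \<in> funs L. \<forall>as. length as = n \<and> set as \<subseteq> dom M \<longrightarrow> fn M f as \<in> dom M)"

primrec val :: "('f, 'r, 'a) struct \<Rightarrow> (nat \<Rightarrow> 'a) \<Rightarrow> 'f trm \<Rightarrow> 'a" where
  "val M e (Var i) = e i"
| "val M e (App f ts) = fn M f (map (val M e) ts)"

primrec sat :: "('f, 'r, 'a) struct \<Rightarrow> (nat \<Rightarrow> 'a) \<Rightarrow> ('f, 'r) form \<Rightarrow> bool" where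
  "sat M e (Eq s t) \<longleftrightarrow> val M e s = val M e t"
| "sat M e (Atom r ts) \<longleftrightarrow> rel M r (map (val M e) ts)"
| "sat M e (Neg \<phi>) \<longleftrightarrow> \<not> sat M e \<phi>"
| "sat M e (And \<phi> \<psi>) \<longleftrightarrow> sat M e \<phi> \<and> sat M e \<psi>"
| "sat M e (Ex i \<phi>) \<longleftrightarrow> (\<exists>a \<in> dom M. sat M (e(i := a)) \<phi>)"

definition sentences :: "('f, 'r) language \<Rightarrow> ('f, 'r) form set" where
  "sentences L = {\<sigma>. wf_form L \<sigma> \<and> free_vars \<sigma> = {}}"

definition models :: "('f, 'r, 'a) struct \<Rightarrow> ('f, 'r) form \<Rightarrow> bool" where
  "models M \<sigma> \<longleftrightarrow> (\<forall>e. range e \<subseteq> dom M \<longrightarrow> sat M e \<sigma>)"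

definition complete_theory :: "('f, 'r) language \<Rightarrow> ('f, 'r, 'a) struct \<Rightarrow> ('f, 'r) form set" where
  "complete_theory L M = {\<sigma> \<in> sentences L. models M \<sigma>}"

definition is_model :: "('f, 'r) language \<Rightarrow> ('f, 'r) form set \<Rightarrow> ('f, 'r, 'a) struct \<Rightarrow> bool" where
  "is_model L T M \<longleftrightarrow> is_struct L M \<and> (\<forall>\<sigma> \<in> T. models M \<sigma>)"


section \<open>Dividing lines\<close>

text \<open>
  A partitioned formula \<open>\<phi>(x; y)\<close> with \<open>|x| = m\<close> and \<open>|y| = n\<close> uses the variables \<open>0, \<dots>, m - 1\<close>
  for \<open>x\<close> and \<open>m, \<dots>, m + n - 1\<close> for \<open>y\<close>.
\<close>

definition partitioned :: "('f, 'r) language \<Rightarrow> nat \<Rightarrow> nat \<Rightarrow> ('f, 'r) form \<Rightarrow> bool" where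
  "partitioned L m n \<phi> \<longleftrightarrow> wf_form L \<phi> \<and> free_vars \<phi> \<subseteq> {..<m + n}"

definition tuples :: "('f, 'r, 'a) struct \<Rightarrow> nat \<Rightarrow> 'a list set" where
  "tuples M n = {as. length as = n \<and> set as \<subseteq> dom M}"

definition holds :: "('f, 'r, 'a) struct \<Rightarrow> ('f, 'r) form \<Rightarrow> 'a list \<Rightarrow> 'a list \<Rightarrow> bool" where
  "holds M \<phi> a b \<longleftrightarrow> sat M ((!) (a @ b)) \<phi>"

text \<open>
  Consistency of \<open>{\<phi>(x; b). b \<in> B}\<close> with the elementary diagram of \<open>M\<close>, i.e.\ finite
  satisfiability in \<open>M\<close>.
\<close>

definition consistent ::
  "('f, 'r, 'a) struct \<Rightarrow> nat \<Rightarrow> ('f, 'r) form \<Rightarrow> 'a list set \<Rightarrow> bool" where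
  "consistent M m \<phi> B \<longleftrightarrow>
     (\<forall>B'. B' \<subseteq> B \<and> finite B' \<longrightarrow> (\<exists>a \<in> tuples M m. \<forall>b \<in> B'. holds M \<phi> a b))"

definition k_inconsistent ::
  "('f, 'r, 'a) struct \<Rightarrow> nat \<Rightarrow> ('f, 'r) form \<Rightarrow> nat \<Rightarrow> (nat \<Rightarrow> 'a list) \<Rightarrow> bool" where
  "k_inconsistent M m \<phi> k b \<longleftrightarrow>
     (\<forall>S. finite S \<and> card S = k \<longrightarrow> \<not> consistent M m \<phi> (b ` S))"

definition order_property :: "('f, 'r, 'a) struct \<Rightarrow> nat \<Rightarrow> nat \<Rightarrow> ('f, 'r) form \<Rightarrow> bool" where
  "order_property M m n \<phi> \<longleftrightarrow>
     (\<exists>a b. (\<forall>i::nat. a i \<in> tuples M m \<and> b i \<in> tuples M n) \<and>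
            (\<forall>i j. holds M \<phi> (a i) (b j) \<longleftrightarrow> i < j))"

definition tree_property :: "('f, 'r, 'a) struct \<Rightarrow> nat \<Rightarrow> nat \<Rightarrow> ('f, 'r) form \<Rightarrow> bool" where
  "tree_property M m n \<phi> \<longleftrightarrow>
     (\<exists>k. \<exists>b :: nat list \<Rightarrow> 'a list.
        (\<forall>\<eta>. b \<eta> \<in> tuples M n) \<and>
        (\<forall>\<eta>. k_inconsistent M m \<phi> k (\<lambda>i. b (\<eta> @ [i]))) \<and>
        (\<forall>\<sigma>. consistent M m \<phi> {b (map \<sigma> [0..<l]) | l. 0 < l}))"

definition tree_property_2 :: "('f, 'r, 'a) struct \<Rightarrow> nat \<Rightarrow> nat \<Rightarrow> ('f, 'r) form \<Rightarrow> bool" where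
  "tree_property_2 M m n \<phi> \<longleftrightarrow>
     (\<exists>k. \<exists>b :: nat \<Rightarrow> nat \<Rightarrow> 'a list.
        (\<forall>i j. b i j \<in> tuples M n) \<and>
        (\<forall>i. k_inconsistent M m \<phi> k (b i)) \<and>
        (\<forall>\<sigma>. consistent M m \<phi> {b i (\<sigma> i) | i. True}))"

definition strong_order_property_1 ::
  "('f, 'r, 'a) struct \<Rightarrow> nat \<Rightarrow> nat \<Rightarrow> ('f, 'r) form \<Rightarrow> bool" where
  "strong_order_property_1 M m n \<phi> \<longleftrightarrow>
     (\<exists>b :: bool list \<Rightarrow> 'a list.
        (\<forall>\<eta>. b \<eta> \<in> tuples M n) \<and>
        (\<forall>\<sigma>. consistent M m \<phi> {b (map \<sigma> [0..<l]) | l. True}) \<and>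
        (\<forall>\<nu> \<tau>. \<not> consistent M m \<phi> {b (\<nu> @ [False] @ \<tau>), b (\<nu> @ [True])}))"

text \<open>
  HOL cannot quantify over all sets inside a definition, so models range over the subsets of a
  universe type \<open>'u\<close>.  The languages below are finite; by compactness and Loewenheim-Skolem every
  infinite \<open>'u\<close> then contains a witnessing model as soon as there is one of any cardinality.
\<close>

definition stable_theory :: "'u itself \<Rightarrow> ('f, 'r) language \<Rightarrow> ('f, 'r) form set \<Rightarrow> bool" where
  "stable_theory U L T \<longleftrightarrow>
     \<not> (\<exists>(M :: ('f, 'r, 'u) struct) m n \<phi>.
           is_model L T M \<and> partitioned L m n \<phi> \<and> order_property M m n \<phi>)"

definition simple_theory :: "'u itself \<Rightarrow> ('f, 'r) language \<Rightarrow> ('f, 'r) form set \<Rightarrow> bool" where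
  "simple_theory U L T \<longleftrightarrow>
     \<not> (\<exists>(M :: ('f, 'r, 'u) struct) m n \<phi>.
           is_model L T M \<and> partitioned L m n \<phi> \<and> tree_property M m n \<phi>)"

definition NTP2_theory :: "'u itself \<Rightarrow> ('f, 'r) language \<Rightarrow> ('f, 'r) form set \<Rightarrow> bool" where
  "NTP2_theory U L T \<longleftrightarrow>
     \<not> (\<exists>(M :: ('f, 'r, 'u) struct) m n \<phi>.
           is_model L T M \<and> partitioned L m n \<phi> \<and> tree_property_2 M m n \<phi>)"

definition NSOP1_theory :: "'u itself \<Rightarrow> ('f, 'r) language \<Rightarrow> ('f, 'r) form set \<Rightarrow> bool" where
  "NSOP1_theory U L T \<longleftrightarrow>
     \<not> (\<exists>(M :: ('f, 'r, 'u) struct) m n \<phi>.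
           is_model L T M \<and> partitioned L m n \<phi> \<and> strong_order_property_1 M m n \<phi>)"


section \<open>Groups and pairs of fields as structures\<close>

datatype group_fun = GMult | GInv | GOne

definition group_language :: "(group_fun, unit) language" where
  "group_language = \<lparr>funs = {(GMult, 2), (GInv, 1), (GOne, 0)}, rels = {}\<rparr>"

definition group_struct :: "('a, 'b) monoid_scheme \<Rightarrow> (group_fun, unit, 'a) struct" where
  "group_struct G = \<lparr>dom = carrier G,
     fn = (\<lambda>f as. case f of
         GMult \<Rightarrow> as ! 0 \<otimes>\<^bsub>G\<^esub> as ! 1
       | GInv \<Rightarrow> inv\<^bsub>G\<^esub> (as ! 0)
       | GOne \<Rightarrow> \<one>\<^bsub>G\<^esub>),
     rel = (\<lambda>_ _. False)\<rparr>"

datatype ring_fun = RPlus | RTimes | RUminus | RZero | ROne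

datatype pair_rel = InSubfield

definition field_pair_language :: "(ring_fun, pair_rel) language" where
  "field_pair_language =
     \<lparr>funs = {(RPlus, 2), (RTimes, 2), (RUminus, 1), (RZero, 0), (ROne, 0)},
      rels = {(InSubfield, 1)}\<rparr>"

text \<open>The pair \<open>(K, k)\<close>; the field \<open>K\<close> is the whole type \<open>'a\<close>.\<close>

definition field_pair :: "'a::field set \<Rightarrow> (ring_fun, pair_rel, 'a) struct" where
  "field_pair k = \<lparr>dom = UNIV,
     fn = (\<lambda>f as. case f of
         RPlus \<Rightarrow> as ! 0 + as ! 1
       | RTimes \<Rightarrow> as ! 0 * as ! 1
       | RUminus \<Rightarrow> - (as ! 0)
       | RZero \<Rightarrow> 0
       | ROne \<Rightarrow> 1),
     rel = (\<lambda>_ as. as ! 0 \<in> k)\<rparr>"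

definition is_subfield :: "'a::field set \<Rightarrow> bool" where
  "is_subfield k \<longleftrightarrow> 0 \<in> k \<and> 1 \<in> k \<and>
     (\<forall>x \<in> k. \<forall>y \<in> k. x - y \<in> k \<and> x * y \<in> k) \<and> (\<forall>x \<in> k. inverse x \<in> k)"


section \<open>The groups \<open>G\<^sub>2(K)\<close> and \<open>G\<^sub>2(k, K)\<close>\<close>

text \<open>
  \<open>G\<^sub>2(K)\<close> is the Chevalley group of the 7-dimensional representation of the simple Lie algebra of
  type \<open>G\<^sub>2\<close>, which is faithful; as the weight and root lattices coincide, all Chevalley groups of
  type \<open>G\<^sub>2\<close> over \<open>K\<close> are isomorphic.

  Let \<open>\<epsilon>\<^sub>i\<close>, with \<open>i\<close> modulo 3, span the root lattice subject to \<open>\<epsilon>\<^sub>0 + \<epsilon>\<^sub>1 + \<epsilon>\<^sub>2 = 0\<close>.  The weights of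
  the representation are \<open>0\<close> (\<open>Wt0\<close>), \<open>\<epsilon>\<^sub>i\<close> (\<open>WtP i\<close>) and \<open>-\<epsilon>\<^sub>i\<close> (\<open>WtN i\<close>).  The short roots are
  \<open>\<epsilon>\<^sub>i\<close> (\<open>ShortP i\<close>) and \<open>-\<epsilon>\<^sub>i\<close> (\<open>ShortN i\<close>); the long roots are \<open>\<epsilon>\<^sub>i\<^sub>+\<^sub>1 - \<epsilon>\<^sub>i\<^sub>+\<^sub>2\<close> (\<open>LongP i\<close>) and
  \<open>\<epsilon>\<^sub>i\<^sub>+\<^sub>2 - \<epsilon>\<^sub>i\<^sub>+\<^sub>1\<close> (\<open>LongN i\<close>).
\<close>

datatype g2_weight = Wt0 | WtP 3 | WtN 3

datatype g2_root = ShortP 3 | ShortN 3 | LongP 3 | LongN 3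

instance g2_weight :: finite
proof
  have "(UNIV :: g2_weight set) = {Wt0} \<union> range WtP \<union> range WtN"
    using g2_weight.exhaust by blast
  then show "finite (UNIV :: g2_weight set)"
    by (metis finite.emptyI finite.insertI finite_UnI finite finite_imageI)
qed

type_synonym 'a g2_matrix = "'a ^ g2_weight ^ g2_weight"

definition mat_unit :: "int \<Rightarrow> g2_weight \<Rightarrow> g2_weight \<Rightarrow> int g2_matrix" where
  "mat_unit c p q = (\<chi> r s. if r = p \<and> s = q then c else 0)"

text \<open>
  The root vectors \<open>e\<^sub>\<alpha>\<close> of a Chevalley basis, acting on column vectors: \<open>[e\<^sub>\<alpha>, e\<^sub>\<beta>] = \<plusminus>(p + 1) e\<^sub>\<alpha>\<^sub>+\<^sub>\<beta>\<close>
  with \<open>p\<close> maximal such that \<open>\<beta> - p\<alpha>\<close> is a root, and \<open>[e\<^sub>\<alpha>, e\<^sub>-\<^sub>\<alpha>]\<close> is the coroot of \<open>\<alpha>\<close>, acting on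
  the weight \<open>\<mu>\<close> by \<open>2(\<mu>, \<alpha>) / (\<alpha>, \<alpha>)\<close>.
\<close>

fun root_vector :: "g2_root \<Rightarrow> int g2_matrix" where
  "root_vector (ShortP i) =
     mat_unit 2 (WtP i) Wt0 + mat_unit 1 Wt0 (WtN i) +
     mat_unit 1 (WtN (i + 2)) (WtP (i + 1)) + mat_unit (- 1) (WtN (i + 1)) (WtP (i + 2))"
| "root_vector (ShortN i) =
     mat_unit 2 (WtN i) Wt0 + mat_unit 1 Wt0 (WtP i) +
     mat_unit (- 1) (WtP (i + 2)) (WtN (i + 1)) + mat_unit 1 (WtP (i + 1)) (WtN (i + 2))"
| "root_vector (LongP i) =
     mat_unit 1 (WtP (i + 1)) (WtP (i + 2)) + mat_unit (- 1) (WtN (i + 2)) (WtN (i + 1))"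
| "root_vector (LongN i) =
     mat_unit 1 (WtP (i + 2)) (WtP (i + 1)) + mat_unit (- 1) (WtN (i + 1)) (WtN (i + 2))"

lemma mod3_simps:
  "(3::3) = 0" "(4::3) = 1" "(2::3) \<noteq> 0" "(2::3) \<noteq> 1" "(0::3) \<noteq> 2" "(1::3) \<noteq> 2"
  "(1::3) + 2 = 0" "(2::3) + 2 = 1" "(2::3) + 1 = 0" "(1::3) + 1 = 2"
  by simp_all

lemma all_mod3: "(\<forall>i::3. P i) \<longleftrightarrow> P 0 \<and> P 1 \<and> P 2"
  by (metis exhaust_3 mod3_simps(1))

lemma all_g2_root:
  "(\<forall>\<alpha>. P \<alpha>) \<longleftrightarrow> (\<forall>i. P (ShortP i)) \<and> (\<forall>i. P (ShortN i)) \<and> (\<forall>i. P (LongP i)) \<and> (\<forall>i. P (LongN i))"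
  by (metis g2_root.exhaust)

lemma mat_unit_mult:
  "mat_unit c p q ** mat_unit d r s = (if q = r then mat_unit (c * d) p s else 0)"
proof -
  have "(\<Sum>k\<in>UNIV. (if i = p \<and> k = q then c else 0) * (if k = r \<and> j = s then d else 0)) =
      (\<Sum>k\<in>UNIV. if k = q then (if i = p \<and> q = r \<and> j = s then c * d else 0) else 0)" for i j
    by (rule sum.cong) auto
  then show ?thesis
    by (simp add: mat_unit_def matrix_matrix_mult_def vec_eq_iff)
qed

lemma mat_mult_add: "(A :: int g2_matrix) ** (B + C) = A ** B + A ** C" "(A + B) ** C = A ** C + B ** C"
  by (simp_all add: vec_eq_iff matrix_matrix_mult_def ring_distribs sum.distrib)

lemma root_vector_nilpotent: "root_vector \<alpha> ** root_vector \<alpha> ** root_vector \<alpha> = 0"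
proof -
  have "\<forall>\<alpha>. root_vector \<alpha> ** root_vector \<alpha> ** root_vector \<alpha> = 0"
    unfolding all_g2_root all_mod3
    by (simp add: mat_unit_mult mat_mult_add mod3_simps)
  then show ?thesis by blast
qed

lemma root_vector_square_even: "even ((root_vector \<alpha> ** root_vector \<alpha>) $ r $ s)"
proof -
  have "\<forall>\<alpha> r s. even ((root_vector \<alpha> ** root_vector \<alpha>) $ r $ s)"
    unfolding all_g2_root all_mod3
    by (simp add: mat_unit_mult mat_mult_add mod3_simps) (simp add: mat_unit_def)
  then show ?thesis by blast
qed

text \<open>
  \<open>x\<^sub>\<alpha>(t) = exp (t e\<^sub>\<alpha>)\<close>: since \<open>e\<^sub>\<alpha>\<^sup>3 = 0\<close> and \<open>e\<^sub>\<alpha>\<^sup>2 / 2\<close> has integer entries, this is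
  \<open>1 + t e\<^sub>\<alpha> + t\<^sup>2 (e\<^sub>\<alpha>\<^sup>2 / 2)\<close>, with the integer matrices reduced to \<open>K\<close>.
\<close>

definition root_elt :: "g2_root \<Rightarrow> 'a::field \<Rightarrow> 'a g2_matrix" where
  "root_elt \<alpha> t = (\<chi> r s.
     (if r = s then 1 else 0) + t * of_int (root_vector \<alpha> $ r $ s)
       + t ^ 2 * of_int ((root_vector \<alpha> ** root_vector \<alpha>) $ r $ s div 2))"

definition root_subgroup :: "g2_root \<Rightarrow> 'a::field set \<Rightarrow> 'a g2_matrix set" where
  "root_subgroup \<alpha> S = root_elt \<alpha> ` S"

definition short_roots :: "g2_root set" where
  "short_roots = range ShortP \<union> range ShortN"

definition long_roots :: "g2_root set" where
  "long_roots = range LongP \<union> range LongN"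

definition GL_g2 :: "'a::field g2_matrix monoid" where
  "GL_g2 = \<lparr>carrier = {A. invertible A}, mult = (**), one = mat 1\<rparr>"

definition G2 :: "'a::field g2_matrix monoid" where
  "G2 = subgroup_generated GL_g2 (\<Union>\<alpha>. root_subgroup \<alpha> UNIV)"

definition mixed_G2 :: "'a::field set \<Rightarrow> 'a g2_matrix monoid" where
  "mixed_G2 k = subgroup_generated G2
     ((\<Union>\<alpha> \<in> short_roots. root_subgroup \<alpha> UNIV) \<union> (\<Union>\<alpha> \<in> long_roots. root_subgroup \<alpha> k))"

end

theory Submission
  imports Defs "HOL-Library.Countable_Set"
begin

text \<open>Each of the four properties fails in a theory iff some model realizes a certain infinite pattern of
  instances of a formula, and by compactness iff every finite part of the pattern is realized in a given model.
  Finite patterns can be transported along interpretations with parameters, so it is enough to interpret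
  \<open>G\<^sub>2(k, K)\<close> and \<open>(K, k)\<close> in each other.

  By Tavgen's argument \<open>G\<^sub>2(k, K)\<close> is a product of boundedly many root subgroups, so its set of matrices is
  definable in the pair.

  In the group, the centralizer of finitely many root elements is, up to scalar matrices, the root subgroup of a
  given root, hence commutators of short root elements define the field \<open>K\<close>.  The double commutator of a long
  root element with a short one reads off its parameter.  That this parameter lies in \<open>k\<close> cannot be seen from
  the matrix entries of a long root element alone, since scalars have to be discarded first; it follows because
  the group normalizes the additive group of all Lie algebra elements whose long root coordinates lie in \<open>k\<close>.\<close>

text \<open>Characteristic 3 and \<open>K^3 \<subseteq> k\<close> keep the mixed group under
  control. Commutator coefficients divisible by 3 vanish, so two short roots never produce a long
  one, and in the commutator of a long and a short root the short parameter enters every long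
  parameter as a cube. Root elements with short parameters in \<open>K\<close> and long ones in
  \<open>k\<close> can therefore be reordered without leaving these parameter sets; Tavgen's
  argument and the invariant Lie ring both rest on this.

  Models live on subsets of an arbitrary infinite type, where a full ultrapower may not fit.
  Compactness is therefore obtained from a countable part of an ultrapower that is closed under
  Skolem functions.

  Parameters of an interpretation are appended to the second tuple of a formula. Conditions that
  forbid solutions survive the transport because every solution of the translated formula is made to
  be a code.

  The scalars that the centralizers leave open are not computed: they are central and cancel in
  commutators, and \<open>K\<close> and \<open>k\<close> are read off through commutators
  only.\<close>

instance trm :: (countable) countable by countable_datatype
instance form :: (countable, countable) countable by countable_datatype

section \<open>Dependence of values and truth on the free variables\<close>

lemma finite_trm_vars [simp]: "finite (trm_vars t)"
  by (induction t) auto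

lemma finite_free_vars [simp]: "finite (free_vars \<phi>)"
  by (induction \<phi>) auto

lemma val_cong: "(\<And>i. i \<in> trm_vars t \<Longrightarrow> e i = e' i) \<Longrightarrow> val M e t = val M e' t"
proof (induction t)
  case (App f ts)
  then have "map (val M e) ts = map (val M e') ts" by auto
  then show ?case by (simp only: val.simps)
qed simp

lemma sat_cong: "(\<And>i. i \<in> free_vars \<phi> \<Longrightarrow> e i = e' i) \<Longrightarrow> sat M e \<phi> \<longleftrightarrow> sat M e' \<phi>"
proof (induction \<phi> arbitrary: e e')
  case (Eq s t)
  then have "val M e s = val M e' s" "val M e t = val M e' t" by (auto intro!: val_cong)
  then show ?case by simp
next
  case (Atom r ts)
  then have "map (val M e) ts = map (val M e') ts" by (auto intro!: val_cong)
  then show ?case by (simp only: sat.simps)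
next
  case (And \<phi> \<psi>)
  have "sat M e \<phi> \<longleftrightarrow> sat M e' \<phi>"
    by (rule And.IH) (use And.prems in auto)
  moreover have "sat M e \<psi> \<longleftrightarrow> sat M e' \<psi>"
    by (rule And.IH) (use And.prems in auto)
  ultimately show ?case by simp
next
  case (Ex i \<phi>)
  have "sat M (e(i := a)) \<phi> \<longleftrightarrow> sat M (e'(i := a)) \<phi>" for a
    by (rule Ex.IH) (use Ex.prems in auto)
  then show ?case by simp
next
  case (Neg \<phi>)
  have "sat M e \<phi> \<longleftrightarrow> sat M e' \<phi>"
    by (rule Neg.IH) (use Neg.prems in auto)
  then show ?case by simp
qed

lemma val_in_dom:
  "is_struct L M \<Longrightarrow> range e \<subseteq> dom M \<Longrightarrow> wf_trm L t \<Longrightarrow> val M e t \<in> dom M"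
proof (induction t)
  case (App f ts)
  then have "set (map (val M e) ts) \<subseteq> dom M" by (auto simp: list_all_iff)
  moreover have "(f, length (map (val M e) ts)) \<in> funs L" using App.prems by simp
  ultimately show ?case using App.prems(1) unfolding is_struct_def by fastforce
qed auto

subsection \<open>Renaming of variables\<close>

primrec ren_trm :: "(nat \<Rightarrow> nat) \<Rightarrow> 'f trm \<Rightarrow> 'f trm" where
  "ren_trm f (Var i) = Var (f i)"
| "ren_trm f (App g ts) = App g (map (ren_trm f) ts)"

text \<open>The new bound variable lies outside the image of all variables free in the body, so
  nothing is captured. The renaming is the last argument because it changes under a
  quantifier.\<close>

primrec ren :: "('f, 'r) form \<Rightarrow> (nat \<Rightarrow> nat) \<Rightarrow> ('f, 'r) form" where
  "ren (Eq s t) = (\<lambda>f. Eq (ren_trm f s) (ren_trm f t))"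
| "ren (Atom r ts) = (\<lambda>f. Atom r (map (ren_trm f) ts))"
| "ren (Neg \<phi>) = (\<lambda>f. Neg (ren \<phi> f))"
| "ren (And \<phi> \<psi>) = (\<lambda>f. And (ren \<phi> f) (ren \<psi> f))"
| "ren (Ex i \<phi>) = (\<lambda>f. let j = (SOME j. j \<notin> f ` free_vars \<phi>) in Ex j (ren \<phi> (f(i := j))))"

lemma val_ren_trm: "val M e (ren_trm f t) = val M (\<lambda>i. e (f i)) t"
proof (induction t)
  case (App g ts)
  then have "map (val M e) (map (ren_trm f) ts) = map (val M (\<lambda>i. e (f i))) ts" by auto
  then show ?case by (simp only: val.simps ren_trm.simps)
qed simp

lemma wf_ren_trm: "wf_trm L (ren_trm f t) \<longleftrightarrow> wf_trm L t"
  by (induction t) (auto simp: list_all_iff)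

lemma wf_ren [simp]: "wf_form L (ren \<phi> f) \<longleftrightarrow> wf_form L \<phi>"
  by (induction \<phi> arbitrary: f) (auto simp: list_all_iff wf_ren_trm Let_def)

lemma sat_ren: "sat M e (ren \<phi> f) \<longleftrightarrow> sat M (\<lambda>i. e (f i)) \<phi>"
proof (induction \<phi> arbitrary: e f)
  case (Eq s t)
  show ?case by (simp only: sat.simps ren.simps val_ren_trm)
next
  case (Atom r ts)
  have "map (val M e) (map (ren_trm f) ts) = map (val M (\<lambda>i. e (f i))) ts"
    by (simp only: map_map comp_def[of "val M e"] val_ren_trm)
  then show ?case by (simp only: sat.simps ren.simps)
next
  case (Ex i \<phi>)
  define j where "j = (SOME j. j \<notin> f ` free_vars \<phi>)"
  have "\<exists>j. j \<notin> f ` free_vars \<phi>"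
    by (meson ex_new_if_finite finite_free_vars finite_imageI infinite_UNIV_nat)
  then have j: "j \<notin> f ` free_vars \<phi>" unfolding j_def by (rule someI_ex)
  have "sat M (e(j := a)) (ren \<phi> (f(i := j))) \<longleftrightarrow> sat M ((\<lambda>i. e (f i))(i := a)) \<phi>" for a
    unfolding Ex.IH using j by (intro sat_cong) auto
  then show ?case unfolding ren.simps j_def[symmetric] Let_def by simp
qed auto

subsection \<open>Finite conjunctions and blocks of quantifiers\<close>

text \<open>A closed formula that is well formed in every language, so an empty conjunction adds
  neither symbols nor variables.\<close>

definition tt :: "('f, 'r) form" where
  "tt = Neg (Ex 0 (Neg (Eq (Var 0) (Var 0))))"

definition Conj :: "('f, 'r) form list \<Rightarrow> ('f, 'r) form" where
  "Conj \<phi>s = foldr And \<phi>s tt"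

lemma sat_Conj [simp]: "sat M e (Conj \<phi>s) \<longleftrightarrow> (\<forall>\<phi> \<in> set \<phi>s. sat M e \<phi>)"
  by (induction \<phi>s) (auto simp: Conj_def tt_def)

lemma wf_Conj [simp]: "wf_form L (Conj \<phi>s) \<longleftrightarrow> (\<forall>\<phi> \<in> set \<phi>s. wf_form L \<phi>)"
  by (induction \<phi>s) (auto simp: Conj_def tt_def)

definition exs :: "nat set \<Rightarrow> ('f, 'r) form \<Rightarrow> ('f, 'r) form" where
  "exs V \<phi> = foldr Ex (sorted_list_of_set V) \<phi>"

lemma wf_exs [simp]: "wf_form L (exs V \<phi>) \<longleftrightarrow> wf_form L \<phi>"
proof -
  have "wf_form L (foldr Ex xs \<phi>) \<longleftrightarrow> wf_form L \<phi>" for xs by (induction xs) auto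
  then show ?thesis by (simp add: exs_def)
qed

lemma free_vars_exs: "finite V \<Longrightarrow> free_vars (exs V \<phi>) = free_vars \<phi> - V"
proof -
  assume "finite V"
  have "free_vars (foldr Ex xs \<phi>) = free_vars \<phi> - set xs" for xs by (induction xs) auto
  then show ?thesis using \<open>finite V\<close> by (simp add: exs_def)
qed

lemma sat_exs:
  assumes "finite V" "range e \<subseteq> dom M"
  shows "sat M e (exs V \<phi>) \<longleftrightarrow> (\<exists>e'. range e' \<subseteq> dom M \<and> (\<forall>i. i \<notin> V \<longrightarrow> e' i = e i) \<and> sat M e' \<phi>)"
proof -
  have "sat M e (foldr Ex xs \<phi>) \<longleftrightarrow>
      (\<exists>e'. range e' \<subseteq> dom M \<and> (\<forall>i. i \<notin> set xs \<longrightarrow> e' i = e i) \<and> sat M e' \<phi>)"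
    if "range e \<subseteq> dom M" for xs using that
  proof (induction xs arbitrary: e)
    case Nil
    have "e' = e" if "\<forall>i. e' i = e i" for e' using that by auto
    then show ?case using Nil by auto
  next
    case (Cons x xs)
    have "sat M e (foldr Ex (x # xs) \<phi>) \<longleftrightarrow> (\<exists>a\<in>dom M. \<exists>e'. range e' \<subseteq> dom M \<and>
        (\<forall>i. i \<notin> set xs \<longrightarrow> e' i = (e(x := a)) i) \<and> sat M e' \<phi>)"
    proof -
      have "range (e(x := a)) \<subseteq> dom M" if "a \<in> dom M" for a using that Cons.prems by auto
      then show ?thesis using Cons.IH by simp
    qed
    also have "\<dots> \<longleftrightarrow> (\<exists>e'. range e' \<subseteq> dom M \<and> (\<forall>i. i \<notin> set (x # xs) \<longrightarrow> e' i = e i) \<and> sat M e' \<phi>)"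
    proof (intro iffI; elim bexE exE conjE)
      fix a e' assume "range e' \<subseteq> dom M" "\<forall>i. i \<notin> set xs \<longrightarrow> e' i = (e(x := a)) i" "sat M e' \<phi>"
      then show "\<exists>e'. range e' \<subseteq> dom M \<and> (\<forall>i. i \<notin> set (x # xs) \<longrightarrow> e' i = e i) \<and> sat M e' \<phi>"
        by (intro exI[of _ e']) auto
    next
      fix e' assume e': "range e' \<subseteq> dom M" "\<forall>i. i \<notin> set (x # xs) \<longrightarrow> e' i = e i" "sat M e' \<phi>"
      have "\<forall>i. i \<notin> set xs \<longrightarrow> e' i = (e(x := e' x)) i" using e'(2) by auto
      moreover have "e' x \<in> dom M" using e'(1) by auto
      ultimately show "\<exists>a\<in>dom M. \<exists>e'. range e' \<subseteq> dom M \<and>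
        (\<forall>i. i \<notin> set xs \<longrightarrow> e' i = (e(x := a)) i) \<and> sat M e' \<phi>" using e' by blast
    qed
    finally show ?case .
  qed
  from this[OF assms(2)] show ?thesis using assms by (simp add: exs_def)
qed

subsection \<open>Patterns\<close>

lemma models_sentence:
  assumes "free_vars \<sigma> = {}" "range e \<subseteq> dom M"
  shows "models M \<sigma> \<longleftrightarrow> sat M e \<sigma>"
proof -
  have "sat M e' \<sigma> \<longleftrightarrow> sat M e \<sigma>" for e' using assms(1) by (intro sat_cong) auto
  then show ?thesis using assms(2) unfolding models_def by blast
qed

lemma holds_cong:
  assumes "partitioned L m n \<phi>" "length a = m" "length b = n"
    and "\<And>i. i < m \<Longrightarrow> e i = a ! i" and "\<And>i. i < n \<Longrightarrow> e (m + i) = b ! i"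
  shows "holds M \<phi> a b \<longleftrightarrow> sat M e \<phi>"
  unfolding holds_def
proof (rule sat_cong)
  fix i assume "i \<in> free_vars \<phi>"
  then have "i < m + n" using assms(1) unfolding partitioned_def by auto
  then show "(a @ b) ! i = e i" using assms(2,3) assms(4)[of i] assms(5)[of "i - m"]
    by (cases "i < m") (auto simp: nth_append)
qed

text \<open>A pattern consists of truth values \<open>Nm\<close> prescribed for instances \<open>\<phi>(a i, b j)\<close> and of conditions \<open>Cs\<close>
  telling for which index sets \<open>S\<close> the formulas \<open>\<phi>(x, b j)\<close> with \<open>j \<in> S\<close> have a common solution.\<close>

definition realizes ::
  "('f, 'r, 'a) struct \<Rightarrow> nat \<Rightarrow> nat \<Rightarrow> ('f, 'r) form \<Rightarrow> (nat \<times> nat \<times> bool) set \<Rightarrow> (bool \<times> nat set) set \<Rightarrow> bool" where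
  "realizes M m n \<phi> Nm Cs \<longleftrightarrow>
     (\<exists>a b. (\<forall>i::nat. a i \<in> tuples M m \<and> b i \<in> tuples M n) \<and>
            (\<forall>(i, j, s) \<in> Nm. holds M \<phi> (a i) (b j) = s) \<and>
            (\<forall>(s, S) \<in> Cs. (\<exists>x \<in> tuples M m. \<forall>j \<in> S. holds M \<phi> x (b j)) = s))"

text \<open>A variable is a coded triple of a tag, the index of a tuple and a position in it. This
  keeps infinitely many tuples apart without a bound on their lengths.\<close>

definition var :: "nat \<Rightarrow> nat \<Rightarrow> nat \<Rightarrow> nat" where
  "var t i l = to_nat (t, i, l)"

definition tup :: "(nat \<Rightarrow> 'a) \<Rightarrow> nat \<Rightarrow> nat \<Rightarrow> nat \<Rightarrow> 'a list" where
  "tup e t i k = map (\<lambda>l. e (var t i l)) [0..<k]"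

definition inst :: "nat \<Rightarrow> nat \<Rightarrow> nat \<Rightarrow> nat \<Rightarrow> ('f, 'r) form \<Rightarrow> ('f, 'r) form" where
  "inst m t i j \<phi> = ren \<phi> (\<lambda>v. if v < m then var t i v else var 1 j (v - m))"

definition lit :: "bool \<Rightarrow> ('f, 'r) form \<Rightarrow> ('f, 'r) form" where
  "lit s \<phi> = (if s then \<phi> else Neg \<phi>)"

lemma sat_lit [simp]: "sat M e (lit s \<phi>) \<longleftrightarrow> sat M e \<phi> = s"
  by (simp add: lit_def)

lemma wf_lit [simp]: "wf_form L (lit s \<phi>) = wf_form L \<phi>"
  by (simp add: lit_def)

lemma var_inject [simp]: "var t i l = var t' i' l' \<longleftrightarrow> t = t' \<and> i = i' \<and> l = l'"
  by (simp add: var_def)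

lemma wf_inst [simp]: "wf_form L (inst m t i j \<phi>) = wf_form L \<phi>"
  by (simp add: inst_def)

lemma sat_inst:
  "partitioned L m n \<phi> \<Longrightarrow> sat M e (inst m t i j \<phi>) \<longleftrightarrow> holds M \<phi> (tup e t i m) (tup e 1 j n)"
  unfolding inst_def sat_ren by (subst holds_cong[of L m n]) (auto simp: tup_def)

lemma tup_in_tuples: "range e \<subseteq> dom M \<Longrightarrow> tup e t i k \<in> tuples M k"
  unfolding tuples_def tup_def by auto

lemma ex_env:
  assumes "dom M \<noteq> {}" "\<And>t i. g t i \<in> tuples M (k t)"
  shows "\<exists>e. range e \<subseteq> dom M \<and> (\<forall>t i. tup e t i (k t) = g t i)"
proof -
  obtain d where d: "d \<in> dom M" using assms(1) by blast
  \<comment> \<open>Codes of positions beyond the length of their tuple get the default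
    \<open>d\<close>.\<close>
  define e where "e v = (case from_nat v of (t::nat, i::nat, l::nat) \<Rightarrow> if l < k t then g t i ! l else d)" for v
  have "e v \<in> dom M" for v
  proof -
    obtain t i l :: nat where v: "from_nat v = (t, i, l)" by (metis prod_cases3)
    have "g t i ! l \<in> dom M" if "l < k t" using that assms(2)[of t i] unfolding tuples_def by auto
    then show ?thesis using d v by (auto simp: e_def)
  qed
  moreover have "tup e t i (k t) = g t i" for t i
    using assms(2)[of t i] by (auto simp: tup_def var_def e_def tuples_def intro!: nth_equalityI)
  ultimately show ?thesis by blast
qed

text \<open>The variables \<open>var 0 i\<close> and \<open>var 1 j\<close> stand for the tuples \<open>a i\<close> and \<open>b j\<close>, and \<open>var 2 0\<close>
  for the quantified one.\<close>

definition witness :: "nat \<Rightarrow> ('f, 'r) form \<Rightarrow> nat list \<Rightarrow> ('f, 'r) form" where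
  "witness m \<phi> js = exs (var 2 0 ` {..<m}) (Conj (map (\<lambda>j. inst m 2 0 j \<phi>) js))"

lemma sat_witness:
  assumes "partitioned L m n \<phi>" "range e \<subseteq> dom M"
  shows "sat M e (witness m \<phi> js) \<longleftrightarrow> (\<exists>x \<in> tuples M m. \<forall>j \<in> set js. holds M \<phi> x (tup e 1 j n))"
proof -
  have "sat M e (witness m \<phi> js) \<longleftrightarrow> (\<exists>e'. range e' \<subseteq> dom M \<and>
      (\<forall>v. v \<notin> var 2 0 ` {..<m} \<longrightarrow> e' v = e v) \<and>
      (\<forall>j \<in> set js. holds M \<phi> (tup e' 2 0 m) (tup e' 1 j n)))"
    unfolding witness_def using assms by (subst sat_exs) (auto simp: sat_inst)
  also have "\<dots> \<longleftrightarrow> (\<exists>x \<in> tuples M m. \<forall>j \<in> set js. holds M \<phi> x (tup e 1 j n))"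
  proof (intro iffI; elim exE bexE conjE)
    fix e' assume e': "range e' \<subseteq> dom M" "\<forall>v. v \<notin> var 2 0 ` {..<m} \<longrightarrow> e' v = e v"
      "\<forall>j \<in> set js. holds M \<phi> (tup e' 2 0 m) (tup e' 1 j n)"
    have "var 1 j l \<notin> var 2 0 ` {..<m}" for j l by auto
    then have "tup e' 1 j n = tup e 1 j n" for j unfolding tup_def using e'(2) by (intro map_cong refl) blast
    then show "\<exists>x \<in> tuples M m. \<forall>j \<in> set js. holds M \<phi> x (tup e 1 j n)"
      using e' tup_in_tuples[OF e'(1)] by metis
  next
    fix x assume x: "x \<in> tuples M m" "\<forall>j \<in> set js. holds M \<phi> x (tup e 1 j n)"
    define e' where "e' v = (if v \<in> var 2 0 ` {..<m} then x ! snd (snd (from_nat v :: nat \<times> nat \<times> nat)) else e v)" for v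
    have "tup e' 2 0 m = x"
      using x(1) by (intro nth_equalityI) (auto simp: tup_def e'_def tuples_def, simp add: var_def)
    moreover have "tup e' 1 j n = tup e 1 j n" for j by (auto simp: tup_def e'_def)
    moreover have "e' v \<in> dom M" for v
      using x(1) assms(2) unfolding e'_def tuples_def by (auto simp: var_def)
    moreover have "e' v = e v" if v: "v \<notin> var 2 0 ` {..<m}" for v
      using v by (simp add: e'_def)
    ultimately show "\<exists>e'. range e' \<subseteq> dom M \<and> (\<forall>v. v \<notin> var 2 0 ` {..<m} \<longrightarrow> e' v = e v) \<and>
      (\<forall>j \<in> set js. holds M \<phi> (tup e' 2 0 m) (tup e' 1 j n))" using x(2) by (intro exI[of _ e']) auto
  qed
  finally show ?thesis .
qed

text \<open>The existential closure over all free variables makes realizability of a finite pattern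
  a matter of a single sentence.\<close>

definition pattern_form ::
  "nat \<Rightarrow> ('f, 'r) form \<Rightarrow> (nat \<times> nat \<times> bool) list \<Rightarrow> (bool \<times> nat list) list \<Rightarrow> ('f, 'r) form" where
  "pattern_form m \<phi> Nm Cs =
     (let \<psi> = Conj (map (\<lambda>(i, j, s). lit s (inst m 0 i j \<phi>)) Nm @ map (\<lambda>(s, js). lit s (witness m \<phi> js)) Cs)
      in exs (free_vars \<psi>) \<psi>)"

lemma models_pattern_form:
  assumes "partitioned L m n \<phi>" "dom M \<noteq> {}"
  shows "models M (pattern_form m \<phi> Nm Cs) \<longleftrightarrow> realizes M m n \<phi> (set Nm) ((\<lambda>(s, js). (s, set js)) ` set Cs)"
proof -
  define \<psi> where "\<psi> = Conj (map (\<lambda>(i, j, s). lit s (inst m 0 i j \<phi>)) Nm @ map (\<lambda>(s, js). lit s (witness m \<phi> js)) Cs)"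
  have pf: "pattern_form m \<phi> Nm Cs = exs (free_vars \<psi>) \<psi>" by (simp add: pattern_form_def \<psi>_def Let_def)
  obtain d where d: "d \<in> dom M" using assms(2) by blast
  have fv: "free_vars (exs (free_vars \<psi>) \<psi>) = {}" by (simp add: free_vars_exs)
  have "models M (pattern_form m \<phi> Nm Cs) \<longleftrightarrow> sat M (\<lambda>_. d) (exs (free_vars \<psi>) \<psi>)"
    unfolding pf using d by (intro models_sentence fv) auto
  also have "\<dots> \<longleftrightarrow> (\<exists>e. range e \<subseteq> dom M \<and> sat M e \<psi>)"
  proof -
    have "\<exists>e'. range e' \<subseteq> dom M \<and> (\<forall>i. i \<notin> free_vars \<psi> \<longrightarrow> e' i = d) \<and> sat M e' \<psi>"
      if e: "range e \<subseteq> dom M" "sat M e \<psi>" for e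
    proof -
      define e' where "e' = (\<lambda>i. if i \<in> free_vars \<psi> then e i else d)"
      have "sat M e' \<psi> = sat M e \<psi>" by (rule sat_cong) (simp add: e'_def)
      then show ?thesis using e d by (intro exI[of _ e']) (auto simp: e'_def)
    qed
    then show ?thesis using d by (subst sat_exs) auto
  qed
  also have "\<dots> \<longleftrightarrow> (\<exists>e. range e \<subseteq> dom M \<and>
      (\<forall>(i, j, s) \<in> set Nm. holds M \<phi> (tup e 0 i m) (tup e 1 j n) = s) \<and>
      (\<forall>(s, js) \<in> set Cs. (\<exists>x \<in> tuples M m. \<forall>j \<in> set js. holds M \<phi> x (tup e 1 j n)) = s))"
  proof -
    have "sat M e \<psi> \<longleftrightarrow> (\<forall>(i, j, s) \<in> set Nm. holds M \<phi> (tup e 0 i m) (tup e 1 j n) = s) \<and>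
      (\<forall>(s, js) \<in> set Cs. (\<exists>x \<in> tuples M m. \<forall>j \<in> set js. holds M \<phi> x (tup e 1 j n)) = s)"
      if that: "range e \<subseteq> dom M" for e
      unfolding \<psi>_def sat_Conj set_append ball_Un set_map ball_simps
      by (intro arg_cong2[where f = "(\<and>)"] ball_cong refl)
        (simp_all add: case_prod_unfold sat_inst[OF assms(1)] sat_witness[OF assms(1) that])
    then show ?thesis by (intro ex_cong1) (rule conj_cong[OF refl])
  qed
  also have "\<dots> \<longleftrightarrow> (\<exists>a b. (\<forall>i::nat. a i \<in> tuples M m \<and> b i \<in> tuples M n) \<and>
      (\<forall>(i, j, s) \<in> set Nm. holds M \<phi> (a i) (b j) = s) \<and>
      (\<forall>(s, js) \<in> set Cs. (\<exists>x \<in> tuples M m. \<forall>j \<in> set js. holds M \<phi> x (b j)) = s))"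
  proof (rule iffI; elim exE conjE)
    fix e assume e: "range e \<subseteq> dom M"
      "\<forall>(i, j, s) \<in> set Nm. holds M \<phi> (tup e 0 i m) (tup e 1 j n) = s"
      "\<forall>(s, js) \<in> set Cs. (\<exists>x \<in> tuples M m. \<forall>j \<in> set js. holds M \<phi> x (tup e 1 j n)) = s"
    then show "\<exists>a b. (\<forall>i::nat. a i \<in> tuples M m \<and> b i \<in> tuples M n) \<and>
      (\<forall>(i, j, s) \<in> set Nm. holds M \<phi> (a i) (b j) = s) \<and>
      (\<forall>(s, js) \<in> set Cs. (\<exists>x \<in> tuples M m. \<forall>j \<in> set js. holds M \<phi> x (b j)) = s)"
      by (rule_tac exI[of _ "\<lambda>i. tup e 0 i m"], rule_tac exI[of _ "\<lambda>i. tup e 1 i n"])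
        (intro conjI allI tup_in_tuples)
  next
    fix a b assume ab: "\<forall>i::nat. a i \<in> tuples M m \<and> b i \<in> tuples M n"
      "\<forall>(i, j, s) \<in> set Nm. holds M \<phi> (a i) (b j) = s"
      "\<forall>(s, js) \<in> set Cs. (\<exists>x \<in> tuples M m. \<forall>j \<in> set js. holds M \<phi> x (b j)) = s"
    \<comment> \<open>Tags 0 and 1 carry the tuples \<open>a i\<close> and \<open>b i\<close>; every
      other tag gets the empty tuple.\<close>
    define k where "k = (\<lambda>t::nat. if t = 0 then m else if t = 1 then n else (0::nat))"
    define g where "g = (\<lambda>t i. if t = 0 then a i else if t = (1::nat) then b i else [])"
    have "g t i \<in> tuples M (k t)" for t i
      using ab(1) by (auto simp: k_def g_def tuples_def)
    then obtain e where e: "range e \<subseteq> dom M" "\<forall>t i. tup e t i (k t) = g t i"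
      using ex_env[OF assms(2)] by blast
    have t: "tup e 0 i m = a i" "tup e 1 i n = b i" for i
      using e(2)[THEN spec, THEN spec, of 0 i] e(2)[THEN spec, THEN spec, of 1 i] by (simp_all add: k_def g_def)
    show "\<exists>e. range e \<subseteq> dom M \<and>
      (\<forall>(i, j, s) \<in> set Nm. holds M \<phi> (tup e 0 i m) (tup e 1 j n) = s) \<and>
      (\<forall>(s, js) \<in> set Cs. (\<exists>x \<in> tuples M m. \<forall>j \<in> set js. holds M \<phi> x (tup e 1 j n)) = s)"
      by (rule exI[of _ e]) (intro conjI e(1), unfold t, rule ab(2), rule ab(3))
  qed
  also have "\<dots> \<longleftrightarrow> realizes M m n \<phi> (set Nm) ((\<lambda>(s, js). (s, set js)) ` set Cs)"
    unfolding realizes_def by (simp add: case_prod_unfold)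
  finally show ?thesis .
qed

lemma pattern_form_sentence:
  assumes "partitioned L m n \<phi>"
  shows "pattern_form m \<phi> Nm Cs \<in> sentences L"
proof -
  have "wf_form L \<phi>" using assms by (simp add: partitioned_def)
  then show ?thesis
    by (auto simp: sentences_def pattern_form_def Let_def free_vars_exs witness_def)
qed

lemma ball_subset: "A \<subseteq> B \<Longrightarrow> \<forall>x \<in> B. P x \<Longrightarrow> \<forall>x \<in> A. P x"
  by blast

lemma realizes_subset:
  assumes "realizes M m n \<phi> Nm Cs" "Nm' \<subseteq> Nm" "Cs' \<subseteq> Cs"
  shows "realizes M m n \<phi> Nm' Cs'"
proof -
  obtain a b where ab: "\<forall>i::nat. a i \<in> tuples M m \<and> b i \<in> tuples M n"
    "\<forall>(i, j, s) \<in> Nm. holds M \<phi> (a i) (b j) = s"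
    "\<forall>(s, S) \<in> Cs. (\<exists>x \<in> tuples M m. \<forall>j \<in> S. holds M \<phi> x (b j)) = s"
    using assms(1) unfolding realizes_def by (elim exE conjE)
  show ?thesis unfolding realizes_def
    by (rule exI[of _ a], rule exI[of _ b])
      (intro conjI ab(1) ball_subset[OF assms(2) ab(2)] ball_subset[OF assms(3) ab(3)])
qed

text \<open>A finite pattern is one sentence, and the complete theory of \<open>A\<close> contains
  this sentence or its negation.\<close>

lemma realizes_elementary:
  assumes "is_struct L A" "is_model L (complete_theory L A) M" "partitioned L m n \<phi>"
    and "realizes M m n \<phi> Nm Cs" "finite Nm" "finite Cs" "\<And>s S. (s, S) \<in> Cs \<Longrightarrow> finite S"
  shows "realizes A m n \<phi> Nm Cs"
proof -
  obtain Nl where Nl: "set Nl = Nm" using assms(5) finite_list by blast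
  obtain Cl0 where Cl0: "set Cl0 = Cs" using assms(6) finite_list by blast
  define Cl where "Cl = map (\<lambda>(s, S). (s, sorted_list_of_set S)) Cl0"
  have Cl: "(\<lambda>(s, js). (s, set js)) ` set Cl = Cs"
    using assms(7) unfolding Cl_def Cl0[symmetric] by (force simp: image_iff)
  have ne: "dom A \<noteq> {}" "dom M \<noteq> {}" using assms(1,2) by (auto simp: is_model_def is_struct_def)
  let ?\<sigma> = "pattern_form m \<phi> Nl Cl"
  have M: "models M ?\<sigma>" using assms(4) by (subst models_pattern_form[OF assms(3) ne(2)]) (simp add: Nl Cl)
  have "models A ?\<sigma>"
  proof (rule ccontr)
    assume neg: "\<not> models A ?\<sigma>"
    obtain d where d: "d \<in> dom A" using ne by blast
    obtain d' where d': "d' \<in> dom M" using ne by blast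
    have s: "?\<sigma> \<in> sentences L" "Neg ?\<sigma> \<in> sentences L"
      using pattern_form_sentence[OF assms(3), of Nl Cl] by (auto simp: sentences_def)
    then have "models A (Neg ?\<sigma>)" using neg d
      by (subst (asm) models_sentence[of _ "\<lambda>_. d"], force simp: sentences_def, force)
        (subst models_sentence[of _ "\<lambda>_. d"], auto simp: sentences_def)
    then have "models M (Neg ?\<sigma>)" using assms(2) s unfolding is_model_def complete_theory_def by blast
    then show False using M d' s unfolding models_def by fastforce
  qed
  then show ?thesis by (subst (asm) models_pattern_form[OF assms(3) ne(1)]) (simp add: Nl Cl)
qed

subsection \<open>Ultrapowers inside an infinite type\<close>

text \<open>Zorn's lemma for families all of whose finite intersections are infinite. Asking for
  infinite rather than nonempty intersections puts every cofinite set into a maximal family.\<close>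

lemma ex_ultrafilter:
  "\<exists>U :: nat set set. {} \<notin> U \<and> (\<forall>A B. A \<in> U \<longrightarrow> A \<subseteq> B \<longrightarrow> B \<in> U) \<and>
     (\<forall>A B. A \<in> U \<longrightarrow> B \<in> U \<longrightarrow> A \<inter> B \<in> U) \<and> (\<forall>A. A \<in> U \<or> - A \<in> U) \<and> (\<forall>A. finite (- A) \<longrightarrow> A \<in> U)"
proof -
  define fip :: "nat set set \<Rightarrow> bool" where "fip F \<longleftrightarrow> (\<forall>X \<subseteq> F. finite X \<longrightarrow> infinite (\<Inter>X))" for F
  have "\<exists>F \<in> {F. fip F}. \<forall>X \<in> {F. fip F}. F \<subseteq> X \<longrightarrow> X = F"
  proof (rule subset_Zorn_nonempty)
    have "fip {}" by (simp add: fip_def)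
    then show "{F. fip F} \<noteq> {}" by blast
  next
    fix \<C> assume C: "\<C> \<noteq> {}" "subset.chain {F. fip F} \<C>"
    have "infinite (\<Inter>X)" if X: "X \<subseteq> \<Union>\<C>" "finite X" for X
    proof -
      obtain F where "F \<in> \<C>" "X \<subseteq> F" using finite_subset_Union_chain[OF X(2,1) C(1)] C(2) by blast
      then show ?thesis using C(2) X(2) unfolding subset_chain_def fip_def by blast
    qed
    then show "\<Union>\<C> \<in> {F. fip F}" by (simp add: fip_def)
  qed
  then obtain U where U: "fip U" and max: "\<And>X. fip X \<Longrightarrow> U \<subseteq> X \<Longrightarrow> X = U" by blast
  \<comment> \<open>Maximality: a set that meets every finite intersection in an infinite set can be
    added, hence is already there.\<close>
  have add: "B \<in> U" if B: "\<And>X. X \<subseteq> U \<Longrightarrow> finite X \<Longrightarrow> infinite (B \<inter> \<Inter>X)" for B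
  proof -
    have "infinite (\<Inter>X)" if X: "X \<subseteq> insert B U" "finite X" for X
    proof -
      have "B \<inter> \<Inter>(X - {B}) \<subseteq> \<Inter>X" by blast
      moreover have "infinite (B \<inter> \<Inter>(X - {B}))" using B[of "X - {B}"] X by blast
      ultimately show ?thesis using finite_subset by blast
    qed
    then have "fip (insert B U)" by (simp add: fip_def)
    then show ?thesis using max by blast
  qed
  have fin: "infinite (\<Inter>X)" if "X \<subseteq> U" "finite X" for X using U that by (simp add: fip_def)
  have "{} \<notin> U" using fin[of "{{}}"] by auto
  moreover have "B \<in> U" if "A \<in> U" "A \<subseteq> B" for A B
  proof (rule add)
    fix X assume "X \<subseteq> U" "finite X"
    then have "infinite (\<Inter>(insert A X))" using that by (intro fin) auto
    moreover have "\<Inter>(insert A X) \<subseteq> B \<inter> \<Inter>X" using that by blast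
    ultimately show "infinite (B \<inter> \<Inter>X)" using finite_subset by blast
  qed
  moreover have "A \<inter> B \<in> U" if "A \<in> U" "B \<in> U" for A B
  proof (rule add)
    fix X assume "X \<subseteq> U" "finite X"
    then have "infinite (\<Inter>(insert A (insert B X)))" using that by (intro fin) auto
    then show "infinite (A \<inter> B \<inter> \<Inter>X)" by (simp add: Int_assoc)
  qed
  moreover have "A \<in> U \<or> - A \<in> U" for A
  proof (rule ccontr)
    assume "\<not> (A \<in> U \<or> - A \<in> U)"
    then obtain X Y where X: "X \<subseteq> U" "finite X" "finite (A \<inter> \<Inter>X)"
      and Y: "Y \<subseteq> U" "finite Y" "finite (- A \<inter> \<Inter>Y)" using add by meson
    have "\<Inter>(X \<union> Y) \<subseteq> (A \<inter> \<Inter>X) \<union> (- A \<inter> \<Inter>Y)" by blast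
    then have "finite (\<Inter>(X \<union> Y))" using X(3) Y(3) finite_subset by blast
    then show False using fin[of "X \<union> Y"] X Y by blast
  qed
  moreover have "A \<in> U" if "finite (- A)" for A
  proof (rule add)
    fix X assume "X \<subseteq> U" "finite X"
    then have "infinite (\<Inter>X)" by (rule fin)
    moreover have "\<Inter>X \<subseteq> (A \<inter> \<Inter>X) \<union> - A" by blast
    ultimately show "infinite (A \<inter> \<Inter>X)" using that by (meson finite_Un finite_subset)
  qed
  ultimately show ?thesis by (intro exI[of _ U]) blast
qed

text \<open>The ultrapower is restricted to a set \<open>F\<close> of sequences that is closed under the operations and
  contains witnesses for all existential formulas.  A countable such \<open>F\<close> exists, so that the restricted
  ultrapower can be realized on a subset of any infinite type.\<close>

locale reduced_power =
  fixes L :: "('f, 'r) language" and A :: "('f, 'r, 'a) struct" and U :: "nat set set"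
    and F :: "(nat \<Rightarrow> 'a) set" and \<pi> :: "(nat \<Rightarrow> 'a) \<Rightarrow> 'u"
  assumes A: "is_struct L A"
    and U_empty: "{} \<notin> U"
    and U_mono: "X \<in> U \<Longrightarrow> X \<subseteq> Y \<Longrightarrow> Y \<in> U"
    and U_inter: "X \<in> U \<Longrightarrow> Y \<in> U \<Longrightarrow> X \<inter> Y \<in> U"
    and U_ultra: "X \<in> U \<or> - X \<in> U"
    and F_nonempty: "F \<noteq> {}"
    and F_dom: "s \<in> F \<Longrightarrow> s N \<in> dom A"
    and F_fn: "(f, length l) \<in> funs L \<Longrightarrow> set l \<subseteq> F \<Longrightarrow> (\<lambda>N. fn A f (map (\<lambda>s. s N) l)) \<in> F"
    and F_witness: "(\<And>v::nat. t v \<in> F) \<Longrightarrow> \<exists>g \<in> F. \<forall>N. (\<exists>a \<in> dom A. sat A ((\<lambda>v. t v N)(i := a)) \<phi>) \<longrightarrow>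
        sat A ((\<lambda>v. t v N)(i := g N)) \<phi>"
    and \<pi>_eq: "s \<in> F \<Longrightarrow> s' \<in> F \<Longrightarrow> \<pi> s = \<pi> s' \<longleftrightarrow> {N. s N = s' N} \<in> U"
begin

section \<open>Los's theorem for the restricted ultrapower\<close>

lemma U_impI: "{N. P N} \<in> U \<Longrightarrow> (\<And>N. P N \<Longrightarrow> Q N) \<Longrightarrow> {N. Q N} \<in> U"
  by (erule U_mono) auto

lemma U_conj: "{N. P N \<and> Q N} \<in> U \<longleftrightarrow> {N. P N} \<in> U \<and> {N. Q N} \<in> U"
  using U_inter[of "{N. P N}" "{N. Q N}"] by (auto simp: Collect_conj_eq elim: U_mono)

lemma U_neg: "{N. \<not> P N} \<in> U \<longleftrightarrow> {N. P N} \<notin> U"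
proof -
  have "{N. \<not> P N} = - {N. P N}" by auto
  moreover have "{N. P N} \<in> U \<Longrightarrow> - {N. P N} \<notin> U" using U_inter U_empty by fastforce
  ultimately show ?thesis using U_ultra[of "{N. P N}"] by auto
qed

lemma U_UNIV: "UNIV \<in> U"
  using U_ultra[of UNIV] U_empty by simp

lemma U_ball: "finite I \<Longrightarrow> (\<And>i. i \<in> I \<Longrightarrow> {N. P i N} \<in> U) \<Longrightarrow> {N. \<forall>i \<in> I. P i N} \<in> U"
  by (induction I rule: finite_induct) (auto simp: U_UNIV U_conj)

lemma U_cong: "{N. P N = Q N} \<in> U \<Longrightarrow> {N. P N} \<in> U \<longleftrightarrow> {N. Q N} \<in> U"
proof -
  assume *: "{N. P N = Q N} \<in> U"
  have "{N. Q N} \<in> U" if "{N. P N} \<in> U"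
    using U_inter[OF * that] by (rule U_mono) auto
  moreover have "{N. P N} \<in> U" if "{N. Q N} \<in> U"
    using U_inter[OF * that] by (rule U_mono) auto
  ultimately show ?thesis by blast
qed

definition rep :: "'u \<Rightarrow> nat \<Rightarrow> 'a" where
  "rep x = (SOME s. s \<in> F \<and> \<pi> s = x)"

text \<open>Operations are computed on chosen representatives; up to \<open>U\<close> the choice
  does not matter, which is \<open>fn_power\<close> and \<open>rel_power\<close>.\<close>

definition power :: "('f, 'r, 'u) struct" where
  "power = \<lparr>dom = \<pi> ` F, fn = (\<lambda>f as. \<pi> (\<lambda>N. fn A f (map (\<lambda>x. rep x N) as))),
     rel = (\<lambda>r as. {N. rel A r (map (\<lambda>x. rep x N) as)} \<in> U)\<rparr>"

lemma dom_power [simp]: "dom power = \<pi> ` F"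
  by (simp add: power_def)

lemma rep: "s \<in> F \<Longrightarrow> rep (\<pi> s) \<in> F \<and> \<pi> (rep (\<pi> s)) = \<pi> s"
  unfolding rep_def by (rule someI[of _ s]) simp

lemma rep_list:
  assumes "set l \<subseteq> F"
  shows "{N. map (\<lambda>x. rep x N) (map \<pi> l) = map (\<lambda>s. s N) l} \<in> U"
proof -
  have "{N. \<forall>s \<in> set l. rep (\<pi> s) N = s N} \<in> U"
    using assms rep \<pi>_eq by (intro U_ball) blast+
  then show ?thesis by (rule U_impI) auto
qed

lemma fn_power:
  assumes "(f, length l) \<in> funs L" "set l \<subseteq> F"
  shows "fn power f (map \<pi> l) = \<pi> (\<lambda>N. fn A f (map (\<lambda>s. s N) l))"
proof -
  define l' where "l' = map (\<lambda>s. rep (\<pi> s)) l"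
  have "set l' \<subseteq> F" using assms(2) rep unfolding l'_def by auto
  then have F': "(\<lambda>N. fn A f (map (\<lambda>s. s N) l')) \<in> F"
    using assms(1) by (intro F_fn) (auto simp: l'_def)
  have e: "map (\<lambda>s. s N) l' = map (\<lambda>x. rep x N) (map \<pi> l)" for N by (simp add: l'_def)
  have "{N. fn A f (map (\<lambda>s. s N) l') = fn A f (map (\<lambda>s. s N) l)} \<in> U"
    unfolding e using rep_list[OF assms(2)] by (rule U_impI) (simp only:)
  then have "\<pi> (\<lambda>N. fn A f (map (\<lambda>s. s N) l')) = \<pi> (\<lambda>N. fn A f (map (\<lambda>s. s N) l))"
    using \<pi>_eq[OF F' F_fn[OF assms]] by blast
  then show ?thesis unfolding e by (simp only: power_def struct.simps)
qed

lemma rel_power: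
  assumes "set l \<subseteq> F"
  shows "rel power r (map \<pi> l) \<longleftrightarrow> {N. rel A r (map (\<lambda>s. s N) l)} \<in> U"
  unfolding power_def struct.simps by (rule U_cong[OF U_impI[OF rep_list[OF assms]]]) (simp only:)

lemma val_power:
  assumes "\<And>v. t v \<in> F"
  shows "wf_trm L u \<Longrightarrow> (\<lambda>N. val A (\<lambda>v. t v N) u) \<in> F \<and>
    val power (\<lambda>v. \<pi> (t v)) u = \<pi> (\<lambda>N. val A (\<lambda>v. t v N) u)"
proof (induction u)
  case (Var i)
  then show ?case using assms by simp
next
  case (App f us)
  define l where "l = map (\<lambda>u N. val A (\<lambda>v. t v N) u) us"
  have l: "set l \<subseteq> F" using App by (auto simp: l_def list_all_iff)
  have f: "(f, length l) \<in> funs L" using App.prems by (simp add: l_def)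
  have m: "map (val power (\<lambda>v. \<pi> (t v))) us = map \<pi> l" using App by (auto simp: l_def list_all_iff)
  have v: "map (val A (\<lambda>v. t v N)) us = map (\<lambda>s. s N) l" for N by (simp add: l_def)
  show ?case using F_fn[OF f l] fn_power[OF f l] unfolding val.simps m v by blast
qed

text \<open>Los's theorem. Not every sequence is available in \<open>F\<close>, so in the
  existential case the sequence of witnesses is taken from \<open>F_witness\<close>.\<close>

theorem los:
  assumes "\<And>v. t v \<in> F"
  shows "wf_form L \<phi> \<Longrightarrow> sat power (\<lambda>v. \<pi> (t v)) \<phi> \<longleftrightarrow> {N. sat A (\<lambda>v. t v N) \<phi>} \<in> U"
  using assms
proof (induction \<phi> arbitrary: t)
  case (Eq u u')
  then have "wf_trm L u" "wf_trm L u'" by auto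
  then show ?case using val_power[of t u] val_power[of t u'] \<pi>_eq Eq.prems(2) by simp
next
  case (Atom r us)
  define l where "l = map (\<lambda>u N. val A (\<lambda>v. t v N) u) us"
  have "wf_trm L u" if "u \<in> set us" for u using that Atom.prems by (auto simp: list_all_iff)
  then have vp: "(\<lambda>N. val A (\<lambda>v. t v N) u) \<in> F \<and> val power (\<lambda>v. \<pi> (t v)) u = \<pi> (\<lambda>N. val A (\<lambda>v. t v N) u)"
    if "u \<in> set us" for u using that val_power[of t u] Atom.prems by blast
  have l: "set l \<subseteq> F" using vp by (auto simp: l_def)
  have m: "map (val power (\<lambda>v. \<pi> (t v))) us = map \<pi> l" using vp by (auto simp: l_def)
  have v: "map (val A (\<lambda>v. t v N)) us = map (\<lambda>s. s N) l" for N by (simp add: l_def)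
  show ?case using rel_power[OF l] unfolding sat.simps m v by blast
next
  case (Neg \<phi>)
  have "sat power (\<lambda>v. \<pi> (t v)) \<phi> \<longleftrightarrow> {N. sat A (\<lambda>v. t v N) \<phi>} \<in> U"
    by (rule Neg.IH) (use Neg.prems in auto)
  then show ?case by (simp add: U_neg)
next
  case (And \<phi> \<psi>)
  have "sat power (\<lambda>v. \<pi> (t v)) \<phi> \<longleftrightarrow> {N. sat A (\<lambda>v. t v N) \<phi>} \<in> U"
    by (rule And.IH) (use And.prems in auto)
  moreover have "sat power (\<lambda>v. \<pi> (t v)) \<psi> \<longleftrightarrow> {N. sat A (\<lambda>v. t v N) \<psi>} \<in> U"
    by (rule And.IH) (use And.prems in auto)
  ultimately show ?case by (simp add: U_conj)
next
  case (Ex i \<phi>)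
  have IH: "sat power ((\<lambda>v. \<pi> (t v))(i := \<pi> g)) \<phi> \<longleftrightarrow> {N. sat A ((\<lambda>v. t v N)(i := g N)) \<phi>} \<in> U"
    if "g \<in> F" for g
  proof -
    have "sat power (\<lambda>v. \<pi> ((t(i := g)) v)) \<phi> \<longleftrightarrow> {N. sat A (\<lambda>v. (t(i := g)) v N) \<phi>} \<in> U"
      by (rule Ex.IH) (use Ex.prems that in auto)
    moreover have "(\<lambda>v. \<pi> ((t(i := g)) v)) = (\<lambda>v. \<pi> (t v))(i := \<pi> g)"
      "(\<lambda>v. (t(i := g)) v N) = (\<lambda>v. t v N)(i := g N)" for N by auto
    ultimately show ?thesis by (simp only:)
  qed
  show ?case
  proof
    assume "sat power (\<lambda>v. \<pi> (t v)) (Ex i \<phi>)"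
    then obtain g where g: "g \<in> F" "{N. sat A ((\<lambda>v. t v N)(i := g N)) \<phi>} \<in> U" using IH by auto
    show "{N. sat A (\<lambda>v. t v N) (Ex i \<phi>)} \<in> U"
      using g(2) by (rule U_impI) (use F_dom[OF g(1)] in auto)
  next
    assume *: "{N. sat A (\<lambda>v. t v N) (Ex i \<phi>)} \<in> U"
    obtain g where g: "g \<in> F" "\<forall>N. (\<exists>a \<in> dom A. sat A ((\<lambda>v. t v N)(i := a)) \<phi>) \<longrightarrow>
        sat A ((\<lambda>v. t v N)(i := g N)) \<phi>" using F_witness[of t] Ex.prems(2) by blast
    have "{N. sat A ((\<lambda>v. t v N)(i := g N)) \<phi>} \<in> U"
      using * by (rule U_impI) (use g(2) in auto)
    then show "sat power (\<lambda>v. \<pi> (t v)) (Ex i \<phi>)" using IH[OF g(1)] g(1) by auto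
  qed
qed

lemma image_list:
  assumes "set as \<subseteq> \<pi> ` F"
  obtains l where "as = map \<pi> l" "set l \<subseteq> F"
proof -
  have "\<forall>x \<in> set as. \<exists>s. s \<in> F \<and> x = \<pi> s" using assms by blast
  then obtain h where h: "\<forall>x \<in> set as. h x \<in> F \<and> x = \<pi> (h x)" by metis
  then have "as = map \<pi> (map h as)" "set (map h as) \<subseteq> F" by (auto intro!: nth_equalityI)
  then show ?thesis using that by blast
qed

lemma power_model: "is_model L (complete_theory L A) power"
  unfolding is_model_def
proof (intro conjI ballI)
  have "fn power f as \<in> \<pi> ` F" if f: "(f, length as) \<in> funs L" and as: "set as \<subseteq> \<pi> ` F" for f as
  proof -
    obtain l where l: "as = map \<pi> l" "set l \<subseteq> F" using as by (rule image_list)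
    have "(f, length l) \<in> funs L" using l(1) f by simp
    then show ?thesis unfolding l(1) using fn_power[of f l] F_fn[of f l] l(2) by auto
  qed
  then show "is_struct L power" using F_nonempty by (auto simp: is_struct_def)
next
  fix \<sigma> assume \<sigma>: "\<sigma> \<in> complete_theory L A"
  obtain s0 where s0: "s0 \<in> F" using F_nonempty by blast
  have wf: "wf_form L \<sigma>" "free_vars \<sigma> = {}" and mod: "models A \<sigma>"
    using \<sigma> by (auto simp: complete_theory_def sentences_def)
  have "sat A (\<lambda>v. s0 N) \<sigma>" for N
    using mod[unfolded models_def, THEN spec, of "\<lambda>v. s0 N"] F_dom[OF s0] by auto
  then have "sat power (\<lambda>v. \<pi> s0) \<sigma>" using los[of "\<lambda>_. s0" \<sigma>] s0 wf by (simp add: U_UNIV)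
  then show "models power \<sigma>" using models_sentence[OF wf(2), of "\<lambda>v. \<pi> s0" power] s0 by auto
qed

lemma holds_power:
  assumes "partitioned L m n \<phi>" "length a = m" "length b = n" "set a \<subseteq> F" "set b \<subseteq> F"
  shows "holds power \<phi> (map \<pi> a) (map \<pi> b) \<longleftrightarrow> {N. holds A \<phi> (map (\<lambda>s. s N) a) (map (\<lambda>s. s N) b)} \<in> U"
proof -
  obtain s0 where s0: "s0 \<in> F" using F_nonempty by blast
  define t where "t v = (if v < m + n then (a @ b) ! v else s0)" for v
  have t: "t v \<in> F" for v
  proof (cases "v < m + n")
    case True
    then have "(a @ b) ! v \<in> set (a @ b)" using assms(2,3) by (intro nth_mem) simp
    then show ?thesis using True assms(4,5) by (auto simp: t_def)
  qed (simp add: t_def s0)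
  have "holds power \<phi> (map \<pi> a) (map \<pi> b) \<longleftrightarrow> sat power (\<lambda>v. \<pi> (t v)) \<phi>"
    using assms(2,3) by (intro holds_cong[OF assms(1)]) (auto simp: t_def nth_append)
  moreover have "holds A \<phi> (map (\<lambda>s. s N) a) (map (\<lambda>s. s N) b) \<longleftrightarrow> sat A (\<lambda>v. t v N) \<phi>" for N
    using assms(2,3) by (intro holds_cong[OF assms(1)]) (auto simp: t_def nth_append)
  ultimately show ?thesis using los[OF t] assms(1) by (simp add: partitioned_def)
qed

end

section \<open>Countable Skolem closures and compactness\<close>

text \<open>The closure consists of the values of all terms in a structure on sequences whose
  function symbols are those of the language together with one Skolem function for each variable and
  formula. Over countably many symbols there are countably many terms.\<close>

lemma countable_skolem_closure:
  fixes A :: "('f :: countable, 'r :: countable, 'a) struct" and I :: "(nat \<Rightarrow> 'a) set"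
  assumes A: "is_struct L A" and I: "countable I" "I \<noteq> {}" "\<forall>s \<in> I. \<forall>N. s N \<in> dom A"
  shows "\<exists>F. countable F \<and> I \<subseteq> F \<and> (\<forall>s \<in> F. \<forall>N. s N \<in> dom A) \<and>
    (\<forall>f l. (f, length l) \<in> funs L \<longrightarrow> set l \<subseteq> F \<longrightarrow> (\<lambda>N. fn A f (map (\<lambda>s. s N) l)) \<in> F) \<and>
    (\<forall>(t :: nat \<Rightarrow> nat \<Rightarrow> 'a) i (\<phi> :: ('f, 'r) form). (\<forall>v. t v \<in> F) \<longrightarrow>
      (\<exists>g \<in> F. \<forall>N. (\<exists>a \<in> dom A. sat A ((\<lambda>v. t v N)(i := a)) \<phi>) \<longrightarrow> sat A ((\<lambda>v. t v N)(i := g N)) \<phi>))"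
proof -
  obtain d where d: "d \<in> dom A" using A by (auto simp: is_struct_def)
  define w where "w e i \<phi> = (SOME a. a \<in> dom A \<and> ((\<exists>a \<in> dom A. sat A (e(i := a)) \<phi>) \<longrightarrow> sat A (e(i := a)) \<phi>))"
    for e i and \<phi> :: "('f, 'r) form"
  have w: "w e i \<phi> \<in> dom A \<and> ((\<exists>a \<in> dom A. sat A (e(i := a)) \<phi>) \<longrightarrow> sat A (e(i := w e i \<phi>)) \<phi>)" for e i \<phi>
    unfolding w_def by (rule someI_ex) (use d in blast)
  \<comment> \<open>Each symbol accepts lists of any length. The default \<open>d\<close> covers
    values outside the domain, as for a wrong arity, and variables beyond the length of the list, so
    every result stays in the domain.\<close>
  define op :: "'f + nat \<times> ('f, 'r) form \<Rightarrow> (nat \<Rightarrow> 'a) list \<Rightarrow> nat \<Rightarrow> 'a" where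
    "op = (\<lambda>h l N. case h of
       Inl f \<Rightarrow> if fn A f (map (\<lambda>s. s N) l) \<in> dom A then fn A f (map (\<lambda>s. s N) l) else d
     | Inr (i, \<phi>) \<Rightarrow> w (\<lambda>v. if v < length l then (l ! v) N else d) i \<phi>)"
  define S :: "('f + nat \<times> ('f, 'r) form, unit, nat \<Rightarrow> 'a) struct" where
    "S = \<lparr>dom = UNIV, fn = op, rel = (\<lambda>_ _. False)\<rparr>"
  define F where "F = range (val S (from_nat_into I))"
  have closed: "op h l \<in> F" if l: "set l \<subseteq> F" for h l
  proof -
    have "\<exists>ts. l = map (val S (from_nat_into I)) ts" using l unfolding ex_map_conv F_def by auto
    then obtain ts where ts: "l = map (val S (from_nat_into I)) ts" by blast
    have "op h l = val S (from_nat_into I) (App h ts)" by (simp add: ts S_def)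
    then show ?thesis unfolding F_def by blast
  qed
  have op_dom: "op h l N \<in> dom A" for h l N
    using d w by (auto simp: op_def split: sum.split)
  have F_dom: "s N \<in> dom A" if s: "s \<in> F" for s N
  proof -
    obtain u where u: "s = val S (from_nat_into I) u" using s unfolding F_def by blast
    have "val S (from_nat_into I) u N \<in> dom A"
    proof (cases u)
      case (Var v)
      then show ?thesis using I(3) from_nat_into[OF I(2)] by simp
    next
      case (App h us)
      then show ?thesis using op_dom by (simp add: S_def)
    qed
    then show ?thesis by (simp add: u)
  qed
  have "countable F" unfolding F_def by simp
  moreover have "I \<subseteq> F"
  proof
    fix s assume "s \<in> I"
    then obtain v where "s = from_nat_into I v" using I(1) from_nat_into_surj by metis
    then have "s = val S (from_nat_into I) (Var v)" by simp
    then show "s \<in> F" unfolding F_def by blast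
  qed
  moreover have "(\<lambda>N. fn A f (map (\<lambda>s. s N) l)) \<in> F" if f: "(f, length l) \<in> funs L" "set l \<subseteq> F" for f l
  proof -
    have "fn A f (map (\<lambda>s. s N) l) \<in> dom A" for N
    proof -
      have "set (map (\<lambda>s. s N) l) \<subseteq> dom A" using f(2) F_dom by auto
      then show ?thesis using A f(1) unfolding is_struct_def by fastforce
    qed
    then have "op (Inl f) l = (\<lambda>N. fn A f (map (\<lambda>s. s N) l))" by (auto simp: op_def)
    then show ?thesis using closed[OF f(2), of "Inl f"] by simp
  qed
  moreover have "\<exists>g \<in> F. \<forall>N. (\<exists>a \<in> dom A. sat A ((\<lambda>v. t v N)(i := a)) \<phi>) \<longrightarrow> sat A ((\<lambda>v. t v N)(i := g N)) \<phi>"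
    if t: "\<And>v. t v \<in> F" for t :: "nat \<Rightarrow> nat \<Rightarrow> 'a" and i and \<phi> :: "('f, 'r) form"
  proof -
    \<comment> \<open>Only the first \<open>K\<close> sequences can influence the truth of
      \<open>\<phi>\<close>, so a finite list of arguments is enough for the Skolem
      function.\<close>
    define K where "K = Suc (Max (insert 0 (free_vars \<phi>)))"
    have K: "v < K" if "v \<in> free_vars \<phi>" for v using that by (auto simp: K_def less_Suc_eq_le)
    define l where "l = map t [0..<K]"
    define g where "g = op (Inr (i, \<phi>)) l"
    have "g \<in> F" unfolding g_def by (rule closed) (use t in \<open>auto simp: l_def\<close>)
    moreover have "sat A ((\<lambda>v. t v N)(i := g N)) \<phi>" if a: "a \<in> dom A" "sat A ((\<lambda>v. t v N)(i := a)) \<phi>" for N a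
    proof -
      define e where "e v = (if v < length l then (l ! v) N else d)" for v
      have e: "sat A (e(i := b)) \<phi> \<longleftrightarrow> sat A ((\<lambda>v. t v N)(i := b)) \<phi>" for b
        by (rule sat_cong) (use K in \<open>auto simp: e_def l_def\<close>)
      have g: "g N = w e i \<phi>" unfolding g_def op_def e_def by simp
      have "sat A (e(i := a)) \<phi>" using a(2) e by blast
      then have "sat A (e(i := g N)) \<phi>" using w[of e i \<phi>] a(1) unfolding g by blast
      then show ?thesis using e by blast
    qed
    ultimately show ?thesis by blast
  qed
  ultimately show ?thesis using F_dom by (intro exI[of _ F]) simp
qed

text \<open>For equivalent elements the two predicates used in the choice coincide, hence so do the
  chosen representatives. Being countably many, the representatives embed into any infinite
  type.\<close>

lemma ex_quotient_map:
  assumes F: "countable F" and E: "\<And>s. s \<in> F \<Longrightarrow> E s s" "\<And>s t. s \<in> F \<Longrightarrow> t \<in> F \<Longrightarrow> E s t \<Longrightarrow> E t s"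
    "\<And>s t u. s \<in> F \<Longrightarrow> t \<in> F \<Longrightarrow> u \<in> F \<Longrightarrow> E s t \<Longrightarrow> E t u \<Longrightarrow> E s u"
  shows "\<exists>\<pi> :: 's \<Rightarrow> 'u::infinite. \<forall>s \<in> F. \<forall>t \<in> F. \<pi> s = \<pi> t \<longleftrightarrow> E s t"
proof -
  obtain \<iota> :: "nat \<Rightarrow> 'u" where \<iota>: "inj \<iota>"
    using infinite_countable_subset[OF infinite_UNIV] by blast
  define c where "c s = (SOME t. t \<in> F \<and> E s t)" for s
  have c: "c s \<in> F \<and> E s (c s)" if "s \<in> F" for s
    unfolding c_def by (rule someI[of _ s]) (use that E(1) in blast)
  have "c s = c t \<longleftrightarrow> E s t" if "s \<in> F" "t \<in> F" for s t
  proof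
    assume "c s = c t"
    then show "E s t" using c[OF that(1)] c[OF that(2)] E that by metis
  next
    assume "E s t"
    then have "(\<lambda>u. u \<in> F \<and> E s u) = (\<lambda>u. u \<in> F \<and> E t u)" using E that by metis
    then show "c s = c t" by (simp add: c_def)
  qed
  moreover have "\<iota> (to_nat_on F (c s)) = \<iota> (to_nat_on F (c t)) \<longleftrightarrow> c s = c t" if "s \<in> F" "t \<in> F" for s t
    using \<iota> c[OF that(1)] c[OF that(2)] F by (simp add: inj_eq)
  ultimately show ?thesis by (intro exI[of _ "\<lambda>s. \<iota> (to_nat_on F (c s))"]) auto
qed

text \<open>Stage \<open>N\<close> realizes in \<open>A\<close> all conditions with number below
  \<open>N\<close>, so each condition holds from some stage on. The sequences of realizing tuples
  then realize the whole pattern in the restricted ultrapower. A condition asking for a solution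
  needs its sequence of solutions inside \<open>F\<close>; a condition forbidding one is inherited
  because every element of the power is a sequence of elements of \<open>A\<close>.\<close>

theorem realizes_compactness:
  fixes A :: "('f :: countable, 'r :: countable, 'a) struct"
  assumes A: "is_struct L A" and \<phi>: "partitioned L m n \<phi>"
    and Cs: "\<And>s S. (s, S) \<in> Cs \<Longrightarrow> finite S"
    and fin: "\<And>Nm' Cs'. finite Nm' \<Longrightarrow> Nm' \<subseteq> Nm \<Longrightarrow> finite Cs' \<Longrightarrow> Cs' \<subseteq> Cs \<Longrightarrow> realizes A m n \<phi> Nm' Cs'"
  shows "\<exists>M :: ('f, 'r, 'u::infinite) struct. is_model L (complete_theory L A) M \<and> realizes M m n \<phi> Nm Cs"
proof -
  obtain d where d: "d \<in> dom A" using A by (auto simp: is_struct_def)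
  have "Cs \<subseteq> UNIV \<times> {S. finite S}" using Cs by auto
  then have cC: "countable Cs"
    by (rule countable_subset) (intro countable_SIGMA countableI_type countable_Collect_finite)
  define Nk where "Nk N = {x \<in> Nm. to_nat x < N}" for N
  define Ck where "Ck N = {x \<in> Cs. to_nat_on Cs x < N}" for N
  have "finite (Nk N)" for N
    by (rule inj_on_finite[of to_nat _ "{..<N}"]) (auto simp: Nk_def)
  moreover have "finite (Ck N)" for N
    by (rule inj_on_finite[of "to_nat_on Cs" _ "{..<N}"])
      (use inj_on_to_nat_on[OF cC] in \<open>auto simp: Ck_def inj_on_def\<close>)
  ultimately have "realizes A m n \<phi> (Nk N) (Ck N)" for N
    by (intro fin) (auto simp: Nk_def Ck_def)
  then have "\<forall>N. \<exists>a b. (\<forall>i::nat. a i \<in> tuples A m \<and> b i \<in> tuples A n) \<and>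
            (\<forall>(i, j, s) \<in> Nk N. holds A \<phi> (a i) (b j) = s) \<and>
            (\<forall>(s, S) \<in> Ck N. (\<exists>x \<in> tuples A m. \<forall>j \<in> S. holds A \<phi> x (b j)) = s)"
    unfolding realizes_def by (rule allI)
  from choice[OF this] obtain a where "\<forall>N. \<exists>b. (\<forall>i::nat. a N i \<in> tuples A m \<and> b i \<in> tuples A n) \<and>
            (\<forall>(i, j, s) \<in> Nk N. holds A \<phi> (a N i) (b j) = s) \<and>
            (\<forall>(s, S) \<in> Ck N. (\<exists>x \<in> tuples A m. \<forall>j \<in> S. holds A \<phi> x (b j)) = s)" by (elim exE)
  from choice[OF this] obtain b where ab: "\<forall>N. (\<forall>i::nat. a N i \<in> tuples A m \<and> b N i \<in> tuples A n) \<and>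
            (\<forall>(i, j, s) \<in> Nk N. holds A \<phi> (a N i) (b N j) = s) \<and>
            (\<forall>(s, S) \<in> Ck N. (\<exists>x \<in> tuples A m. \<forall>j \<in> S. holds A \<phi> x (b N j)) = s)" by (elim exE)
  have a: "a N i \<in> tuples A m" and b: "b N i \<in> tuples A n" for N i
    using ab[THEN spec, of N] by simp_all
  have Nk: "holds A \<phi> (a N i) (b N j) = s" if "(i, j, s) \<in> Nk N" for N i j s
    using ab[THEN spec, of N, THEN conjunct2, THEN conjunct1] that by (drule_tac bspec) (assumption, simp)
  have Ck: "(\<exists>x \<in> tuples A m. \<forall>j \<in> S. holds A \<phi> x (b N j)) = s" if "(s, S) \<in> Ck N" for N s S
    using ab[THEN spec, of N, THEN conjunct2, THEN conjunct2] that by (drule_tac bspec) (assumption, simp)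
  define w where "w N S = (SOME x. x \<in> tuples A m \<and>
    ((\<exists>x \<in> tuples A m. \<forall>j \<in> S. holds A \<phi> x (b N j)) \<longrightarrow> (\<forall>j \<in> S. holds A \<phi> x (b N j))))" for N S
  have w: "w N S \<in> tuples A m \<and>
    ((\<exists>x \<in> tuples A m. \<forall>j \<in> S. holds A \<phi> x (b N j)) \<longrightarrow> (\<forall>j \<in> S. holds A \<phi> (w N S) (b N j)))" for N S
    unfolding w_def by (rule someI_ex) (use a in blast)
  define comp where "comp xs l = (if l < length xs then xs ! l else d)" for xs and l :: nat
  have comp_dom: "comp xs l \<in> dom A" if "xs \<in> tuples A k" for xs l k
    using that d by (auto simp: comp_def tuples_def)
  define seq where "seq k (x :: nat \<Rightarrow> 'a list) = map (\<lambda>l N. comp (x N) l) [0..<k]" for k x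
  have seq: "map (\<lambda>s. s N) (seq k x) = x N" if "\<And>N. x N \<in> tuples A k" for k x N
    using that[of N] by (auto simp: seq_def comp_def tuples_def intro!: nth_equalityI)
  \<comment> \<open>The components of all tuples and of the chosen solutions for each finite index
    set, of which there are countably many. The constant sequence keeps the set nonempty when
    \<open>m\<close> and \<open>n\<close> are zero.\<close>
  define I where "I = (\<Union>i. set (seq m (\<lambda>N. a N i))) \<union> (\<Union>i. set (seq n (\<lambda>N. b N i)))
    \<union> (\<Union>S \<in> {S. finite S}. set (seq m (\<lambda>N. w N S))) \<union> {\<lambda>_. d}"
  have I1: "countable I" unfolding I_def
    by (intro countable_Un countable_UN countable_Collect_finite countableI_type)
      (simp_all add: countable_finite)
  have I2: "I \<noteq> {}" unfolding I_def by auto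
  have I3: "\<forall>s \<in> I. \<forall>N. s N \<in> dom A"
    using comp_dom[OF a] comp_dom[OF b] comp_dom[OF conjunct1[OF w]] d
    unfolding I_def seq_def by auto
  from countable_skolem_closure[of L A I, OF A I1 I2 I3] obtain F where F: "countable F" "I \<subseteq> F" "\<forall>s \<in> F. \<forall>N. s N \<in> dom A"
    "\<forall>f l. (f, length l) \<in> funs L \<longrightarrow> set l \<subseteq> F \<longrightarrow> (\<lambda>N. fn A f (map (\<lambda>s. s N) l)) \<in> F"
    "\<forall>(t :: nat \<Rightarrow> nat \<Rightarrow> 'a) i (\<phi> :: ('f, 'r) form). (\<forall>v. t v \<in> F) \<longrightarrow>
      (\<exists>g \<in> F. \<forall>N. (\<exists>a \<in> dom A. sat A ((\<lambda>v. t v N)(i := a)) \<phi>) \<longrightarrow> sat A ((\<lambda>v. t v N)(i := g N)) \<phi>)"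
    by (elim exE conjE)
  obtain U :: "nat set set" where U: "{} \<notin> U" "\<forall>A B. A \<in> U \<longrightarrow> A \<subseteq> B \<longrightarrow> B \<in> U"
    "\<forall>A B. A \<in> U \<longrightarrow> B \<in> U \<longrightarrow> A \<inter> B \<in> U" "\<forall>A. A \<in> U \<or> - A \<in> U" "\<forall>A. finite (- A) \<longrightarrow> A \<in> U"
    using ex_ultrafilter by (elim exE conjE)
  have "\<exists>\<pi> :: (nat \<Rightarrow> 'a) \<Rightarrow> 'u. \<forall>s \<in> F. \<forall>t \<in> F. \<pi> s = \<pi> t \<longleftrightarrow> {N. s N = t N} \<in> U"
  proof (rule ex_quotient_map[OF F(1)])
    fix s t u assume "{N. s N = t N} \<in> U" "{N. t N = u N} \<in> U"
    then have "{N. s N = t N} \<inter> {N. t N = u N} \<in> U" using U(3) by blast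
    moreover have "{N. s N = t N} \<inter> {N. t N = u N} \<subseteq> {N. s N = u N}" by auto
    ultimately show "{N. s N = u N} \<in> U" using U(2) by blast
  next
    have "UNIV \<in> U" using U(5) by simp
    then show "{N. s N = s N} \<in> U" for s :: "nat \<Rightarrow> 'a" by simp
  qed (simp add: eq_commute)
  then obtain \<pi> :: "(nat \<Rightarrow> 'a) \<Rightarrow> 'u" where \<pi>: "\<forall>s \<in> F. \<forall>t \<in> F. \<pi> s = \<pi> t \<longleftrightarrow> {N. s N = t N} \<in> U" ..
  interpret reduced_power L A U F \<pi>
  proof
    show "F \<noteq> {}" using F(2) I2 by auto
    show "(\<lambda>N. fn A f (map (\<lambda>s. s N) l)) \<in> F" if "(f, length l) \<in> funs L" "set l \<subseteq> F" for f l
      using F(4)[THEN spec, THEN spec, of f l] that by simp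
    show "\<exists>g \<in> F. \<forall>N. (\<exists>a \<in> dom A. sat A ((\<lambda>v. t v N)(i := a)) \<phi>) \<longrightarrow>
        sat A ((\<lambda>v. t v N)(i := g N)) \<phi>" if "\<And>v. t v \<in> F" for t i and \<phi> :: "('f, 'r) form"
      using F(5)[THEN spec, THEN spec, THEN spec, of t i \<phi>] that by simp
    show "\<pi> s = \<pi> s' \<longleftrightarrow> {N. s N = s' N} \<in> U" if "s \<in> F" "s' \<in> F" for s s'
      using \<pi> that by simp
    show "s N \<in> dom A" if "s \<in> F" for s N using F(3) that by simp
    show "X \<in> U \<or> - X \<in> U" for X using U(4) by simp
    show "X \<inter> Y \<in> U" if "X \<in> U" "Y \<in> U" for X Y using U(3) that by simp
    show "Y \<in> U" if "X \<in> U" "X \<subseteq> Y" for X Y using U(2) that by simp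
  qed (rule A, rule U(1))
  \<comment> \<open>Cofinite sets belong to \<open>U\<close>, so what holds from some stage on holds
    almost everywhere.\<close>
  have evt: "{N. P N} \<in> U" if "\<And>N. N > N0 \<Longrightarrow> P N" for P and N0 :: nat
  proof -
    have "- {N. P N} \<subseteq> {..N0}" using that by (auto simp: not_le[symmetric])
    then show ?thesis using U(5) finite_subset by blast
  qed
  have sF: "set (seq m (\<lambda>N. a N i)) \<subseteq> F" "set (seq n (\<lambda>N. b N i)) \<subseteq> F"
    "finite S \<Longrightarrow> set (seq m (\<lambda>N. w N S)) \<subseteq> F" for i S
    using F(2) unfolding I_def by blast+
  have len: "length (seq k x) = k" for k x by (simp add: seq_def)
  define a' where "a' i = map \<pi> (seq m (\<lambda>N. a N i))" for i
  define b' where "b' i = map \<pi> (seq n (\<lambda>N. b N i))" for i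
  have tup: "map \<pi> l \<in> tuples power k" if "set l \<subseteq> F" "length l = k" for l k
    using that by (auto simp: tuples_def)
  have hold: "holds power \<phi> (map \<pi> l) (b' j) \<longleftrightarrow> {N. holds A \<phi> (map (\<lambda>s. s N) l) (b N j)} \<in> U"
    if "set l \<subseteq> F" "length l = m" for l j
    using holds_power[OF \<phi> that(2) len that(1) sF(2)] seq[OF b] by (simp add: b'_def)
  have "realizes power m n \<phi> Nm Cs"
    unfolding realizes_def
  proof (rule exI[of _ a'], rule exI[of _ b'], intro conjI ballI allI; (clarify)?)
    show "a' i \<in> tuples power m" "b' i \<in> tuples power n" for i
      unfolding a'_def b'_def by (intro tup sF len)+
  next
    fix i j s assume ijs: "(i, j, s) \<in> Nm"
    have "{N. holds A \<phi> (a N i) (b N j) = s} \<in> U"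
      by (rule evt[of "to_nat (i, j, s)"]) (use ijs in \<open>auto intro!: Nk simp: Nk_def\<close>)
    then have "{N. holds A \<phi> (a N i) (b N j)} \<in> U \<longleftrightarrow> {N. s} \<in> U" by (rule U_cong)
    moreover have "{N :: nat. s} \<in> U \<longleftrightarrow> s" using U_UNIV U_empty by (cases s) simp_all
    ultimately show "holds power \<phi> (a' i) (b' j) = s"
      using hold[OF sF(1) len, of i j] seq[OF a] by (simp add: a'_def)
  next
    fix s S assume sS: "(s, S) \<in> Cs"
    have S: "finite S" using Cs sS by blast
    have ev: "{N. (\<exists>x \<in> tuples A m. \<forall>j \<in> S. holds A \<phi> x (b N j)) = s} \<in> U"
      by (rule evt[of "to_nat_on Cs (s, S)"]) (rule Ck, use sS in \<open>simp add: Ck_def\<close>)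
    show "(\<exists>x \<in> tuples power m. \<forall>j \<in> S. holds power \<phi> x (b' j)) = s"
    proof (cases s)
      case True
      let ?x = "map \<pi> (seq m (\<lambda>N. w N S))"
      have "holds power \<phi> ?x (b' j)" if j: "j \<in> S" for j
      proof -
        have "{N. holds A \<phi> (w N S) (b N j)} \<in> U"
          using ev by (rule U_impI) (use w[of _ S] j True in blast)
        then show ?thesis using hold[OF sF(3)[OF S] len, of j] seq[OF conjunct1[OF w]] by simp
      qed
      moreover have "?x \<in> tuples power m" by (intro tup sF(3) S len)
      ultimately show ?thesis using True by blast
    next
      case False
      \<comment> \<open>A solution in the power is a sequence from \<open>F\<close>. As
        \<open>S\<close> is finite, its entries would solve all formulas with index in
        \<open>S\<close> at almost all stages.\<close>
      have "\<not> (\<forall>j \<in> S. holds power \<phi> x (b' j))" if x: "x \<in> tuples power m" for x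
      proof
        assume h: "\<forall>j \<in> S. holds power \<phi> x (b' j)"
        have "set x \<subseteq> \<pi> ` F" using x by (simp add: tuples_def)
        then obtain l where l: "x = map \<pi> l" "set l \<subseteq> F" by (rule image_list)
        have lm: "length l = m" using x l(1) by (simp add: tuples_def)
        have "{N. holds A \<phi> (map (\<lambda>s. s N) l) (b N j)} \<in> U" if "j \<in> S" for j
          using h that hold[OF l(2) lm] unfolding l(1) by blast
        then have "{N. \<forall>j \<in> S. holds A \<phi> (map (\<lambda>s. s N) l) (b N j)} \<in> U" by (rule U_ball[OF S])
        then have "{N. (\<forall>j \<in> S. holds A \<phi> (map (\<lambda>s. s N) l) (b N j)) \<and>
            (\<exists>x \<in> tuples A m. \<forall>j \<in> S. holds A \<phi> x (b N j)) = s} \<in> U" using ev by (simp only: U_conj)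
        moreover have "map (\<lambda>s. s N) l \<in> tuples A m" for N
          using l(2) lm F_dom by (auto simp: tuples_def)
        then have "{N. (\<forall>j \<in> S. holds A \<phi> (map (\<lambda>s. s N) l) (b N j)) \<and>
            (\<exists>x \<in> tuples A m. \<forall>j \<in> S. holds A \<phi> x (b N j)) = s} = {}" using False by blast
        ultimately show False using U_empty by (simp only:)
      qed
      then show ?thesis using False by blast
    qed
  qed
  then show ?thesis using power_model by blast
qed

subsection \<open>Dividing lines as patterns\<close>

text \<open>One formula serves all finite parts of the pattern. Only \<open>A\<close> itself occurs
  here, neither other models nor a universe type, so the condition can be moved along
  interpretations.\<close>

definition finitely_realized ::
  "('f, 'r) language \<Rightarrow> ('f, 'r, 'a) struct \<Rightarrow> (nat \<times> nat \<times> bool) set \<Rightarrow> (bool \<times> nat set) set \<Rightarrow> bool" where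
  "finitely_realized L A Nm Cs \<longleftrightarrow> (\<exists>m n \<phi>. partitioned L m n \<phi> \<and>
     (\<forall>Nm' Cs'. finite Nm' \<longrightarrow> Nm' \<subseteq> Nm \<longrightarrow> finite Cs' \<longrightarrow> Cs' \<subseteq> Cs \<longrightarrow> realizes A m n \<phi> Nm' Cs'))"

lemma ex_model_realizes_iff:
  fixes A :: "('f :: countable, 'r :: countable, 'a) struct"
  assumes A: "is_struct L A" and Cs: "\<And>s S. (s, S) \<in> Cs \<Longrightarrow> finite S"
  shows "(\<exists>(M :: ('f, 'r, 'u::infinite) struct) m n \<phi>. is_model L (complete_theory L A) M \<and>
      partitioned L m n \<phi> \<and> realizes M m n \<phi> Nm Cs) \<longleftrightarrow> finitely_realized L A Nm Cs"
proof (rule iffI; (unfold finitely_realized_def, elim exE conjE))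
  fix M :: "('f, 'r, 'u) struct" and m n \<phi>
  assume M: "is_model L (complete_theory L A) M" and \<phi>: "partitioned L m n \<phi>" and r: "realizes M m n \<phi> Nm Cs"
  have "realizes A m n \<phi> Nm' Cs'" if "finite Nm'" "Nm' \<subseteq> Nm" "finite Cs'" "Cs' \<subseteq> Cs" for Nm' Cs'
    using realizes_elementary[OF A M \<phi> realizes_subset[OF r that(2,4)] that(1,3)] Cs that(4) by blast
  then show "\<exists>m n \<phi>. partitioned L m n \<phi> \<and>
     (\<forall>Nm' Cs'. finite Nm' \<longrightarrow> Nm' \<subseteq> Nm \<longrightarrow> finite Cs' \<longrightarrow> Cs' \<subseteq> Cs \<longrightarrow> realizes A m n \<phi> Nm' Cs')"
    using \<phi> by blast
next
  fix m n \<phi> assume \<phi>: "partitioned L m n \<phi>"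
    and r: "\<forall>Nm' Cs'. finite Nm' \<longrightarrow> Nm' \<subseteq> Nm \<longrightarrow> finite Cs' \<longrightarrow> Cs' \<subseteq> Cs \<longrightarrow> realizes A m n \<phi> Nm' Cs'"
  have "\<exists>M :: ('f, 'r, 'u) struct. is_model L (complete_theory L A) M \<and> realizes M m n \<phi> Nm Cs"
    by (rule realizes_compactness[OF A \<phi> Cs]) (use r in auto)
  then show "\<exists>(M :: ('f, 'r, 'u) struct) m n \<phi>. is_model L (complete_theory L A) M \<and>
      partitioned L m n \<phi> \<and> realizes M m n \<phi> Nm Cs" using \<phi> by blast
qed

text \<open>Trees and arrays are indexed by other countable types. Indices are coded by
  \<open>to_nat\<close>; the naturals that code nothing are filled through \<open>from_nat\<close>,
  and the tuples \<open>a i\<close> are arbitrary since no instance names them.\<close>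

lemma realizes_indexed:
  fixes Cs :: "(bool \<times> 'i::countable set) set" and M :: "('f, 'r, 'a) struct"
  assumes "dom M \<noteq> {}"
  shows "realizes M m n \<phi> {} (map_prod id ((`) to_nat) ` Cs) \<longleftrightarrow>
    (\<exists>b :: 'i \<Rightarrow> 'a list. (\<forall>\<eta>. b \<eta> \<in> tuples M n) \<and>
      (\<forall>(s, S) \<in> Cs. (\<exists>x \<in> tuples M m. \<forall>\<eta> \<in> S. holds M \<phi> x (b \<eta>)) = s))"
    (is "?L \<longleftrightarrow> ?R")
proof
  assume ?L
  then obtain a b where b: "\<forall>i::nat. a i \<in> tuples M m \<and> b i \<in> tuples M n"
    "\<forall>(s, S) \<in> map_prod id ((`) to_nat) ` Cs. (\<exists>x \<in> tuples M m. \<forall>j \<in> S. holds M \<phi> x (b j)) = s"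
    unfolding realizes_def by (elim exE conjE)
  show ?R
    by (rule exI[of _ "\<lambda>\<eta>. b (to_nat \<eta>)"]) (use b in \<open>simp add: case_prod_unfold del: map_prod_simp\<close>)
next
  assume ?R
  then obtain b :: "'i \<Rightarrow> 'a list" where b: "\<forall>\<eta>. b \<eta> \<in> tuples M n"
    "\<forall>(s, S) \<in> Cs. (\<exists>x \<in> tuples M m. \<forall>\<eta> \<in> S. holds M \<phi> x (b \<eta>)) = s" by (elim exE conjE)
  obtain d where d: "d \<in> dom M" using assms by blast
  show ?L unfolding realizes_def
    by (rule exI[of _ "\<lambda>_. replicate m d"], rule exI[of _ "\<lambda>i. b (from_nat i)"])
      (use b d in \<open>simp add: case_prod_unfold tuples_def set_replicate_conv_if\<close>)
qed

lemma consistent_finite: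
  "finite B \<Longrightarrow> consistent M m \<phi> B \<longleftrightarrow> (\<exists>a \<in> tuples M m. \<forall>b \<in> B. holds M \<phi> a b)"
  unfolding consistent_def by (rule iffI) (simp, blast)

lemma ball_setcompr: "(\<forall>p \<in> {f x y | x y. P x y}. Q p) \<longleftrightarrow> (\<forall>x y. P x y \<longrightarrow> Q (f x y))"
  by blast

text \<open>Finite subsets of an image are images of finite sets of indices. This turns consistency
  of a set of tuples into conditions on finite index sets, as a pattern requires, even when
  different indices carry the same tuple.\<close>

lemma consistent_image:
  "consistent M m \<phi> (f ` I) \<longleftrightarrow>
    (\<forall>X. finite X \<and> X \<subseteq> I \<longrightarrow> (\<exists>a \<in> tuples M m. \<forall>x \<in> X. holds M \<phi> a (f x)))"
proof
  assume *: "consistent M m \<phi> (f ` I)"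
  show "\<forall>X. finite X \<and> X \<subseteq> I \<longrightarrow> (\<exists>a \<in> tuples M m. \<forall>x \<in> X. holds M \<phi> a (f x))"
  proof (intro allI impI)
    fix X assume X: "finite X \<and> X \<subseteq> I"
    then have "f ` X \<subseteq> f ` I \<and> finite (f ` X)" by auto
    then have "\<exists>a \<in> tuples M m. \<forall>b \<in> f ` X. holds M \<phi> a b" using *[unfolded consistent_def] by blast
    then show "\<exists>a \<in> tuples M m. \<forall>x \<in> X. holds M \<phi> a (f x)" by simp
  qed
next
  assume *: "\<forall>X. finite X \<and> X \<subseteq> I \<longrightarrow> (\<exists>a \<in> tuples M m. \<forall>x \<in> X. holds M \<phi> a (f x))"
  show "consistent M m \<phi> (f ` I)"
    unfolding consistent_def
  proof (intro allI impI)
    fix B' assume "B' \<subseteq> f ` I \<and> finite B'"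
    then obtain X where "X \<subseteq> I" "finite X" "B' = f ` X" using finite_subset_image by metis
    then show "\<exists>a \<in> tuples M m. \<forall>b \<in> B'. holds M \<phi> a b" using * by simp
  qed
qed

definition op_named :: "(nat \<times> nat \<times> bool) set" where
  "op_named = {(i, j, i < j) | i j. True}"

text \<open>Consistency along a branch is split into its finite parts, because a sentence can only
  speak about finitely many instances. The lengths \<open>X\<close> are positive since the root lies
  on no branch of the tree property.\<close>

definition tp_pattern :: "nat \<Rightarrow> (bool \<times> nat list set) set" where
  "tp_pattern k = {(False, (\<lambda>i. \<eta> @ [i]) ` S) | \<eta> S. finite S \<and> card S = k} \<union>
     {(True, (\<lambda>l. map \<sigma> [0..<l]) ` X) | \<sigma> X. finite X \<and> X \<subseteq> {0<..}}"

definition tp2_pattern :: "nat \<Rightarrow> (bool \<times> (nat \<times> nat) set) set" where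
  "tp2_pattern k = {(False, Pair i ` S) | i S. finite S \<and> card S = k} \<union>
     {(True, (\<lambda>i. (i, \<sigma> i)) ` X) | \<sigma> X. finite X}"

definition sop1_pattern :: "(bool \<times> bool list set) set" where
  "sop1_pattern = {(False, {\<nu> @ [False] @ \<tau>, \<nu> @ [True]}) | \<nu> \<tau>. True} \<union>
     {(True, (\<lambda>l. map \<sigma> [0..<l]) ` X) | \<sigma> X. finite X}"

lemma order_property_iff: "order_property M m n \<phi> \<longleftrightarrow> realizes M m n \<phi> op_named {}"
  unfolding order_property_def realizes_def op_named_def ball_setcompr by simp

lemma tree_property_iff:
  fixes M :: "('f, 'r, 'c) struct"
  assumes "dom M \<noteq> {}"
  shows "tree_property M m n \<phi> \<longleftrightarrow> (\<exists>k. realizes M m n \<phi> {} (map_prod id ((`) to_nat) ` tp_pattern k))"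
proof -
  have "(\<forall>\<eta>. k_inconsistent M m \<phi> k (\<lambda>i. b (\<eta> @ [i]))) \<and>
        (\<forall>\<sigma>. consistent M m \<phi> {b (map \<sigma> [0..<l]) | l. 0 < l}) \<longleftrightarrow>
      (\<forall>(s, S) \<in> tp_pattern k. (\<exists>x \<in> tuples M m. \<forall>\<eta> \<in> S. holds M \<phi> x (b \<eta>)) = s)"
    (is "?A \<and> ?B \<longleftrightarrow> ?C") for k and b :: "nat list \<Rightarrow> 'c list"
  proof -
    have "{b (map \<sigma> [0..<l]) | l. 0 < l} = (\<lambda>l. b (map \<sigma> [0..<l])) ` {0<..}" for \<sigma> by auto
    then have B: "?B \<longleftrightarrow> (\<forall>\<sigma> X. finite X \<and> X \<subseteq> {0<..} \<longrightarrow>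
        (\<exists>a \<in> tuples M m. \<forall>x \<in> X. holds M \<phi> a (b (map \<sigma> [0..<x]))))"
      by (simp only: consistent_image)
    have A: "?A \<longleftrightarrow> (\<forall>\<eta> S. finite S \<and> card S = k \<longrightarrow>
        \<not> (\<exists>a \<in> tuples M m. \<forall>i \<in> S. holds M \<phi> a (b (\<eta> @ [i]))))"
      unfolding k_inconsistent_def by (simp add: consistent_finite)
    show ?thesis unfolding A B tp_pattern_def ball_Un ball_setcompr by simp
  qed
  then show ?thesis unfolding tree_property_def realizes_indexed[OF assms] by simp
qed

lemma tree_property_2_iff:
  fixes M :: "('f, 'r, 'c) struct"
  assumes "dom M \<noteq> {}"
  shows "tree_property_2 M m n \<phi> \<longleftrightarrow> (\<exists>k. realizes M m n \<phi> {} (map_prod id ((`) to_nat) ` tp2_pattern k))"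
proof -
  have "(\<forall>i. k_inconsistent M m \<phi> k (b i)) \<and> (\<forall>\<sigma>. consistent M m \<phi> {b i (\<sigma> i) | i. True}) \<longleftrightarrow>
      (\<forall>(s, S) \<in> tp2_pattern k. (\<exists>x \<in> tuples M m. \<forall>\<eta> \<in> S. holds M \<phi> x (case_prod b \<eta>)) = s)"
    (is "?A \<and> ?B \<longleftrightarrow> ?C") for k and b :: "nat \<Rightarrow> nat \<Rightarrow> 'c list"
  proof -
    have "{b i (\<sigma> i) | i. True} = (\<lambda>i. b i (\<sigma> i)) ` UNIV" for \<sigma> by auto
    then have B: "?B \<longleftrightarrow> (\<forall>\<sigma> X. finite X \<longrightarrow> (\<exists>a \<in> tuples M m. \<forall>x \<in> X. holds M \<phi> a (b x (\<sigma> x))))"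
      by (simp only: consistent_image) simp
    have A: "?A \<longleftrightarrow> (\<forall>i S. finite S \<and> card S = k \<longrightarrow>
        \<not> (\<exists>a \<in> tuples M m. \<forall>j \<in> S. holds M \<phi> a (b i j)))"
      unfolding k_inconsistent_def by (simp add: consistent_finite)
    show ?thesis unfolding A B tp2_pattern_def ball_Un ball_setcompr by simp
  qed
  then have "tree_property_2 M m n \<phi> \<longleftrightarrow> (\<exists>k. \<exists>b :: nat \<Rightarrow> nat \<Rightarrow> 'c list. (\<forall>\<eta>. case_prod b \<eta> \<in> tuples M n) \<and>
      (\<forall>(s, S) \<in> tp2_pattern k. (\<exists>x \<in> tuples M m. \<forall>\<eta> \<in> S. holds M \<phi> x (case_prod b \<eta>)) = s))"
    unfolding tree_property_2_def by simp
  also have "\<dots> \<longleftrightarrow> (\<exists>k. \<exists>b :: nat \<times> nat \<Rightarrow> 'c list. (\<forall>\<eta>. b \<eta> \<in> tuples M n) \<and>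
      (\<forall>(s, S) \<in> tp2_pattern k. (\<exists>x \<in> tuples M m. \<forall>\<eta> \<in> S. holds M \<phi> x (b \<eta>)) = s))"
  proof -
    have "(\<exists>b :: nat \<Rightarrow> nat \<Rightarrow> 'c list. P (case_prod b)) \<longleftrightarrow> (\<exists>b. P b)" for P
    proof
      assume "\<exists>b. P b"
      then obtain b where "P b" ..
      then have "P (case_prod (curry b))" by simp
      then show "\<exists>b. P (case_prod b)" by blast
    qed blast
    then show ?thesis by (intro ex_cong1)
  qed
  finally show ?thesis unfolding realizes_indexed[OF assms] .
qed

lemma strong_order_property_1_iff:
  fixes M :: "('f, 'r, 'c) struct"
  assumes "dom M \<noteq> {}"
  shows "strong_order_property_1 M m n \<phi> \<longleftrightarrow> realizes M m n \<phi> {} (map_prod id ((`) to_nat) ` sop1_pattern)"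
proof -
  have "(\<forall>\<sigma>. consistent M m \<phi> {b (map \<sigma> [0..<l]) | l. True}) \<and>
        (\<forall>\<nu> \<tau>. \<not> consistent M m \<phi> {b (\<nu> @ [False] @ \<tau>), b (\<nu> @ [True])}) \<longleftrightarrow>
      (\<forall>(s, S) \<in> sop1_pattern. (\<exists>x \<in> tuples M m. \<forall>\<eta> \<in> S. holds M \<phi> x (b \<eta>)) = s)"
    (is "?A \<and> ?B \<longleftrightarrow> ?C") for b :: "bool list \<Rightarrow> 'c list"
  proof -
    have "{b (map \<sigma> [0..<l]) | l. True} = (\<lambda>l. b (map \<sigma> [0..<l])) ` UNIV" for \<sigma> by auto
    then have A: "?A \<longleftrightarrow> (\<forall>\<sigma> X. finite X \<longrightarrow>
        (\<exists>a \<in> tuples M m. \<forall>x \<in> X. holds M \<phi> a (b (map \<sigma> [0..<x]))))"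
      by (simp only: consistent_image) simp
    have B: "?B \<longleftrightarrow> (\<forall>\<nu> \<tau>. \<not> (\<exists>a \<in> tuples M m.
        \<forall>\<eta> \<in> {\<nu> @ [False] @ \<tau>, \<nu> @ [True]}. holds M \<phi> a (b \<eta>)))"
      by (simp add: consistent_finite)
    show ?thesis unfolding A B sop1_pattern_def ball_Un ball_setcompr by (simp add: conj_commute)
  qed
  then show ?thesis unfolding strong_order_property_1_def realizes_indexed[OF assms] by simp
qed

lemma dom_model: "is_model L T M \<Longrightarrow> dom M \<noteq> {}"
  by (simp add: is_model_def is_struct_def)

context
  fixes L :: "('f :: countable, 'r :: countable) language" and A :: "('f, 'r, 'a) struct"
  assumes A: "is_struct L A"
begin

lemma stable_theory_iff:
  "stable_theory TYPE('u::infinite) L (complete_theory L A) \<longleftrightarrow> \<not> finitely_realized L A op_named {}"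
  unfolding stable_theory_def order_property_iff
  using ex_model_realizes_iff[OF A, of "{}" op_named, where ?'u = 'u] by simp

lemma finite_pattern_sets:
  "(s, S) \<in> map_prod id ((`) to_nat) ` tp_pattern k \<Longrightarrow> finite S"
  "(s, S) \<in> map_prod id ((`) to_nat) ` tp2_pattern k \<Longrightarrow> finite S"
  "(s, S) \<in> map_prod id ((`) to_nat) ` sop1_pattern \<Longrightarrow> finite S"
  by (auto simp: tp_pattern_def tp2_pattern_def sop1_pattern_def)

lemma simple_theory_iff:
  "simple_theory TYPE('u::infinite) L (complete_theory L A) \<longleftrightarrow>
    \<not> (\<exists>k. finitely_realized L A {} (map_prod id ((`) to_nat) ` tp_pattern k))"
proof -
  have "(\<exists>(M :: ('f, 'r, 'u) struct) m n \<phi>. is_model L (complete_theory L A) M \<and> partitioned L m n \<phi> \<and> tree_property M m n \<phi>) \<longleftrightarrow>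
    (\<exists>k. \<exists>(M :: ('f, 'r, 'u) struct) m n \<phi>. is_model L (complete_theory L A) M \<and> partitioned L m n \<phi> \<and>
      realizes M m n \<phi> {} (map_prod id ((`) to_nat) ` tp_pattern k))"
    using tree_property_iff[OF dom_model] by metis
  then show ?thesis
    unfolding simple_theory_def using ex_model_realizes_iff[OF A finite_pattern_sets(1), where ?'u = 'u] by simp
qed

lemma NTP2_theory_iff:
  "NTP2_theory TYPE('u::infinite) L (complete_theory L A) \<longleftrightarrow>
    \<not> (\<exists>k. finitely_realized L A {} (map_prod id ((`) to_nat) ` tp2_pattern k))"
proof -
  have "(\<exists>(M :: ('f, 'r, 'u) struct) m n \<phi>. is_model L (complete_theory L A) M \<and> partitioned L m n \<phi> \<and> tree_property_2 M m n \<phi>) \<longleftrightarrow>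
    (\<exists>k. \<exists>(M :: ('f, 'r, 'u) struct) m n \<phi>. is_model L (complete_theory L A) M \<and> partitioned L m n \<phi> \<and>
      realizes M m n \<phi> {} (map_prod id ((`) to_nat) ` tp2_pattern k))"
    using tree_property_2_iff[OF dom_model] by metis
  then show ?thesis
    unfolding NTP2_theory_def using ex_model_realizes_iff[OF A finite_pattern_sets(2), where ?'u = 'u] by simp
qed

lemma NSOP1_theory_iff:
  "NSOP1_theory TYPE('u::infinite) L (complete_theory L A) \<longleftrightarrow>
    \<not> finitely_realized L A {} (map_prod id ((`) to_nat) ` sop1_pattern)"
proof -
  have "(\<exists>(M :: ('f, 'r, 'u) struct) m n \<phi>. is_model L (complete_theory L A) M \<and> partitioned L m n \<phi> \<and> strong_order_property_1 M m n \<phi>) \<longleftrightarrow>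
    (\<exists>(M :: ('f, 'r, 'u) struct) m n \<phi>. is_model L (complete_theory L A) M \<and> partitioned L m n \<phi> \<and>
      realizes M m n \<phi> {} (map_prod id ((`) to_nat) ` sop1_pattern))"
    using strong_order_property_1_iff[OF dom_model] by metis
  then show ?thesis
    unfolding NSOP1_theory_def using ex_model_realizes_iff[OF A finite_pattern_sets(3), where ?'u = 'u] by simp
qed

end

subsection \<open>Interpretations with parameters\<close>

text \<open>In an interpretation of dimension \<open>d\<close> with \<open>p\<close> parameters, the variables below \<open>p\<close> hold the parameters
  and the \<open>j\<close>-th block of \<open>d\<close> further variables encodes the value of the variable \<open>j\<close>.\<close>

definition block :: "nat \<Rightarrow> nat \<Rightarrow> (nat \<Rightarrow> 'b) \<Rightarrow> nat \<Rightarrow> 'b list" where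
  "block p d e j = map (\<lambda>l. e (p + d * j + l)) [0..<d]"

definition envs :: "('g, 's, 'b) struct \<Rightarrow> 'b list \<Rightarrow> (nat \<Rightarrow> 'b) set" where
  "envs B c = {e. range e \<subseteq> dom B \<and> (\<forall>i < length c. e i = c ! i)}"

text \<open>Codes are unique, so equality of codes interprets equality. The formulas for functions
  and relations have to be right on codes only; the domain formula confines quantifiers to
  codes.\<close>

locale interpretable =
  fixes L1 :: "('f, 'r) language" and A :: "('f, 'r, 'a) struct"
    and L2 :: "('g, 's) language" and B :: "('g, 's, 'b) struct"
    and enc :: "'a \<Rightarrow> 'b list" and d :: nat and c :: "'b list"
  assumes A: "is_struct L1 A" and B: "is_struct L2 B" and c: "set c \<subseteq> dom B"
    and enc: "a \<in> dom A \<Longrightarrow> enc a \<in> tuples B d"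
    and enc_inj: "inj_on enc (dom A)"
    and ex_dom_form: "\<exists>\<delta>. wf_form L2 \<delta> \<and> (\<forall>e \<in> envs B c. sat B e \<delta> \<longleftrightarrow> block (length c) d e 0 \<in> enc ` dom A)"
    and ex_fn_form: "(f, n) \<in> funs L1 \<Longrightarrow> \<exists>\<psi>. wf_form L2 \<psi> \<and>
      (\<forall>e \<in> envs B c. \<forall>as a. length as = n \<longrightarrow> set as \<subseteq> dom A \<longrightarrow> a \<in> dom A \<longrightarrow>
         (\<forall>i < n. block (length c) d e i = enc (as ! i)) \<longrightarrow> block (length c) d e n = enc a \<longrightarrow>
         (sat B e \<psi> \<longleftrightarrow> fn A f as = a))"
    and ex_rel_form: "(r, n) \<in> rels L1 \<Longrightarrow> \<exists>\<psi>. wf_form L2 \<psi> \<and>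
      (\<forall>e \<in> envs B c. \<forall>as. length as = n \<longrightarrow> set as \<subseteq> dom A \<longrightarrow>
         (\<forall>i < n. block (length c) d e i = enc (as ! i)) \<longrightarrow> (sat B e \<psi> \<longleftrightarrow> rel A r as))"
begin

abbreviation "p \<equiv> length c"
abbreviation "blk \<equiv> block p d"
abbreviation "E \<equiv> envs B c"
abbreviation "EA \<equiv> {e. range e \<subseteq> dom A}"

lemma envs_range: "e \<in> E \<Longrightarrow> e v \<in> dom B" by (auto simp: envs_def)

text \<open>Reads block \<open>i\<close> from block \<open>js ! i\<close> and fixes the parameters,
  so that a formula given for the first few blocks can be used at any blocks.\<close>

definition move :: "nat list \<Rightarrow> nat \<Rightarrow> nat" where
  "move js v = (if v < p then v else p + d * (js ! ((v - p) div d)) + (v - p) mod d)"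

lemma move_envs: "e \<in> E \<Longrightarrow> (\<lambda>v. e (move js v)) \<in> E"
  by (auto simp: envs_def move_def)

lemma block_move: "blk (\<lambda>v. e (move js v)) i = blk e (js ! i)"
  unfolding block_def move_def
proof (rule map_cong[OF refl], goal_cases)
  case (1 l)
  then have "(p + d * i + l - p) div d = i" "(p + d * i + l - p) mod d = l" by auto
  then show ?case by simp
qed

lemma dom_form: "\<exists>\<delta>. wf_form L2 \<delta> \<and> (\<forall>e \<in> E. sat B e \<delta> \<longleftrightarrow> blk e j \<in> enc ` dom A)"
proof -
  obtain \<delta> where "wf_form L2 \<delta>" "\<forall>e \<in> E. sat B e \<delta> \<longleftrightarrow> blk e 0 \<in> enc ` dom A"
    using ex_dom_form by blast
  then show ?thesis using move_envs[of _ "[j]"]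
    by (intro exI[of _ "ren \<delta> (move [j])"]) (simp add: sat_ren block_move)
qed

lemma fn_form:
  assumes "(f, n) \<in> funs L1"
  shows "\<exists>\<psi>. wf_form L2 \<psi> \<and> (\<forall>e \<in> E. \<forall>as a. length as = n \<longrightarrow> set as \<subseteq> dom A \<longrightarrow> a \<in> dom A \<longrightarrow>
         (\<forall>i < n. blk e (N + i) = enc (as ! i)) \<longrightarrow> blk e j = enc a \<longrightarrow> (sat B e \<psi> \<longleftrightarrow> fn A f as = a))"
proof -
  obtain \<psi> where \<psi>: "wf_form L2 \<psi>" "\<forall>e \<in> E. \<forall>as a. length as = n \<longrightarrow> set as \<subseteq> dom A \<longrightarrow> a \<in> dom A \<longrightarrow>
         (\<forall>i < n. blk e i = enc (as ! i)) \<longrightarrow> blk e n = enc a \<longrightarrow> (sat B e \<psi> \<longleftrightarrow> fn A f as = a)"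
    using ex_fn_form[OF assms] by blast
  define js where "js = [N..<N + n] @ [j]"
  have js: "js ! n = j" "\<And>i. i < n \<Longrightarrow> js ! i = N + i" by (auto simp: js_def nth_append)
  show ?thesis
  proof (intro exI[of _ "ren \<psi> (move js)"] conjI ballI allI impI)
    fix e as a assume e: "e \<in> E" and as: "length as = n" "set as \<subseteq> dom A" "a \<in> dom A"
      "\<forall>i < n. blk e (N + i) = enc (as ! i)" "blk e j = enc a"
    show "sat B e (ren \<psi> (move js)) \<longleftrightarrow> fn A f as = a"
      unfolding sat_ren comp_def
      by (rule \<psi>(2)[rule_format, OF move_envs[OF e]]) (use as js in \<open>auto simp: block_move\<close>)
  qed (simp add: \<psi>)
qed

lemma rel_form:
  assumes "(r, n) \<in> rels L1"
  shows "\<exists>\<psi>. wf_form L2 \<psi> \<and> (\<forall>e \<in> E. \<forall>as. length as = n \<longrightarrow> set as \<subseteq> dom A \<longrightarrow>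
         (\<forall>i < n. blk e (N + i) = enc (as ! i)) \<longrightarrow> (sat B e \<psi> \<longleftrightarrow> rel A r as))"
proof -
  obtain \<psi> where \<psi>: "wf_form L2 \<psi>" "\<forall>e \<in> E. \<forall>as. length as = n \<longrightarrow> set as \<subseteq> dom A \<longrightarrow>
         (\<forall>i < n. blk e i = enc (as ! i)) \<longrightarrow> (sat B e \<psi> \<longleftrightarrow> rel A r as)"
    using ex_rel_form[OF assms] by blast
  show ?thesis
  proof (intro exI[of _ "ren \<psi> (move [N..<N + n])"] conjI ballI allI impI)
    fix e as assume e: "e \<in> E" and as: "length as = n" "set as \<subseteq> dom A"
      "\<forall>i < n. blk e (N + i) = enc (as ! i)"
    show "sat B e (ren \<psi> (move [N..<N + n])) \<longleftrightarrow> rel A r as"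
      unfolding sat_ren comp_def
      by (rule \<psi>(2)[rule_format, OF move_envs[OF e]]) (use as in \<open>auto simp: block_move\<close>)
  qed (simp add: \<psi>)
qed

definition block_eq :: "nat \<Rightarrow> nat \<Rightarrow> ('g, 's) form" where
  "block_eq i j = Conj (map (\<lambda>l. Eq (Var (p + d * i + l)) (Var (p + d * j + l))) [0..<d])"

lemma wf_block_eq: "wf_form L2 (block_eq i j)"
  by (auto simp: block_eq_def)

lemma sat_block_eq: "sat B e (block_eq i j) \<longleftrightarrow> blk e i = blk e j"
  by (auto simp: block_eq_def block_def)

definition block_vars :: "nat \<Rightarrow> nat \<Rightarrow> nat set" where
  "block_vars N n = {p + d * N..<p + d * (N + n)}"

lemma finite_block_vars: "finite (block_vars N n)"
  by (simp add: block_vars_def)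

lemma block_outside:
  assumes "\<forall>v. v \<notin> block_vars N n \<longrightarrow> e' v = e v" "i < N \<or> N + n \<le> i"
  shows "blk e' i = blk e i"
  unfolding block_def
proof (rule map_cong[OF refl], goal_cases)
  case (1 l)
  have "p + d * i + l \<notin> block_vars N n"
  proof (cases "i < N")
    case True
    then have "d * i + d \<le> d * N" by (metis Suc_leI mult_Suc_right mult_le_mono2 add.commute)
    then show ?thesis using 1 by (simp add: block_vars_def)
  next
    case False
    then have "d * (N + n) \<le> d * i" using assms(2) by (intro mult_le_mono2) simp
    then show ?thesis unfolding block_vars_def atLeastLessThan_iff by linarith
  qed
  then show ?case using assms(1) by blast
qed

lemma envs_outside:
  assumes "\<forall>v. v \<notin> block_vars N n \<longrightarrow> e' v = e v" "e \<in> E" "range e' \<subseteq> dom B"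
  shows "e' \<in> E"
  using assms by (auto simp: envs_def block_vars_def)

lemma ex_blocks:
  assumes "e \<in> E" "length as = n" "set as \<subseteq> dom A"
  shows "\<exists>e'. range e' \<subseteq> dom B \<and> (\<forall>v. v \<notin> block_vars N n \<longrightarrow> e' v = e v) \<and>
    (\<forall>i < n. blk e' (N + i) = enc (as ! i))"
proof -
  define e' where "e' v = (if v \<in> block_vars N n then enc (as ! ((v - p) div d - N)) ! ((v - p) mod d) else e v)" for v
  have en: "length (enc (as ! i)) = d \<and> set (enc (as ! i)) \<subseteq> dom B" if "i < n" for i
  proof -
    have "as ! i \<in> dom A" using assms(2,3) that by auto
    then show ?thesis using enc by (auto simp: tuples_def)
  qed
  have "e' v \<in> dom B" for v
  proof (cases "v \<in> block_vars N n")
    case True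
    then have v: "d * N \<le> v - p" "v - p < d * (N + n)" by (auto simp: block_vars_def)
    then have d: "d > 0" by (cases d) auto
    have "(v - p) div d < N + n" using v(2) by (simp add: less_mult_imp_div_less mult.commute)
    moreover have "N \<le> (v - p) div d" using v(1) d by (simp add: less_eq_div_iff_mult_less_eq mult.commute)
    ultimately have "(v - p) div d - N < n" by simp
    then have "enc (as ! ((v - p) div d - N)) ! ((v - p) mod d) \<in> dom B"
      using en d by (metis mod_less_divisor nth_mem subsetD)
    then show ?thesis using True by (simp add: e'_def)
  qed (use envs_range[OF assms(1)] in \<open>simp add: e'_def\<close>)
  moreover have "blk e' (N + i) = enc (as ! i)" if i: "i < n" for i
  proof (rule nth_equalityI)
    show "length (blk e' (N + i)) = length (enc (as ! i))" using en[OF i] by (simp add: block_def)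
    fix l assume "l < length (blk e' (N + i))"
    then have l: "l < d" by (simp add: block_def)
    have "d * (N + i) + l < d * (N + i) + d" using l by simp
    also have "\<dots> \<le> d * (N + n)" using i mult_le_mono2[of "N + i + 1" "N + n" d] by (simp add: algebra_simps)
    finally have "p + d * (N + i) + l \<in> block_vars N n" by (simp add: block_vars_def algebra_simps)
    moreover have "(p + d * (N + i) + l - p) div d = N + i" "(p + d * (N + i) + l - p) mod d = l"
      using l by auto
    ultimately show "blk e' (N + i) ! l = enc (as ! i) ! l"
      using l by (simp add: block_def e'_def)
  qed
  moreover have "\<forall>v. v \<notin> block_vars N n \<longrightarrow> e' v = e v" by (simp add: e'_def)
  ultimately show ?thesis by (intro exI[of _ e']) blast
qed

definition translates_trm :: "'f trm \<Rightarrow> bool" where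
  "translates_trm t \<longleftrightarrow> (\<forall>j. \<exists>\<psi>. wf_form L2 \<psi> \<and> (\<forall>e' \<in> E. \<forall>e \<in> EA. \<forall>a \<in> dom A.
     (\<forall>i \<in> trm_vars t. blk e' i = enc (e i)) \<longrightarrow> blk e' j = enc a \<longrightarrow> (sat B e' \<psi> \<longleftrightarrow> val A e t = a)))"

text \<open>\<open>\<gamma>\<close> expresses \<open>Q\<close> for the contents of the fresh blocks,
  \<open>\<psi>\<close> expresses \<open>Q\<close> for the values of the terms. The environment
  \<open>e''\<close> agrees with \<open>e'\<close> outside the fresh blocks, so \<open>Q\<close> may
  also depend on other blocks, such as the one holding the result of a function.\<close>

definition unnests :: "nat \<Rightarrow> 'f trm list \<Rightarrow> ('g, 's) form \<Rightarrow> ('g, 's) form \<Rightarrow> bool" where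
  "unnests N ts \<gamma> \<psi> \<longleftrightarrow> wf_form L2 \<psi> \<and> (\<forall>e' \<in> E. \<forall>e \<in> EA. \<forall>Q.
    (\<forall>t \<in> set ts. \<forall>i \<in> trm_vars t. blk e' i = enc (e i)) \<longrightarrow>
    (\<forall>e'' \<in> E. \<forall>as. (\<forall>v. v \<notin> block_vars N (length ts) \<longrightarrow> e'' v = e' v) \<longrightarrow> length as = length ts \<longrightarrow>
      set as \<subseteq> dom A \<longrightarrow> (\<forall>i < length ts. blk e'' (N + i) = enc (as ! i)) \<longrightarrow> (sat B e'' \<gamma> \<longleftrightarrow> Q as)) \<longrightarrow>
    (sat B e' \<psi> \<longleftrightarrow> Q (map (val A e) ts)))"

lemma unnestsD:
  assumes "unnests N ts \<gamma> \<psi>" "e' \<in> E" "e \<in> EA"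
    and "\<And>t i. t \<in> set ts \<Longrightarrow> i \<in> trm_vars t \<Longrightarrow> blk e' i = enc (e i)"
    and "\<And>e'' as. e'' \<in> E \<Longrightarrow> \<forall>v. v \<notin> block_vars N (length ts) \<longrightarrow> e'' v = e' v \<Longrightarrow> length as = length ts \<Longrightarrow>
      set as \<subseteq> dom A \<Longrightarrow> \<forall>i < length ts. blk e'' (N + i) = enc (as ! i) \<Longrightarrow> sat B e'' \<gamma> \<longleftrightarrow> Q as"
  shows "sat B e' \<psi> \<longleftrightarrow> Q (map (val A e) ts)"
  using assms(1)[unfolded unnests_def, THEN conjunct2, THEN bspec, OF assms(2), THEN bspec, OF assms(3), THEN spec, of Q]
    assms(4,5) by simp

text \<open>Nested terms are unravelled by naming the values of the immediate subterms in fresh blocks.\<close>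

lemma unnest:
  assumes ts: "\<And>t. t \<in> set ts \<Longrightarrow> translates_trm t" "\<And>t. t \<in> set ts \<Longrightarrow> wf_trm L1 t"
    and N: "\<And>t i. t \<in> set ts \<Longrightarrow> i \<in> trm_vars t \<Longrightarrow> i < N"
    and \<gamma>: "wf_form L2 \<gamma>"
  shows "\<exists>\<psi>. unnests N ts \<gamma> \<psi>"
proof -
  define n where n: "n = length ts"
  have "\<forall>i. \<exists>\<psi>. i < n \<longrightarrow> wf_form L2 \<psi> \<and> (\<forall>e' \<in> E. \<forall>e \<in> EA. \<forall>a \<in> dom A.
     (\<forall>v \<in> trm_vars (ts ! i). blk e' v = enc (e v)) \<longrightarrow> blk e' (N + i) = enc a \<longrightarrow>
     (sat B e' \<psi> \<longleftrightarrow> val A e (ts ! i) = a))"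
    using ts(1)[unfolded translates_trm_def] n by (metis nth_mem)
  from choice[OF this] obtain \<psi> where \<psi>': "\<forall>i. i < n \<longrightarrow> wf_form L2 (\<psi> i) \<and> (\<forall>e' \<in> E. \<forall>e \<in> EA. \<forall>a \<in> dom A.
     (\<forall>v \<in> trm_vars (ts ! i). blk e' v = enc (e v)) \<longrightarrow> blk e' (N + i) = enc a \<longrightarrow>
     (sat B e' (\<psi> i) \<longleftrightarrow> val A e (ts ! i) = a))" ..
  have \<psi>: "wf_form L2 (\<psi> i)" if "i < n" for i using \<psi>' that by blast
  have sat_\<psi>: "sat B e' (\<psi> i) \<longleftrightarrow> val A e (ts ! i) = a"
    if "i < n" "e' \<in> E" "e \<in> EA" "a \<in> dom A" "\<forall>v \<in> trm_vars (ts ! i). blk e' v = enc (e v)"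
      "blk e' (N + i) = enc a" for i e' e a using \<psi>' that by blast
  obtain \<delta> where \<delta>: "\<And>j. wf_form L2 (\<delta> j)" "\<And>j e. e \<in> E \<Longrightarrow> sat B e (\<delta> j) \<longleftrightarrow> blk e j \<in> enc ` dom A"
    using dom_form by metis
  let ?\<theta> = "exs (block_vars N n) (Conj (\<gamma> # map (\<lambda>i. \<delta> (N + i)) [0..<n] @ map \<psi> [0..<n]))"
  have "sat B e' ?\<theta> \<longleftrightarrow> Q (map (val A e) ts)"
    if e': "e' \<in> E" and e: "e \<in> EA" and bl: "\<forall>t \<in> set ts. \<forall>i \<in> trm_vars t. blk e' i = enc (e i)"
      and Q: "\<forall>e'' \<in> E. \<forall>as. (\<forall>v. v \<notin> block_vars N n \<longrightarrow> e'' v = e' v) \<longrightarrow> length as = n \<longrightarrow> set as \<subseteq> dom A \<longrightarrow>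
      (\<forall>i < n. blk e'' (N + i) = enc (as ! i)) \<longrightarrow> (sat B e'' \<gamma> \<longleftrightarrow> Q as)" for e' e Q
  proof -
    have r: "range e' \<subseteq> dom B" using e' by (auto simp: envs_def)
    have vA: "set (map (val A e) ts) \<subseteq> dom A" using val_in_dom[OF A] e ts(2) by auto
    \<comment> \<open>On fresh blocks coding \<open>as\<close>, the formulas of the subterms say
      that \<open>as\<close> lists their values. The fresh blocks lie beyond all variables of the
      terms, whose blocks thus keep their contents.\<close>
    have key: "sat B e'' (Conj (map \<psi> [0..<n])) \<longleftrightarrow> as = map (val A e) ts"
      if e'': "e'' \<in> E" "\<forall>v. v \<notin> block_vars N n \<longrightarrow> e'' v = e' v" and as: "length as = n" "set as \<subseteq> dom A"
        "\<forall>i < n. blk e'' (N + i) = enc (as ! i)" for e'' as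
    proof -
      have "sat B e'' (\<psi> i) \<longleftrightarrow> val A e (ts ! i) = as ! i" if i: "i < n" for i
      proof (rule sat_\<psi>[OF i e''(1) e])
        show "as ! i \<in> dom A" using as(1,2) i by auto
        show "\<forall>v \<in> trm_vars (ts ! i). blk e'' v = enc (e v)"
        proof
          fix v assume v: "v \<in> trm_vars (ts ! i)"
          have t: "ts ! i \<in> set ts" using i n by simp
          have "blk e'' v = blk e' v" using N[OF t v] by (intro block_outside[OF e''(2)]) simp
          then show "blk e'' v = enc (e v)" using bl t v by simp
        qed
      qed (use as i in blast)
      then have "sat B e'' (Conj (map \<psi> [0..<n])) \<longleftrightarrow> (\<forall>i < n. val A e (ts ! i) = as ! i)" by auto
      also have "\<dots> \<longleftrightarrow> as = map (val A e) ts" using as(1) n by (auto simp: list_eq_iff_nth_eq)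
      finally show ?thesis .
    qed
    show ?thesis unfolding sat_exs[OF finite_block_vars r]
    proof
      assume "\<exists>e''. range e'' \<subseteq> dom B \<and> (\<forall>v. v \<notin> block_vars N n \<longrightarrow> e'' v = e' v) \<and>
        sat B e'' (Conj (\<gamma> # map (\<lambda>i. \<delta> (N + i)) [0..<n] @ map \<psi> [0..<n]))"
      then obtain e'' where e'': "range e'' \<subseteq> dom B" "\<forall>v. v \<notin> block_vars N n \<longrightarrow> e'' v = e' v"
        "sat B e'' (Conj (\<gamma> # map (\<lambda>i. \<delta> (N + i)) [0..<n] @ map \<psi> [0..<n]))" by blast
      have E'': "e'' \<in> E" using envs_outside[OF e''(2) e' e''(1)] .
      have "\<forall>i < n. blk e'' (N + i) \<in> enc ` dom A" using e''(3) \<delta>(2)[OF E''] by (simp add: ball_Un)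
      then have "\<forall>i. \<exists>a. i < n \<longrightarrow> a \<in> dom A \<and> blk e'' (N + i) = enc a" by blast
      from choice[OF this] obtain g where g: "\<And>i. i < n \<Longrightarrow> g i \<in> dom A \<and> blk e'' (N + i) = enc (g i)" by blast
      have as: "length (map g [0..<n]) = n" "set (map g [0..<n]) \<subseteq> dom A"
        "\<forall>i < n. blk e'' (N + i) = enc (map g [0..<n] ! i)" using g by auto
      have "map g [0..<n] = map (val A e) ts" using key[OF E'' e''(2) as] e''(3) by simp
      moreover have "sat B e'' \<gamma>" using e''(3) by simp
      then have "Q (map g [0..<n])" using Q E'' e''(2) as by blast
      ultimately show "Q (map (val A e) ts)" by simp
    next
      assume q: "Q (map (val A e) ts)"
      have l: "length (map (val A e) ts) = n" using n by simp
      obtain e'' where e'': "range e'' \<subseteq> dom B" "\<forall>v. v \<notin> block_vars N n \<longrightarrow> e'' v = e' v"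
        "\<forall>i < n. blk e'' (N + i) = enc (map (val A e) ts ! i)" using ex_blocks[OF e' l vA] by blast
      have E'': "e'' \<in> E" using envs_outside[OF e''(2) e' e''(1)] .
      have "sat B e'' (Conj (map \<psi> [0..<n]))" using key[OF E'' e''(2) l vA e''(3)] by simp
      moreover have "sat B e'' \<gamma>" using Q E'' e''(2) l vA e''(3) q by blast
      moreover have "sat B e'' (\<delta> (N + i))" if "i < n" for i
      proof -
        have "map (val A e) ts ! i \<in> dom A" using vA l that by (metis nth_mem subsetD)
        then show ?thesis using \<delta>(2)[OF E''] e''(3) that by auto
      qed
      ultimately show "\<exists>e''. range e'' \<subseteq> dom B \<and> (\<forall>v. v \<notin> block_vars N n \<longrightarrow> e'' v = e' v) \<and>
        sat B e'' (Conj (\<gamma> # map (\<lambda>i. \<delta> (N + i)) [0..<n] @ map \<psi> [0..<n]))"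
        using e''(1,2) by (intro exI[of _ e'']) (simp add: ball_Un)
    qed
  qed
  moreover have "wf_form L2 ?\<theta>" using \<gamma> \<psi> \<delta>(1) by auto
  ultimately have "unnests N ts \<gamma> ?\<theta>" unfolding unnests_def n[symmetric] by blast
  then show ?thesis ..
qed

end

section \<open>Translation of formulas along an interpretation\<close>

context interpretable
begin

lemma ex_fresh_block: "finite V \<Longrightarrow> \<exists>N. \<forall>i \<in> V. i < (N :: nat)"
  by (metis finite_nat_set_iff_bounded)

lemma translates_trm: "wf_trm L1 t \<Longrightarrow> translates_trm t"
proof (induction t)
  case (Var i)
  show ?case unfolding translates_trm_def
  proof (intro allI exI[of _ "block_eq i _"] conjI wf_block_eq ballI impI)
    fix j e' e a
    assume e: "e \<in> EA" "a \<in> dom A" "\<forall>v \<in> trm_vars (Var i). blk e' v = enc (e v)" "blk e' j = enc a"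
    then have "sat B e' (block_eq i j) \<longleftrightarrow> enc (e i) = enc a" by (simp add: sat_block_eq)
    also have "\<dots> \<longleftrightarrow> e i = a" using enc_inj e(1,2) by (auto simp: inj_on_def)
    finally show "sat B e' (block_eq i j) \<longleftrightarrow> val A e (Var i) = a" by simp
  qed
next
  case (App f ts)
  have f: "(f, length ts) \<in> funs L1" and ts: "\<And>t. t \<in> set ts \<Longrightarrow> wf_trm L1 t"
    using App.prems by (auto simp: list_all_iff)
  show ?case unfolding translates_trm_def
  proof
    fix j
    obtain N where N: "\<forall>i \<in> insert j (trm_vars (App f ts)). i < N" using ex_fresh_block by (metis finite_insert finite_trm_vars)
    obtain \<gamma> where \<gamma>: "wf_form L2 \<gamma>" "\<forall>e \<in> E. \<forall>as a. length as = length ts \<longrightarrow> set as \<subseteq> dom A \<longrightarrow> a \<in> dom A \<longrightarrow>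
         (\<forall>i < length ts. blk e (N + i) = enc (as ! i)) \<longrightarrow> blk e j = enc a \<longrightarrow> (sat B e \<gamma> \<longleftrightarrow> fn A f as = a)"
      using fn_form[OF f, of N j] by blast
    have Nt: "i < N" if "t \<in> set ts" "i \<in> trm_vars t" for t i using N that by auto
    have "\<exists>\<psi>. unnests N ts \<gamma> \<psi>"
      by (rule unnest) (use App.IH ts Nt \<gamma>(1) in blast)+
    then obtain \<psi> where \<psi>: "unnests N ts \<gamma> \<psi>" ..
    then have wf: "wf_form L2 \<psi>" by (simp add: unnests_def)
    show "\<exists>\<psi>. wf_form L2 \<psi> \<and> (\<forall>e' \<in> E. \<forall>e \<in> EA. \<forall>a \<in> dom A.
     (\<forall>i \<in> trm_vars (App f ts). blk e' i = enc (e i)) \<longrightarrow> blk e' j = enc a \<longrightarrow> (sat B e' \<psi> \<longleftrightarrow> val A e (App f ts) = a))"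
    proof (intro exI[of _ \<psi>] conjI wf ballI impI)
      fix e' e a assume e': "e' \<in> E" and e: "e \<in> EA" and a: "a \<in> dom A" "blk e' j = enc a"
        and bl: "\<forall>i \<in> trm_vars (App f ts). blk e' i = enc (e i)"
      have "sat B e' \<psi> \<longleftrightarrow> (\<lambda>as. fn A f as = a) (map (val A e) ts)"
      proof (rule unnestsD[OF \<psi> e' e], goal_cases)
        case (1 t i)
        then show ?case using bl by auto
      next
        case (2 e'' as)
        have "j < N" using N by simp
        then have "blk e'' j = enc a" using block_outside[of N "length ts" e'' e' j] 2(2) a(2) by simp
        then show ?case using \<gamma>(2) 2 a(1) by blast
      qed
      then show "sat B e' \<psi> \<longleftrightarrow> val A e (App f ts) = a" by simp
    qed
  qed
qed

definition translates :: "('f, 'r) form \<Rightarrow> ('g, 's) form \<Rightarrow> bool" where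
  "translates \<phi> \<psi> \<longleftrightarrow> wf_form L2 \<psi> \<and> (\<forall>e' \<in> E. \<forall>e \<in> EA.
     (\<forall>i \<in> free_vars \<phi>. blk e' i = enc (e i)) \<longrightarrow> (sat B e' \<psi> \<longleftrightarrow> sat A e \<phi>))"

text \<open>Equations and relation symbols are handled alike, as predicates \<open>Q\<close> of the
  list of values of the immediate terms.\<close>

lemma translates_atomic:
  assumes ts: "\<And>t. t \<in> set ts \<Longrightarrow> wf_trm L1 t"
    and \<gamma>: "\<And>N. \<exists>\<gamma>. wf_form L2 \<gamma> \<and> (\<forall>e \<in> E. \<forall>as. length as = length ts \<longrightarrow> set as \<subseteq> dom A \<longrightarrow>
         (\<forall>i < length ts. blk e (N + i) = enc (as ! i)) \<longrightarrow> (sat B e \<gamma> \<longleftrightarrow> Q as))"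
    and \<phi>: "free_vars \<phi> = (\<Union>t \<in> set ts. trm_vars t)" "\<And>e. sat A e \<phi> \<longleftrightarrow> Q (map (val A e) ts)"
  shows "\<exists>\<psi>. translates \<phi> \<psi>"
proof -
  have "finite (\<Union>t \<in> set ts. trm_vars t)" by simp
  then obtain N where N: "\<forall>i \<in> (\<Union>t \<in> set ts. trm_vars t). i < N" using ex_fresh_block by blast
  obtain \<gamma> where \<gamma>: "wf_form L2 \<gamma>" "\<forall>e \<in> E. \<forall>as. length as = length ts \<longrightarrow> set as \<subseteq> dom A \<longrightarrow>
         (\<forall>i < length ts. blk e (N + i) = enc (as ! i)) \<longrightarrow> (sat B e \<gamma> \<longleftrightarrow> Q as)" using \<gamma>[of N] by blast
  have Nt: "i < N" if "t \<in> set ts" "i \<in> trm_vars t" for t i using N that by auto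
  have "\<exists>\<psi>. unnests N ts \<gamma> \<psi>"
    by (rule unnest) (use translates_trm ts Nt \<gamma>(1) in blast)+
  then obtain \<psi> where \<psi>: "unnests N ts \<gamma> \<psi>" ..
  have "sat B e' \<psi> \<longleftrightarrow> Q (map (val A e) ts)"
    if e': "e' \<in> E" and e: "e \<in> EA" and bl: "\<forall>i \<in> free_vars \<phi>. blk e' i = enc (e i)" for e' e
  proof (rule unnestsD[OF \<psi> e' e], goal_cases)
    case (1 t i)
    then show ?case using bl \<phi>(1) by auto
  next
    case (2 e'' as)
    then show ?case using \<gamma>(2) by blast
  qed
  then show ?thesis using \<psi> \<phi>(2) unfolding translates_def unnests_def by (intro exI[of _ \<psi>]) simp
qed

text \<open>Atomic formulas are unnested, connectives are kept, and a quantifier over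
  \<open>A\<close> becomes a quantifier over one block relativized to codes.\<close>

theorem ex_translation: "wf_form L1 \<phi> \<Longrightarrow> \<exists>\<psi>. translates \<phi> \<psi>"
proof (induction \<phi>)
  case (Eq s t)
  show ?case
  proof (rule translates_atomic[of "[s, t]" "\<lambda>as. as ! 0 = as ! 1"])
    fix N
    have "sat B e (block_eq N (N + 1)) \<longleftrightarrow> as ! 0 = as ! 1"
      if "length as = length [s, t]" "set as \<subseteq> dom A" "\<forall>i < length [s, t]. blk e (N + i) = enc (as ! i)" for e as
    proof -
      have "as ! 0 \<in> dom A" "as ! 1 \<in> dom A" using that(1,2) by auto
      moreover have "blk e N = enc (as ! 0)" using that(3)[rule_format, of 0] by simp
      moreover have "blk e (N + 1) = enc (as ! 1)" using that(3)[rule_format, of 1] by simp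
      ultimately show ?thesis using enc_inj unfolding sat_block_eq by (simp add: inj_on_eq_iff)
    qed
    then show "\<exists>\<gamma>. wf_form L2 \<gamma> \<and> (\<forall>e \<in> E. \<forall>as. length as = length [s, t] \<longrightarrow> set as \<subseteq> dom A \<longrightarrow>
         (\<forall>i < length [s, t]. blk e (N + i) = enc (as ! i)) \<longrightarrow> (sat B e \<gamma> \<longleftrightarrow> as ! 0 = as ! 1))"
      by (intro exI[of _ "block_eq N (N + 1)"] conjI wf_block_eq) blast
  qed (use Eq in auto)
next
  case (Atom r ts)
  have r: "(r, length ts) \<in> rels L1" using Atom by simp
  show ?case
  proof (rule translates_atomic[of ts "rel A r"])
    show "\<exists>\<gamma>. wf_form L2 \<gamma> \<and> (\<forall>e \<in> E. \<forall>as. length as = length ts \<longrightarrow> set as \<subseteq> dom A \<longrightarrow>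
         (\<forall>i < length ts. blk e (N + i) = enc (as ! i)) \<longrightarrow> (sat B e \<gamma> \<longleftrightarrow> rel A r as))" for N
      by (rule rel_form[OF r])
  qed (use Atom in \<open>auto simp: list_all_iff\<close>)
next
  case (Neg \<phi>)
  then obtain \<psi> where "translates \<phi> \<psi>" by auto
  then have "translates (Neg \<phi>) (Neg \<psi>)" unfolding translates_def by simp
  then show ?case by blast
next
  case (And \<phi>1 \<phi>2)
  then obtain \<psi>1 \<psi>2 where "translates \<phi>1 \<psi>1" "translates \<phi>2 \<psi>2" by auto
  then have "translates (And \<phi>1 \<phi>2) (And \<psi>1 \<psi>2)" unfolding translates_def by simp
  then show ?case by blast
next
  case (Ex i \<phi>)
  then obtain \<psi> where \<psi>: "translates \<phi> \<psi>" by auto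
  obtain \<delta> where \<delta>: "wf_form L2 \<delta>" "\<forall>e \<in> E. sat B e \<delta> \<longleftrightarrow> blk e i \<in> enc ` dom A"
    using dom_form by blast
  let ?\<theta> = "exs (block_vars i 1) (And \<delta> \<psi>)"
  have "sat B e' ?\<theta> \<longleftrightarrow> sat A e (Ex i \<phi>)"
    if e': "e' \<in> E" and e: "e \<in> EA" and bl: "\<forall>v \<in> free_vars (Ex i \<phi>). blk e' v = enc (e v)" for e' e
  proof -
    have key: "sat B e'' \<psi> \<longleftrightarrow> sat A (e(i := a)) \<phi>"
      if E'': "e'' \<in> E" and out: "\<forall>v. v \<notin> block_vars i 1 \<longrightarrow> e'' v = e' v"
        and a: "a \<in> dom A" "blk e'' i = enc a" for e'' a
    proof -
      have "blk e'' v = enc ((e(i := a)) v)" if v: "v \<in> free_vars \<phi>" for v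
      proof (cases "v = i")
        case False
        then have "blk e'' v = blk e' v" by (intro block_outside[OF out]) auto
        then show ?thesis using bl v False by simp
      qed (simp add: a)
      moreover have "e(i := a) \<in> EA" using e a(1) by auto
      ultimately show ?thesis using \<psi> E'' unfolding translates_def by blast
    qed
    have r: "range e' \<subseteq> dom B" using e' by (auto simp: envs_def)
    show ?thesis unfolding sat_exs[OF finite_block_vars r]
    proof
      assume "\<exists>e''. range e'' \<subseteq> dom B \<and> (\<forall>v. v \<notin> block_vars i 1 \<longrightarrow> e'' v = e' v) \<and> sat B e'' (And \<delta> \<psi>)"
      then obtain e'' where e'': "range e'' \<subseteq> dom B" "\<forall>v. v \<notin> block_vars i 1 \<longrightarrow> e'' v = e' v"
        "sat B e'' \<delta>" "sat B e'' \<psi>" by auto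
      have E'': "e'' \<in> E" using envs_outside[OF e''(2) e' e''(1)] .
      then obtain a where "a \<in> dom A" "blk e'' i = enc a" using \<delta>(2) e''(3) by blast
      then show "sat A e (Ex i \<phi>)" using key[OF E'' e''(2)] e''(4) by auto
    next
      assume "sat A e (Ex i \<phi>)"
      then obtain a where a: "a \<in> dom A" "sat A (e(i := a)) \<phi>" by auto
      obtain e'' where e'': "range e'' \<subseteq> dom B" "\<forall>v. v \<notin> block_vars i 1 \<longrightarrow> e'' v = e' v"
        "\<forall>l < 1. blk e'' (i + l) = enc ([a] ! l)" using ex_blocks[OF e', of "[a]" 1 i] a(1) by auto
      have E'': "e'' \<in> E" using envs_outside[OF e''(2) e' e''(1)] .
      have "blk e'' i = enc a" using e''(3) by simp
      then have "sat B e'' \<psi>" "sat B e'' \<delta>" using key[OF E'' e''(2) a(1)] a \<delta>(2) E'' by auto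
      then show "\<exists>e''. range e'' \<subseteq> dom B \<and> (\<forall>v. v \<notin> block_vars i 1 \<longrightarrow> e'' v = e' v) \<and> sat B e'' (And \<delta> \<psi>)"
        using e'' by auto
    qed
  qed
  then have "translates (Ex i \<phi>) ?\<theta>" using \<psi> \<delta>(1) unfolding translates_def by simp
  then show ?case by blast
qed

section \<open>Transfer of patterns along an interpretation\<close>

definition flat :: "'a list \<Rightarrow> 'b list" where
  "flat a = map (\<lambda>v. enc (a ! (v div d)) ! (v mod d)) [0..<d * length a]"

lemma length_flat [simp]: "length (flat a) = d * length a"
  by (simp add: flat_def)

lemma div_less: "v < d * m \<Longrightarrow> v div d < m \<and> v mod d < d"
  by (cases "d = 0") (auto simp: less_mult_imp_div_less mult.commute)

lemma flat_tuples: "a \<in> tuples A m \<Longrightarrow> flat a \<in> tuples B (d * m)"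
proof -
  assume a: "a \<in> tuples A m"
  have "enc (a ! (v div d)) ! (v mod d) \<in> dom B" if "v < d * length a" for v
  proof -
    have "a ! (v div d) \<in> dom A" using a div_less[OF that] by (auto simp: tuples_def)
    then have "enc (a ! (v div d)) \<in> tuples B d" by (rule enc)
    then show ?thesis using div_less[OF that] by (auto simp: tuples_def)
  qed
  then show ?thesis using a by (auto simp: tuples_def flat_def)
qed

lemma block_less: "i < m \<Longrightarrow> l < d \<Longrightarrow> d * i + l < d * m"
proof -
  assume "i < m" "l < d"
  then have "d * i + l < d * Suc i" by simp
  also have "\<dots> \<le> d * m" using \<open>i < m\<close> by (intro mult_le_mono2) simp
  finally show ?thesis .
qed

lemma flat_nth: "i < length a \<Longrightarrow> l < d \<Longrightarrow> flat a ! (d * i + l) = enc (a ! i) ! l"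
  using block_less[of i "length a" l] by (simp add: flat_def)

lemma enc_length: "a \<in> tuples A m \<Longrightarrow> i < m \<Longrightarrow> length (enc (a ! i)) = d"
proof -
  assume "a \<in> tuples A m" "i < m"
  then have "a ! i \<in> dom A" by (auto simp: tuples_def)
  then show ?thesis using enc by (simp add: tuples_def)
qed

text \<open>The translation is conjoined with the domain formulas for the first tuple. All its
  solutions are then codes, so that absence of solutions is transferred as well as existence. The
  parameters \<open>c\<close> become the end of the second tuple.\<close>

theorem ex_transfer:
  assumes \<phi>: "partitioned L1 m n \<phi>"
  shows "\<exists>\<psi>. partitioned L2 (d * m) (d * n + p) \<psi> \<and>
    (\<forall>b \<in> tuples A n. (\<forall>a \<in> tuples A m. holds B \<psi> (flat a) (flat b @ c) = holds A \<phi> a b) \<and>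
      (\<forall>x \<in> tuples B (d * m). holds B \<psi> x (flat b @ c) \<longrightarrow> x \<in> flat ` tuples A m))"
proof -
  obtain \<theta> where \<theta>: "translates \<phi> \<theta>" using ex_translation \<phi> by (auto simp: partitioned_def)
  have "\<forall>j. \<exists>\<delta>. wf_form L2 \<delta> \<and> (\<forall>e \<in> E. sat B e \<delta> \<longleftrightarrow> blk e j \<in> enc ` dom A)"
    using dom_form by blast
  from choice[OF this] obtain \<delta> where \<delta>: "\<And>j. wf_form L2 (\<delta> j)"
    "\<And>j e. e \<in> E \<Longrightarrow> sat B e (\<delta> j) \<longleftrightarrow> blk e j \<in> enc ` dom A" by blast
  define \<theta>' where "\<theta>' = And \<theta> (Conj (map \<delta> [0..<m]))"
  define M where "M = d * m + d * n + p"
  \<comment> \<open>The translation has the parameters in front of all blocks; a partitioned formula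
    needs them behind both tuples.\<close>
  define f where "f v = (if v < p then d * m + d * n + v else if v < p + d * (m + n) then v - p else v)" for v
  \<comment> \<open>The translation gives no control over its free variables. Those outside the two
    tuples are quantified away; they do not affect the truth of the translation.\<close>
  define V where "V = free_vars (ren \<theta>' f) - {..<M}"
  have fV: "finite V" by (simp add: V_def)
  define \<psi> where "\<psi> = exs V (ren \<theta>' f)"
  have wf: "wf_form L2 \<psi>" using \<theta> \<delta>(1) by (simp add: \<psi>_def \<theta>'_def translates_def)
  moreover have "free_vars \<psi> \<subseteq> {..<M}" unfolding \<psi>_def free_vars_exs[OF fV] by (auto simp: V_def)
  ultimately have part: "partitioned L2 (d * m) (d * n + p) \<psi>"
    by (simp add: partitioned_def M_def add.assoc)
  obtain d0 where d0: "d0 \<in> dom B" using B by (auto simp: is_struct_def)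
  have env: "(\<lambda>v. e' (f v)) \<in> E" "\<And>i. i < m \<Longrightarrow> blk (\<lambda>v. e' (f v)) i = map (\<lambda>l. x ! (d * i + l)) [0..<d]"
    "\<And>j. j < n \<Longrightarrow> blk (\<lambda>v. e' (f v)) (m + j) = enc (b ! j)"
    if x: "x \<in> tuples B (d * m)" and b: "b \<in> tuples A n"
      and e': "range e' \<subseteq> dom B" "\<forall>v < M. e' v = (x @ flat b @ c) ! v" for x b e'
  proof -
    have len: "length x = d * m" "length b = n" using x b by (auto simp: tuples_def)
    show "(\<lambda>v. e' (f v)) \<in> E"
      using e' len by (auto simp: envs_def f_def M_def nth_append)
    show "blk (\<lambda>v. e' (f v)) i = map (\<lambda>l. x ! (d * i + l)) [0..<d]" if "i < m" for i
      unfolding block_def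
    proof (rule map_cong[OF refl], goal_cases)
      case (1 l)
      then have "d * i + l < d * m" using block_less that by simp
      then show ?case using e'(2) len by (simp add: f_def M_def nth_append algebra_simps)
    qed
    show "blk (\<lambda>v. e' (f v)) (m + j) = enc (b ! j)" if "j < n" for j
    proof (rule nth_equalityI)
      show "length (blk (\<lambda>v. e' (f v)) (m + j)) = length (enc (b ! j))"
        using enc_length[OF b that] by (simp add: block_def)
      fix l assume "l < length (blk (\<lambda>v. e' (f v)) (m + j))"
      then have l: "l < d" by (simp add: block_def)
      have jl: "d * j + l < d * n" using block_less l that by simp
      have "f (p + d * (m + j) + l) = d * m + (d * j + l)" using jl by (simp add: f_def algebra_simps)
      then have "e' (f (p + d * (m + j) + l)) = flat b ! (d * j + l)"
        using e'(2) jl len by (simp add: M_def nth_append)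
      then show "blk (\<lambda>v. e' (f v)) (m + j) ! l = enc (b ! j) ! l"
        using l that len by (simp add: block_def flat_nth)
    qed
  qed
  have holds_iff: "holds B \<psi> x (flat b @ c) \<longleftrightarrow> (\<exists>e'. range e' \<subseteq> dom B \<and>
      (\<forall>v < M. e' v = (x @ flat b @ c) ! v) \<and> sat B (\<lambda>v. e' (f v)) \<theta>')"
    if x: "x \<in> tuples B (d * m)" and b: "b \<in> tuples A n" for x b
  proof -
    have len: "length x = d * m" "length b = n" using x b by (auto simp: tuples_def)
    define y where "y = x @ flat b @ c"
    have y: "length y = M" "set y \<subseteq> dom B"
      using x flat_tuples[OF b] c len by (auto simp: y_def M_def tuples_def)
    have yv: "y ! v \<in> dom B" if "v < M" for v using y that by (metis nth_mem subsetD)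
    define e where "e v = (if v < M then y ! v else d0)" for v
    have e: "range e \<subseteq> dom B" using yv d0 by (auto simp: e_def)
    have "holds B \<psi> x (flat b @ c) \<longleftrightarrow> sat B e \<psi>"
      using len by (intro holds_cong[OF part]) (auto simp: e_def y_def M_def nth_append)
    also have "\<dots> \<longleftrightarrow> (\<exists>e'. range e' \<subseteq> dom B \<and> (\<forall>i. i \<notin> V \<longrightarrow> e' i = e i) \<and> sat B e' (ren \<theta>' f))"
      unfolding \<psi>_def by (rule sat_exs[OF fV e])
    also have "\<dots> \<longleftrightarrow> (\<exists>e'. range e' \<subseteq> dom B \<and> (\<forall>v < M. e' v = y ! v) \<and> sat B e' (ren \<theta>' f))"
    proof (rule iffI; elim exE conjE)
      fix e' assume "range e' \<subseteq> dom B" "\<forall>i. i \<notin> V \<longrightarrow> e' i = e i" "sat B e' (ren \<theta>' f)"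
      then show "\<exists>e'. range e' \<subseteq> dom B \<and> (\<forall>v < M. e' v = y ! v) \<and> sat B e' (ren \<theta>' f)"
        by (intro exI[of _ e']) (auto simp: e_def V_def)
    next
      fix e' assume e': "range e' \<subseteq> dom B" "\<forall>v < M. e' v = y ! v" "sat B e' (ren \<theta>' f)"
      define e'' where "e'' v = (if v \<in> V then e' v else e v)" for v
      have "sat B e'' (ren \<theta>' f) \<longleftrightarrow> sat B e' (ren \<theta>' f)"
        by (rule sat_cong) (use e'(2) in \<open>auto simp: e''_def V_def e_def\<close>)
      then show "\<exists>e'. range e' \<subseteq> dom B \<and> (\<forall>i. i \<notin> V \<longrightarrow> e' i = e i) \<and> sat B e' (ren \<theta>' f)"
        using e' e by (intro exI[of _ e'']) (auto simp: e''_def)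
    qed
    finally show ?thesis by (simp add: sat_ren comp_def y_def)
  qed
  have "holds B \<psi> (flat a) (flat b @ c) = holds A \<phi> a b" if a: "a \<in> tuples A m" and b: "b \<in> tuples A n" for a b
  proof -
    have len: "length a = m" "length b = n" using a b by (auto simp: tuples_def)
    obtain a0 where a0: "a0 \<in> dom A" using A by (auto simp: is_struct_def)
    define e where "e v = (if v < m + n then (a @ b) ! v else a0)" for v
    have "(a @ b) ! v \<in> dom A" if "v < m + n" for v
    proof -
      have "(a @ b) ! v \<in> set (a @ b)" using that len by (intro nth_mem) simp
      then show ?thesis using a b by (auto simp: tuples_def)
    qed
    then have e: "e \<in> EA" using a0 by (auto simp: e_def)
    have "holds A \<phi> a b \<longleftrightarrow> sat A e \<phi>"
      using len by (intro holds_cong[OF \<phi>]) (auto simp: e_def nth_append)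
    moreover have "sat B (\<lambda>v. e' (f v)) \<theta>' \<longleftrightarrow> sat A e \<phi>"
      if e': "range e' \<subseteq> dom B" "\<forall>v < M. e' v = (flat a @ flat b @ c) ! v" for e'
    proof -
      note en = env[OF flat_tuples[OF a] b e']
      have ba: "blk (\<lambda>v. e' (f v)) i = enc (a ! i)" if i: "i < m" for i
        unfolding en(2)[OF i] using enc_length[OF a i] len i by (intro nth_equalityI) (auto simp: flat_nth)
      have "blk (\<lambda>v. e' (f v)) i = enc (e i)" if "i \<in> free_vars \<phi>" for i
      proof -
        have "i < m + n" using \<phi> that by (auto simp: partitioned_def)
        then show ?thesis using ba[of i] en(3)[of "i - m"] len by (cases "i < m") (auto simp: e_def nth_append)
      qed
      then have "sat B (\<lambda>v. e' (f v)) \<theta> \<longleftrightarrow> sat A e \<phi>"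
        using \<theta> en(1) e unfolding translates_def by blast
      moreover have "sat B (\<lambda>v. e' (f v)) (\<delta> i)" if i: "i < m" for i
      proof -
        have "a ! i \<in> dom A" using a i by (auto simp: tuples_def)
        then show ?thesis using \<delta>(2)[OF en(1)] ba[OF i] by simp
      qed
      ultimately show ?thesis by (auto simp: \<theta>'_def)
    qed
    moreover obtain e' where "range e' \<subseteq> dom B" "\<forall>v < M. e' v = (flat a @ flat b @ c) ! v"
    proof
      let ?y = "flat a @ flat b @ c"
      have "set ?y \<subseteq> dom B" using c flat_tuples[OF a] flat_tuples[OF b] by (auto simp: tuples_def)
      moreover have "length ?y = M" using len by (simp add: M_def)
      ultimately have "?y ! v \<in> dom B" if "v < M" for v using that by (metis nth_mem subsetD)
      then show "range (\<lambda>v. if v < M then ?y ! v else d0) \<subseteq> dom B" using d0 by auto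
    qed simp
    ultimately show ?thesis unfolding holds_iff[OF flat_tuples[OF a] b] by blast
  qed
  moreover have "x \<in> flat ` tuples A m" if x: "x \<in> tuples B (d * m)" and b: "b \<in> tuples A n"
    and h: "holds B \<psi> x (flat b @ c)" for x b
  proof -
    obtain e' where e': "range e' \<subseteq> dom B" "\<forall>v < M. e' v = (x @ flat b @ c) ! v" "sat B (\<lambda>v. e' (f v)) \<theta>'"
      using h holds_iff[OF x b] by blast
    note en = env[OF x b e'(1,2)]
    have "map (\<lambda>l. x ! (d * i + l)) [0..<d] \<in> enc ` dom A" if "i < m" for i
    proof -
      have "sat B (\<lambda>v. e' (f v)) (\<delta> i)" using e'(3) that by (simp add: \<theta>'_def)
      then show ?thesis using \<delta>(2)[OF en(1)] en(2)[OF that] by simp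
    qed
    then have "\<forall>i. \<exists>a. i < m \<longrightarrow> a \<in> dom A \<and> map (\<lambda>l. x ! (d * i + l)) [0..<d] = enc a" by blast
    from choice[OF this] obtain g
      where g': "\<forall>i. i < m \<longrightarrow> g i \<in> dom A \<and> map (\<lambda>l. x ! (d * i + l)) [0..<d] = enc (g i)" ..
    have g: "g i \<in> dom A" "enc (g i) = map (\<lambda>l. x ! (d * i + l)) [0..<d]" if "i < m" for i
      using g' that by simp_all
    have "map g [0..<m] \<in> tuples A m" using g(1) by (auto simp: tuples_def)
    moreover have "x = flat (map g [0..<m])"
    proof (rule nth_equalityI)
      show "length x = length (flat (map g [0..<m]))" using x by (simp add: tuples_def)
      fix v assume "v < length x"
      then have v: "v < d * m" using x by (simp add: tuples_def)
      then show "x ! v = flat (map g [0..<m]) ! v" using div_less[OF v] g(2) by (simp add: flat_def)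
    qed
    ultimately show ?thesis by blast
  qed
  ultimately show ?thesis using part by blast
qed

text \<open>A common solution of translated instances is the code of a common solution of the
  original instances, so the pattern itself is unchanged and only the formula and its tuples are
  replaced.\<close>

theorem finitely_realized_transfer:
  assumes "finitely_realized L1 A Nm Cs"
  shows "finitely_realized L2 B Nm Cs"
proof -
  obtain m n \<phi> where \<phi>: "partitioned L1 m n \<phi>"
    and fin: "\<And>Nm' Cs'. finite Nm' \<Longrightarrow> Nm' \<subseteq> Nm \<Longrightarrow> finite Cs' \<Longrightarrow> Cs' \<subseteq> Cs \<Longrightarrow> realizes A m n \<phi> Nm' Cs'"
    using assms unfolding finitely_realized_def by blast
  obtain \<psi> where \<psi>: "partitioned L2 (d * m) (d * n + p) \<psi>"
    "\<forall>b \<in> tuples A n. (\<forall>a \<in> tuples A m. holds B \<psi> (flat a) (flat b @ c) = holds A \<phi> a b) \<and>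
      (\<forall>x \<in> tuples B (d * m). holds B \<psi> x (flat b @ c) \<longrightarrow> x \<in> flat ` tuples A m)"
    using ex_transfer[OF \<phi>] by blast
  have h: "holds B \<psi> (flat a) (flat b @ c) = holds A \<phi> a b" if "a \<in> tuples A m" "b \<in> tuples A n" for a b
    using \<psi>(2) that by blast
  have surj: "x \<in> flat ` tuples A m" if "x \<in> tuples B (d * m)" "b \<in> tuples A n" "holds B \<psi> x (flat b @ c)" for x b
    using \<psi>(2) that by blast
  have "realizes B (d * m) (d * n + p) \<psi> Nm' Cs'"
    if r: "realizes A m n \<phi> Nm' Cs'" for Nm' Cs'
  proof -
    from r[unfolded realizes_def] obtain a b where ab: "\<forall>i::nat. a i \<in> tuples A m \<and> b i \<in> tuples A n"
      "\<forall>(i, j, s) \<in> Nm'. holds A \<phi> (a i) (b j) = s"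
      "\<forall>(s, S) \<in> Cs'. (\<exists>x \<in> tuples A m. \<forall>j \<in> S. holds A \<phi> x (b j)) = s" by (elim exE conjE)
    have ex: "(\<exists>x \<in> tuples B (d * m). \<forall>j \<in> S. holds B \<psi> x (flat (b j) @ c)) \<longleftrightarrow>
        (\<exists>x \<in> tuples A m. \<forall>j \<in> S. holds A \<phi> x (b j))" for S
    proof
      assume "\<exists>x \<in> tuples B (d * m). \<forall>j \<in> S. holds B \<psi> x (flat (b j) @ c)"
      then obtain x where x: "x \<in> tuples B (d * m)" "\<forall>j \<in> S. holds B \<psi> x (flat (b j) @ c)" ..
      show "\<exists>x \<in> tuples A m. \<forall>j \<in> S. holds A \<phi> x (b j)"
      \<comment> \<open>For empty \<open>S\<close> nothing forces \<open>x\<close> to be a code; any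
        tuple of the given realization will do.\<close>
      proof (cases "S = {}")
        case True
        then show ?thesis using ab(1) by blast
      next
        case False
        then obtain a' where "a' \<in> tuples A m" "x = flat a'" using x surj ab(1) by blast
        then show ?thesis using x(2) h ab(1) by blast
      qed
    next
      assume "\<exists>x \<in> tuples A m. \<forall>j \<in> S. holds A \<phi> x (b j)"
      then show "\<exists>x \<in> tuples B (d * m). \<forall>j \<in> S. holds B \<psi> x (flat (b j) @ c)"
        using h flat_tuples ab(1) by blast
    qed
    have t: "flat (b i) @ c \<in> tuples B (d * n + p)" "flat (a i) \<in> tuples B (d * m)" for i
      using ab(1) flat_tuples c by (auto simp: tuples_def)
    show ?thesis unfolding realizes_def
      by (rule exI[of _ "\<lambda>i. flat (a i)"], rule exI[of _ "\<lambda>i. flat (b i) @ c"])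
        (use ab t h in \<open>simp add: ex\<close>)
  qed
  then show ?thesis unfolding finitely_realized_def using \<psi>(1) fin by blast
qed

end

subsection \<open>Root elements and their commutators\<close>

lemma UNIV_g2_weight: "UNIV = {Wt0, WtP 0, WtP 1, WtP 2, WtN 0, WtN 1, WtN 2}"
proof -
  have "w \<in> {Wt0, WtP 0, WtP 1, WtP 2, WtN 0, WtN 1, WtN 2}" for w
  proof -
    have "i = 0 \<or> i = 1 \<or> i = 2" for i :: 3 using exhaust_3[of i] by auto
    then show ?thesis by (cases w) auto
  qed
  then show ?thesis by blast
qed

lemma all_g2_weight:
  "(\<forall>w. P w) \<longleftrightarrow> P Wt0 \<and> P (WtP 0) \<and> P (WtP 1) \<and> P (WtP 2) \<and> P (WtN 0) \<and> P (WtN 1) \<and> P (WtN 2)"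
proof -
  have "(\<forall>w. P w) \<longleftrightarrow> (\<forall>w \<in> {Wt0, WtP 0, WtP 1, WtP 2, WtN 0, WtN 1, WtN 2}. P w)"
    unfolding UNIV_g2_weight[symmetric] by blast
  then show ?thesis by simp
qed

lemma sum_g2_weight:
  "(\<Sum>w \<in> UNIV. f w) = f Wt0 + f (WtP 0) + f (WtP 1) + f (WtP 2) + f (WtN 0) + f (WtN 1) + f (WtN 2)"
  unfolding UNIV_g2_weight by (simp add: mod3_simps add.assoc)

text \<open>Left multiplication by a root element changes few rows. Written out once, it replaces
  later matrix products by rewriting of single entries.\<close>

fun row_op :: "g2_root \<Rightarrow> 'a::field \<Rightarrow> (g2_weight \<Rightarrow> 'a) \<Rightarrow> g2_weight \<Rightarrow> 'a" where
  "row_op (ShortP i) t v Wt0 = v Wt0 + t * v (WtN i)"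
| "row_op (ShortP i) t v (WtP j) =
     v (WtP j) + (if j = i then 2 * t * v Wt0 + t\<^sup>2 * v (WtN i) else 0)"
| "row_op (ShortP i) t v (WtN j) =
     v (WtN j) + (if j = i + 2 then t * v (WtP (i + 1)) else if j = i + 1 then - t * v (WtP (i + 2)) else 0)"
| "row_op (ShortN i) t v Wt0 = v Wt0 + t * v (WtP i)"
| "row_op (ShortN i) t v (WtN j) =
     v (WtN j) + (if j = i then 2 * t * v Wt0 + t\<^sup>2 * v (WtP i) else 0)"
| "row_op (ShortN i) t v (WtP j) =
     v (WtP j) + (if j = i + 1 then t * v (WtN (i + 2)) else if j = i + 2 then - t * v (WtN (i + 1)) else 0)"
| "row_op (LongP i) t v Wt0 = v Wt0"
| "row_op (LongP i) t v (WtP j) = v (WtP j) + (if j = i + 1 then t * v (WtP (i + 2)) else 0)"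
| "row_op (LongP i) t v (WtN j) = v (WtN j) + (if j = i + 2 then - t * v (WtN (i + 1)) else 0)"
| "row_op (LongN i) t v Wt0 = v Wt0"
| "row_op (LongN i) t v (WtP j) = v (WtP j) + (if j = i + 2 then t * v (WtP (i + 1)) else 0)"
| "row_op (LongN i) t v (WtN j) = v (WtN j) + (if j = i + 1 then - t * v (WtN (i + 2)) else 0)"

text \<open>The same for multiplication from the right, acting on the entries of a row.\<close>

fun col_op :: "g2_root \<Rightarrow> 'a::field \<Rightarrow> (g2_weight \<Rightarrow> 'a) \<Rightarrow> g2_weight \<Rightarrow> 'a" where
  "col_op (ShortP i) t v Wt0 = v Wt0 + 2 * t * v (WtP i)"
| "col_op (ShortP i) t v (WtN j) = v (WtN j) + (if j = i then t * v Wt0 + t\<^sup>2 * v (WtP i) else 0)"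
| "col_op (ShortP i) t v (WtP j) =
     v (WtP j) + (if j = i + 1 then t * v (WtN (i + 2)) else if j = i + 2 then - t * v (WtN (i + 1)) else 0)"
| "col_op (ShortN i) t v Wt0 = v Wt0 + 2 * t * v (WtN i)"
| "col_op (ShortN i) t v (WtP j) = v (WtP j) + (if j = i then t * v Wt0 + t\<^sup>2 * v (WtN i) else 0)"
| "col_op (ShortN i) t v (WtN j) =
     v (WtN j) + (if j = i + 2 then t * v (WtP (i + 1)) else if j = i + 1 then - t * v (WtP (i + 2)) else 0)"
| "col_op (LongP i) t v Wt0 = v Wt0"
| "col_op (LongP i) t v (WtP j) = v (WtP j) + (if j = i + 2 then t * v (WtP (i + 1)) else 0)"
| "col_op (LongP i) t v (WtN j) = v (WtN j) + (if j = i + 1 then - t * v (WtN (i + 2)) else 0)"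
| "col_op (LongN i) t v Wt0 = v Wt0"
| "col_op (LongN i) t v (WtP j) = v (WtP j) + (if j = i + 1 then t * v (WtP (i + 2)) else 0)"
| "col_op (LongN i) t v (WtN j) = v (WtN j) + (if j = i + 2 then - t * v (WtN (i + 1)) else 0)"

lemma root_elt_mult: "(root_elt \<alpha> t ** A) $ r $ s = row_op \<alpha> t (\<lambda>q. A $ q $ s) r"
proof -
  have "\<forall>\<alpha> r. (\<Sum>q \<in> UNIV. root_elt \<alpha> t $ r $ q * A $ q $ s) = row_op \<alpha> t (\<lambda>q. A $ q $ s) r"
    unfolding sum_g2_weight all_g2_root all_mod3 all_g2_weight
    by (simp add: root_elt_def mat_unit_mult mat_mult_add mod3_simps)
      (simp add: mat_unit_def mod3_simps algebra_simps)
  then show ?thesis by (simp add: matrix_matrix_mult_def)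
qed

lemma mult_root_elt: "(A ** root_elt \<alpha> t) $ r $ s = col_op \<alpha> t (\<lambda>q. A $ r $ q) s"
proof -
  have "\<forall>\<alpha> s. (\<Sum>q \<in> UNIV. A $ r $ q * root_elt \<alpha> t $ q $ s) = col_op \<alpha> t (\<lambda>q. A $ r $ q) s"
    unfolding sum_g2_weight all_g2_root all_mod3 all_g2_weight
    by (simp add: root_elt_def mat_unit_mult mat_mult_add mod3_simps)
      (simp add: mat_unit_def mod3_simps algebra_simps)
  then show ?thesis by (simp add: matrix_matrix_mult_def)
qed

lemma root_elt_0: "root_elt \<alpha> 0 = mat 1"
  by (simp add: root_elt_def mat_def vec_eq_iff)

text \<open>The trailing \<open>A\<close> keeps products nested to the right, the form to which
  \<open>root_elt_mult\<close> applies; later identities have it for the same reason.\<close>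

lemma root_elt_add_mult: "root_elt \<alpha> t ** (root_elt \<alpha> u ** A) = root_elt \<alpha> (t + u) ** A"
proof -
  have "\<forall>\<alpha> r. (root_elt \<alpha> t ** (root_elt \<alpha> u ** A)) $ r $ s = (root_elt \<alpha> (t + u) ** A) $ r $ s" for s
    unfolding root_elt_mult all_g2_root all_mod3 all_g2_weight
    by (simp add: mod3_simps algebra_simps power2_eq_square)
  then show ?thesis by (simp add: vec_eq_iff)
qed

text \<open>Chevalley's commutator of \<open>root_elt \<alpha> t\<close> and
  \<open>root_elt \<beta> u\<close> in characteristic 3, as a list of root elements whose product
  stands to the left of the exchanged factors. Coefficients divisible by 3 are dropped, which
  removes every long root from the commutator of two short ones, and 2 has become -1. Values at
  equal roots have no meaning.\<close>

fun comm :: "g2_root \<Rightarrow> g2_root \<Rightarrow> 'a::field \<Rightarrow> 'a \<Rightarrow> (g2_root \<times> 'a) list" where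
  "comm (ShortP i) (ShortP j) t u =
     (if j = i + 1 then [(ShortN (i + 2), - (t * u))] else [(ShortN (i + 1), t * u)])"
| "comm (ShortN i) (ShortN j) t u =
     (if j = i + 1 then [(ShortP (i + 2), t * u)] else [(ShortP (i + 1), - (t * u))])"
| "comm (LongP i) (LongP j) t u =
     (if j = i + 1 then [(LongN (i + 2), t * u)] else [(LongN (i + 1), - (t * u))])"
| "comm (LongN i) (LongN j) t u =
     (if j = i + 1 then [(LongP (i + 2), - (t * u))] else [(LongP (i + 1), t * u)])"
| "comm (LongP i) (ShortP j) t u = (if j = i + 2 then
     [(ShortP (i + 1), t * u), (ShortN i, - (t * u ^ 2)), (LongP (i + 1), - (t * u ^ 3)), (LongN (i + 2), t ^ 2 * u ^ 3)] else [])"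
| "comm (LongP i) (ShortN j) t u = (if j = i + 1 then
     [(ShortN (i + 2), - (t * u)), (ShortP i, t * u ^ 2), (LongP (i + 2), - (t * u ^ 3)), (LongN (i + 1), - (t ^ 2 * u ^ 3))] else [])"
| "comm (LongN i) (ShortP j) t u = (if j = i + 1 then
     [(ShortP (i + 2), t * u), (ShortN i, t * u ^ 2), (LongN (i + 2), t * u ^ 3), (LongP (i + 1), - (t ^ 2 * u ^ 3))] else [])"
| "comm (LongN i) (ShortN j) t u = (if j = i + 2 then
     [(ShortN (i + 1), - (t * u)), (ShortP i, - (t * u ^ 2)), (LongN (i + 1), t * u ^ 3), (LongP (i + 2), t ^ 2 * u ^ 3)] else [])"
| "comm (ShortP i) (LongP j) t u = (if j = i + 1 then
     [(ShortP (i + 2), - (t * u)), (ShortN (i + 1), t ^ 2 * u), (LongP (i + 2), t ^ 3 * u), (LongN i, - (t ^ 3 * u ^ 2))] else [])"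
| "comm (ShortP i) (LongN j) t u = (if j = i + 2 then
     [(ShortP (i + 1), - (t * u)), (ShortN (i + 2), - (t ^ 2 * u)), (LongN (i + 1), - (t ^ 3 * u)), (LongP i, t ^ 3 * u ^ 2)] else [])"
| "comm (ShortN i) (LongP j) t u = (if j = i + 2 then
     [(ShortN (i + 1), t * u), (ShortP (i + 2), - (t ^ 2 * u)), (LongP (i + 1), t ^ 3 * u), (LongN i, t ^ 3 * u ^ 2)] else [])"
| "comm (ShortN i) (LongN j) t u = (if j = i + 1 then
     [(ShortN (i + 2), t * u), (ShortP (i + 1), t ^ 2 * u), (LongN (i + 2), - (t ^ 3 * u)), (LongP i, - (t ^ 3 * u ^ 2))] else [])"
| "comm _ _ t u = []"

fun opp :: "g2_root \<Rightarrow> g2_root" where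
  "opp (ShortP i) = ShortN i"
| "opp (ShortN i) = ShortP i"
| "opp (LongP i) = LongN i"
| "opp (LongN i) = LongP i"

definition word :: "(g2_root \<times> 'a::field) list \<Rightarrow> 'a g2_matrix \<Rightarrow> 'a g2_matrix" where
  "word ws A = foldr (\<lambda>(\<alpha>, t) A. root_elt \<alpha> t ** A) ws A"

lemma word_simps [simp]: "word [] A = A" "word ((\<alpha>, t) # ws) A = root_elt \<alpha> t ** word ws A"
  by (simp_all add: word_def)

text \<open>The standard representative in the group of the reflection in \<open>\<alpha>\<close>,
  applied to \<open>A\<close> from the left.\<close>

definition weyl :: "g2_root \<Rightarrow> 'a::field g2_matrix \<Rightarrow> 'a g2_matrix" where
  "weyl \<alpha> A = word [(\<alpha>, 1), (opp \<alpha>, - 1), (\<alpha>, 1)] A"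

context
  assumes char3: "CHAR('a::field) = 3"
begin

lemma three_eq_0: "(3 :: 'a) = 0"
  using of_nat_CHAR[where 'a = 'a] char3 by simp

lemma two_eq: "(2 :: 'a) = - 1"
  using three_eq_0 by (simp add: eq_neg_iff_add_eq_0)

text \<open>As rewrite rules these reduce repeated summands modulo 3; the second form reaches into
  sums nested to the right.\<close>

lemma add_self: "(x :: 'a) + x = - x" "(x :: 'a) + (x + y) = - x + y"
proof -
  have "x + x = 2 * x" by simp
  then show "x + x = - x" by (simp only: two_eq mult_minus1)
  then show "x + (x + y) = - x + y" by (simp add: add.assoc[symmetric])
qed

text \<open>Each relation is verified row by row on an arbitrary column, by cases on both roots,
  with coefficients reduced modulo 3.\<close>

lemma root_elt_comm_ShortP:
  fixes A :: "'a g2_matrix"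
  shows "\<forall>i \<beta>. ShortP i \<noteq> \<beta> \<longrightarrow> ShortN i \<noteq> \<beta> \<longrightarrow> (\<forall>r. (root_elt (ShortP i) t ** (root_elt \<beta> u ** A)) $ r $ s =
     word (comm (ShortP i) \<beta> t u) (root_elt \<beta> u ** (root_elt (ShortP i) t ** A)) $ r $ s)"
  unfolding all_g2_root all_mod3 all_g2_weight
  by (simp add: root_elt_mult mod3_simps two_eq algebra_simps power2_eq_square power3_eq_cube add_self)

lemma root_elt_comm_ShortN:
  fixes A :: "'a g2_matrix"
  shows "\<forall>i \<beta>. ShortN i \<noteq> \<beta> \<longrightarrow> ShortP i \<noteq> \<beta> \<longrightarrow> (\<forall>r. (root_elt (ShortN i) t ** (root_elt \<beta> u ** A)) $ r $ s =
     word (comm (ShortN i) \<beta> t u) (root_elt \<beta> u ** (root_elt (ShortN i) t ** A)) $ r $ s)"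
  unfolding all_g2_root all_mod3 all_g2_weight
  by (simp add: root_elt_mult mod3_simps two_eq algebra_simps power2_eq_square power3_eq_cube add_self)

lemma root_elt_comm_LongP:
  fixes A :: "'a g2_matrix"
  shows "\<forall>i \<beta>. LongP i \<noteq> \<beta> \<longrightarrow> LongN i \<noteq> \<beta> \<longrightarrow> (\<forall>r. (root_elt (LongP i) t ** (root_elt \<beta> u ** A)) $ r $ s =
     word (comm (LongP i) \<beta> t u) (root_elt \<beta> u ** (root_elt (LongP i) t ** A)) $ r $ s)"
  unfolding all_g2_root all_mod3 all_g2_weight
  by (simp add: root_elt_mult mod3_simps two_eq algebra_simps power2_eq_square power3_eq_cube add_self)

lemma root_elt_comm_LongN:
  fixes A :: "'a g2_matrix"
  shows "\<forall>i \<beta>. LongN i \<noteq> \<beta> \<longrightarrow> LongP i \<noteq> \<beta> \<longrightarrow> (\<forall>r. (root_elt (LongN i) t ** (root_elt \<beta> u ** A)) $ r $ s =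
     word (comm (LongN i) \<beta> t u) (root_elt \<beta> u ** (root_elt (LongN i) t ** A)) $ r $ s)"
  unfolding all_g2_root all_mod3 all_g2_weight
  by (simp add: root_elt_mult mod3_simps two_eq algebra_simps power2_eq_square power3_eq_cube add_self)

theorem root_elt_comm:
  fixes A :: "'a g2_matrix"
  assumes "\<alpha> \<noteq> \<beta>" "opp \<alpha> \<noteq> \<beta>"
  shows "root_elt \<alpha> t ** (root_elt \<beta> u ** A) = word (comm \<alpha> \<beta> t u) (root_elt \<beta> u ** (root_elt \<alpha> t ** A))"
  using assms root_elt_comm_ShortP root_elt_comm_ShortN root_elt_comm_LongP root_elt_comm_LongN
  by (cases \<alpha>) (simp_all add: vec_eq_iff)

end

subsection \<open>Bounded generation\<close>

text \<open>The action on column vectors of the matrix with rows \<open>(p, q)\<close> and \<open>(r, s)\<close> under the homomorphism from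
  \<open>SL\<^sub>2\<close> attached to a root and its opposite; meaningful only for the roots \<open>ShortP i\<close> and \<open>LongN i\<close>.\<close>

fun sl2 :: "g2_root \<Rightarrow> 'a::field \<Rightarrow> 'a \<Rightarrow> 'a \<Rightarrow> 'a \<Rightarrow> (g2_weight \<Rightarrow> 'a) \<Rightarrow> g2_weight \<Rightarrow> 'a" where
  "sl2 (ShortP i) p q r s v Wt0 = p * r * v (WtP i) + (p * s + q * r) * v Wt0 + q * s * v (WtN i)"
| "sl2 (ShortP i) p q r s v (WtP j) =
     (if j = i then p\<^sup>2 * v (WtP i) + 2 * p * q * v Wt0 + q\<^sup>2 * v (WtN i)
      else if j = i + 1 then r * v (WtN (i + 2)) + s * v (WtP (i + 1))
      else s * v (WtP (i + 2)) - r * v (WtN (i + 1)))"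
| "sl2 (ShortP i) p q r s v (WtN j) =
     (if j = i then r\<^sup>2 * v (WtP i) + 2 * r * s * v Wt0 + s\<^sup>2 * v (WtN i)
      else if j = i + 2 then p * v (WtN (i + 2)) + q * v (WtP (i + 1))
      else p * v (WtN (i + 1)) - q * v (WtP (i + 2)))"
| "sl2 (LongN i) p q r s v Wt0 = v Wt0"
| "sl2 (LongN i) p q r s v (WtP j) =
     (if j = i then v (WtP i)
      else if j = i + 2 then p * v (WtP (i + 2)) + q * v (WtP (i + 1))
      else r * v (WtP (i + 2)) + s * v (WtP (i + 1)))"
| "sl2 (LongN i) p q r s v (WtN j) =
     (if j = i then v (WtN i)
      else if j = i + 1 then p * v (WtN (i + 1)) - q * v (WtN (i + 2))
      else s * v (WtN (i + 2)) - r * v (WtN (i + 1)))"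
| "sl2 _ p q r s v w = v w"

definition sl2_mult :: "g2_root \<Rightarrow> 'a::field \<Rightarrow> 'a \<Rightarrow> 'a \<Rightarrow> 'a \<Rightarrow> 'a g2_matrix \<Rightarrow> 'a g2_matrix" where
  "sl2_mult \<alpha> p q r s A = (\<chi> w c. sl2 \<alpha> p q r s (\<lambda>x. A $ x $ c) w)"

lemma sl2_mult:
  assumes "\<alpha> \<in> range ShortP \<union> range LongN"
  shows "root_elt \<alpha> t ** sl2_mult \<alpha> p q r s A = sl2_mult \<alpha> (p + t * r) (q + t * s) r s A"
    and "root_elt (opp \<alpha>) t ** sl2_mult \<alpha> p q r s A = sl2_mult \<alpha> p q (r + t * p) (s + t * q) A"
    and "sl2_mult \<alpha> 1 0 0 1 A = A"
proof -
  have "\<forall>i w. (root_elt (ShortP i) t ** sl2_mult (ShortP i) p q r s A) $ w $ c = sl2_mult (ShortP i) (p + t * r) (q + t * s) r s A $ w $ c"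
    "\<forall>i w. (root_elt (LongN i) t ** sl2_mult (LongN i) p q r s A) $ w $ c = sl2_mult (LongN i) (p + t * r) (q + t * s) r s A $ w $ c"
    "\<forall>i w. (root_elt (ShortN i) t ** sl2_mult (ShortP i) p q r s A) $ w $ c = sl2_mult (ShortP i) p q (r + t * p) (s + t * q) A $ w $ c"
    "\<forall>i w. (root_elt (LongP i) t ** sl2_mult (LongN i) p q r s A) $ w $ c = sl2_mult (LongN i) p q (r + t * p) (s + t * q) A $ w $ c"
    "\<forall>i w. sl2_mult (ShortP i) 1 0 0 1 A $ w $ c = A $ w $ c"
    "\<forall>i w. sl2_mult (LongN i) 1 0 0 1 A $ w $ c = A $ w $ c" for c
    unfolding all_mod3 all_g2_weight root_elt_mult
    by (simp_all add: sl2_mult_def mod3_simps power2_eq_square algebra_simps)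
  then show "root_elt \<alpha> t ** sl2_mult \<alpha> p q r s A = sl2_mult \<alpha> (p + t * r) (q + t * s) r s A"
    "root_elt (opp \<alpha>) t ** sl2_mult \<alpha> p q r s A = sl2_mult \<alpha> p q (r + t * p) (s + t * q) A"
    "sl2_mult \<alpha> 1 0 0 1 A = A" using assms by (auto simp: vec_eq_iff)
qed

lemma subfieldD:
  assumes "is_subfield F"
  shows "0 \<in> F" "1 \<in> F" "x \<in> F \<Longrightarrow> - x \<in> F" "x \<in> F \<Longrightarrow> y \<in> F \<Longrightarrow> x + y \<in> F" "x \<in> F \<Longrightarrow> y \<in> F \<Longrightarrow> x - y \<in> F"
    "x \<in> F \<Longrightarrow> y \<in> F \<Longrightarrow> x * y \<in> F" "x \<in> F \<Longrightarrow> inverse x \<in> F" "x \<in> F \<Longrightarrow> y \<in> F \<Longrightarrow> x / y \<in> F" "x \<in> F \<Longrightarrow> x ^ n \<in> F"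
proof -
  note F = assms[unfolded is_subfield_def]
  show 0: "0 \<in> F" and 1: "1 \<in> F" and d: "\<And>x y. x \<in> F \<Longrightarrow> y \<in> F \<Longrightarrow> x - y \<in> F"
    and m: "\<And>x y. x \<in> F \<Longrightarrow> y \<in> F \<Longrightarrow> x * y \<in> F" and i: "\<And>x. x \<in> F \<Longrightarrow> inverse x \<in> F" using F by auto
  show n: "\<And>x. x \<in> F \<Longrightarrow> - x \<in> F" using d[OF 0] by simp
  show "x \<in> F \<Longrightarrow> y \<in> F \<Longrightarrow> x + y \<in> F" using d[of x "- y"] n by simp
  show "x \<in> F \<Longrightarrow> y \<in> F \<Longrightarrow> x / y \<in> F" using m i by (simp add: divide_inverse)
  show "x \<in> F \<Longrightarrow> x ^ n \<in> F" by (induction n) (use 1 m in auto)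
qed

text \<open>Every element of \<open>SL\<^sub>2\<close> is a product \<open>u(a) l(b) u(c) l(d)\<close>: if the lower left entry vanishes,
  multiplying by \<open>l(-1)\<close> makes it nonzero.\<close>

lemma sl2_factorization:
  fixes p q r s :: "'a::field"
  assumes F: "is_subfield F" and pqrs: "p \<in> F" "q \<in> F" "r \<in> F" "s \<in> F" "p * s - q * r = 1"
  obtains a b c d where "a \<in> F" "b \<in> F" "c \<in> F" "d \<in> F"
    "p = 1 + a * b + ((1 + a * b) * c + a) * d" "q = (1 + a * b) * c + a" "r = b + (b * c + 1) * d" "s = b * c + 1"
proof (cases "r = 0")
  case False
  let ?a = "(p - 1) / r" and ?c = "(s - 1) / r"
  have "(1 + ?a * r) * ?c + ?a = q"
  proof -
    have "1 + ?a * r = p" using False by simp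
    then have "((1 + ?a * r) * ?c + ?a) * r = p * (s - 1) + (p - 1)" using False by (simp add: field_simps)
    also have "\<dots> = q * r" using pqrs(5) by (simp add: algebra_simps)
    finally show ?thesis using False by simp
  qed
  moreover have "1 + ?a * r = p" "r * ?c + 1 = s" using False by simp_all
  ultimately show ?thesis using that[of ?a r ?c 0] subfieldD[OF F] pqrs by simp
next
  case True
  then have s: "s \<noteq> 0" and ps: "p * s = 1" using pqrs(5) by auto
  \<comment> \<open>The factors of the matrix multiplied by \<open>l(-1)\<close> from the right,
    whose rows are \<open>(p - q, q)\<close> and \<open>(- s, s)\<close>; the last factor, with
    parameter 1, undoes this multiplication.\<close>
  define a b c where "a = (p - q - 1) / (- s)" and "b = - s" and "c = (s - 1) / (- s)"
  then have m: "c * (- s) = s - 1" "a * (- s) = p - q - 1" using s by simp_all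
  then have ab: "1 + a * b = p - q" by (simp add: b_def)
  have "((1 + a * b) * c + a) * (- s) = (p - q) * (s - 1) + (p - q - 1)"
    unfolding ab by (simp only: distrib_right mult.assoc m)
  also have "\<dots> = q * (- s)" using ps by (simp add: algebra_simps)
  finally have q: "(1 + a * b) * c + a = q" using s by simp
  have sc: "b * c + 1 = s" using m(1) by (simp add: b_def mult.commute)
  show ?thesis
  proof (rule that[of a b c 1])
    show "p = 1 + a * b + ((1 + a * b) * c + a) * 1"
      by (simp only: q mult_1_right) (simp add: ab)
    show "q = (1 + a * b) * c + a" by (rule q[symmetric])
    show "r = b + (b * c + 1) * 1" unfolding sc using True by (simp add: b_def)
    show "s = b * c + 1" by (rule sc[symmetric])
  qed (use subfieldD[OF F] pqrs in \<open>auto simp: a_def b_def c_def\<close>)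
qed

section \<open>Products of root groups\<close>

definition smul :: "'a::field g2_matrix set \<Rightarrow> 'a g2_matrix set \<Rightarrow> 'a g2_matrix set" (infixr "\<odot>" 70) where
  "X \<odot> Y = {x ** y | x y. x \<in> X \<and> y \<in> Y}"

lemma smulI: "x \<in> X \<Longrightarrow> y \<in> Y \<Longrightarrow> x ** y \<in> X \<odot> Y"
  by (auto simp: smul_def)

lemma smul_assoc: "(X \<odot> Y) \<odot> Z = X \<odot> (Y \<odot> Z)"
proof (intro equalityI subsetI)
  fix m assume "m \<in> (X \<odot> Y) \<odot> Z"
  then obtain x y z where "x \<in> X" "y \<in> Y" "z \<in> Z" "m = (x ** y) ** z" by (auto simp: smul_def)
  then show "m \<in> X \<odot> (Y \<odot> Z)" by (simp add: smulI matrix_mul_assoc[symmetric])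
next
  fix m assume "m \<in> X \<odot> (Y \<odot> Z)"
  then obtain x y z where "x \<in> X" "y \<in> Y" "z \<in> Z" "m = x ** (y ** z)" by (auto simp: smul_def)
  then show "m \<in> (X \<odot> Y) \<odot> Z" by (simp add: smulI matrix_mul_assoc)
qed

lemma smul_mono: "X \<subseteq> X' \<Longrightarrow> Y \<subseteq> Y' \<Longrightarrow> X \<odot> Y \<subseteq> X' \<odot> Y'"
  by (auto simp: smul_def)

lemma smul_1 [simp]: "X \<odot> {mat 1} = X" "{mat 1} \<odot> X = X"
  by (auto simp: smul_def)

lemma word_append: "word (ws @ vs) A = word ws (word vs A)"
  by (simp add: word_def)

lemma word_mult: "word ws A ** B = word ws (A ** B)"
  by (induction ws) (auto simp: matrix_mul_assoc[symmetric])

definition inv_word :: "(g2_root \<times> 'a::field) list \<Rightarrow> (g2_root \<times> 'a) list" where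
  "inv_word ws = rev (map (\<lambda>(\<alpha>, t). (\<alpha>, - t)) ws)"

lemma root_elt_neg: "root_elt \<alpha> t ** (root_elt \<alpha> (- t) ** A) = A" "root_elt \<alpha> (- t) ** (root_elt \<alpha> t ** A) = A"
  by (simp_all add: root_elt_add_mult root_elt_0)

lemma word_inv_word: "word (inv_word ws) (word ws A) = A" "word ws (word (inv_word ws) A) = A"
proof -
  show "word (inv_word ws) (word ws A) = A" for A
    by (induction ws arbitrary: A) (auto simp: inv_word_def word_append root_elt_neg)
  show "word ws (word (inv_word ws) A) = A"
    by (induction ws arbitrary: A) (auto simp: inv_word_def word_append root_elt_neg)
qed

definition params :: "'a::field set \<Rightarrow> g2_root \<Rightarrow> 'a set" where
  "params k \<alpha> = (if \<alpha> \<in> long_roots then k else UNIV)"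

lemma params_simps [simp]:
  "params k (ShortP i) = UNIV" "params k (ShortN i) = UNIV" "params k (LongP i) = k" "params k (LongN i) = k"
  by (auto simp: params_def long_roots_def)

lemma params_opp [simp]: "params k (opp \<alpha>) = params k \<alpha>"
  by (cases \<alpha>) auto

definition valid :: "'a::field set \<Rightarrow> g2_root set \<Rightarrow> (g2_root \<times> 'a) list \<Rightarrow> bool" where
  "valid k R ws \<longleftrightarrow> (\<forall>(\<alpha>, t) \<in> set ws. \<alpha> \<in> R \<and> t \<in> params k \<alpha>)"

lemma valid_simps [simp]:
  "valid k R []" "valid k R ((\<alpha>, t) # ws) \<longleftrightarrow> \<alpha> \<in> R \<and> t \<in> params k \<alpha> \<and> valid k R ws"
  "valid k R (ws @ vs) \<longleftrightarrow> valid k R ws \<and> valid k R vs"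
  by (auto simp: valid_def)

text \<open>Words without inverses. For a subfield \<open>k\<close> the parameter sets contain
  negatives, so inverses of words are words again.\<close>

definition root_span :: "'a::field set \<Rightarrow> g2_root set \<Rightarrow> 'a g2_matrix set" where
  "root_span k R = {word ws (mat 1) | ws. valid k R ws}"

definition root_grp :: "'a::field set \<Rightarrow> g2_root \<Rightarrow> 'a g2_matrix set" where
  "root_grp k \<alpha> = root_elt \<alpha> ` params k \<alpha>"

definition prod_set :: "'a::field set \<Rightarrow> g2_root list \<Rightarrow> 'a g2_matrix set" where
  "prod_set k \<alpha>s = foldr (\<lambda>\<alpha> X. root_grp k \<alpha> \<odot> X) \<alpha>s {mat 1}"

lemma prod_set_simps [simp]: "prod_set k [] = {mat 1}" "prod_set k (\<alpha> # \<alpha>s) = root_grp k \<alpha> \<odot> prod_set k \<alpha>s"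
  by (simp_all add: prod_set_def)

lemma prod_set_append: "prod_set k (\<alpha>s @ \<beta>s) = prod_set k \<alpha>s \<odot> prod_set k \<beta>s"
  by (induction \<alpha>s) (auto simp: smul_assoc)

lemma word_in_root_span: "valid k R ws \<Longrightarrow> word ws (mat 1) \<in> root_span k R"
  by (auto simp: root_span_def)

lemma root_span_mult: "x \<in> root_span k R \<Longrightarrow> y \<in> root_span k R \<Longrightarrow> x ** y \<in> root_span k R"
proof -
  assume "x \<in> root_span k R" "y \<in> root_span k R"
  then obtain ws vs where "x = word ws (mat 1)" "valid k R ws" "y = word vs (mat 1)" "valid k R vs"
    by (auto simp: root_span_def)
  then show ?thesis using word_in_root_span[of k R "ws @ vs"] by (simp add: word_append word_mult)
qed

lemma one_in_root_span: "mat 1 \<in> root_span k R"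
  using word_in_root_span[of k R "[]"] by simp

lemma root_span_smul: "root_span k R \<odot> root_span k R = root_span k R"
proof
  show "root_span k R \<subseteq> root_span k R \<odot> root_span k R" using smulI[OF one_in_root_span] by fastforce
qed (auto simp: smul_def intro: root_span_mult)

lemma root_elt_in_root_span: "\<alpha> \<in> R \<Longrightarrow> t \<in> params k \<alpha> \<Longrightarrow> root_elt \<alpha> t \<in> root_span k R"
  using word_in_root_span[of k R "[(\<alpha>, t)]"] by simp

text \<open>A condition on roots alone which implies that the root group of \<open>\<alpha>\<close>
  normalizes \<open>root_span k R\<close>: the commutator formula applies to all pairs and does not
  lead out of \<open>R\<close>.\<close>

definition normalizes :: "'a::field set \<Rightarrow> g2_root \<Rightarrow> g2_root set \<Rightarrow> bool" where
  "normalizes k \<alpha> R \<longleftrightarrow> (\<forall>\<beta> \<in> R. \<alpha> \<noteq> \<beta> \<and> opp \<alpha> \<noteq> \<beta> \<and>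
     (\<forall>t \<in> params k \<alpha>. \<forall>u \<in> params k \<beta>. fst ` set (comm \<alpha> \<beta> t u) \<subseteq> R))"

context
  fixes k :: "'a::field set"
  assumes char3: "CHAR('a) = 3" and k: "is_subfield k" and cubes: "\<forall>x. x ^ 3 \<in> k"
begin

lemma params_subfield: "is_subfield (params k \<alpha>)"
  using k by (auto simp: params_def is_subfield_def)

text \<open>Here cubes in \<open>k\<close> are used: a long parameter of a commutator of a long and
  a short root is a product of powers of the long parameter with the cube of the short one.\<close>

lemma valid_comm:
  assumes "t \<in> params k \<alpha>" "u \<in> params k \<beta>" "fst ` set (comm \<alpha> \<beta> t u) \<subseteq> R"
  shows "valid k R (comm \<alpha> \<beta> t u)"
  using assms subfieldD[OF k] cubes by (cases \<alpha>; cases \<beta>) (auto split: if_splits)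

lemma valid_inv_word: "valid k R ws \<Longrightarrow> valid k R (inv_word ws)"
  using subfieldD(3)[OF params_subfield] by (auto simp: valid_def inv_word_def)

text \<open>The root element is moved through the word letter by letter. Each exchange leaves a
  commutator in the span of \<open>R\<close>, which is collected on the left.\<close>

lemma conj_span:
  assumes "normalizes k \<alpha> R" "t \<in> params k \<alpha>" "v \<in> root_span k R"
  shows "\<exists>v' \<in> root_span k R. root_elt \<alpha> t ** v = v' ** root_elt \<alpha> t"
proof -
  obtain ws where ws: "v = word ws (mat 1)" "valid k R ws" using assms(3) by (auto simp: root_span_def)
  have "\<exists>v' \<in> root_span k R. root_elt \<alpha> t ** word ws (mat 1) = v' ** root_elt \<alpha> t"
    using ws(2)
  proof (induction ws)
    case Nil
    show ?case using one_in_root_span by (intro bexI[of _ "mat 1"]) auto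
  next
    case (Cons a ws)
    obtain \<beta> u where a: "a = (\<beta>, u)" by fastforce
    then have \<beta>: "\<beta> \<in> R" "u \<in> params k \<beta>" "valid k R ws" using Cons.prems by auto
    then obtain v' where v': "v' \<in> root_span k R" "root_elt \<alpha> t ** word ws (mat 1) = v' ** root_elt \<alpha> t"
      using Cons.IH by blast
    have n: "\<alpha> \<noteq> \<beta>" "opp \<alpha> \<noteq> \<beta>" "fst ` set (comm \<alpha> \<beta> t u) \<subseteq> R"
      using assms(1,2) \<beta>(1,2) by (auto simp: normalizes_def)
    define c where "c = word (comm \<alpha> \<beta> t u) (mat 1)"
    have c: "c \<in> root_span k R" unfolding c_def by (intro word_in_root_span valid_comm assms(2) \<beta>(2) n(3))
    have "root_elt \<alpha> t ** word (a # ws) (mat 1) = root_elt \<alpha> t ** (root_elt \<beta> u ** word ws (mat 1))"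
      by (simp add: a)
    also have "\<dots> = word (comm \<alpha> \<beta> t u) (root_elt \<beta> u ** (root_elt \<alpha> t ** word ws (mat 1)))"
      by (rule root_elt_comm[OF char3 n(1,2)])
    also have "\<dots> = c ** (root_elt \<beta> u ** (v' ** root_elt \<alpha> t))"
      by (simp add: c_def word_mult v'(2))
    also have "\<dots> = (c ** (root_elt \<beta> u ** v')) ** root_elt \<alpha> t"
      by (simp add: matrix_mul_assoc)
    finally show ?case using c v'(1) \<beta> by (intro bexI[of _ "c ** (root_elt \<beta> u ** v')"]) (auto intro!: root_span_mult root_elt_in_root_span)
  qed
  then show ?thesis by (simp add: ws(1))
qed

lemma root_grp_span_commute:
  assumes "normalizes k \<alpha> R"
  shows "root_grp k \<alpha> \<odot> root_span k R = root_span k R \<odot> root_grp k \<alpha>"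
proof (intro equalityI subsetI)
  fix m assume "m \<in> root_grp k \<alpha> \<odot> root_span k R"
  then obtain t v where "t \<in> params k \<alpha>" "v \<in> root_span k R" "m = root_elt \<alpha> t ** v"
    by (auto simp: smul_def root_grp_def)
  then show "m \<in> root_span k R \<odot> root_grp k \<alpha>"
    using conj_span[OF assms] by (force simp: root_grp_def intro: smulI)
next
  fix m assume "m \<in> root_span k R \<odot> root_grp k \<alpha>"
  then obtain t v where t: "t \<in> params k \<alpha>" "v \<in> root_span k R" "m = v ** root_elt \<alpha> t"
    by (auto simp: smul_def root_grp_def)
  then obtain v' where v': "v' \<in> root_span k R" "root_elt \<alpha> (- t) ** v = v' ** root_elt \<alpha> (- t)"
    using conj_span[OF assms, of "- t" v] subfieldD(3)[OF params_subfield] by blast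
  \<comment> \<open>Conjugation is available in one direction only, so the inverse root element is
    inserted and moved through \<open>v\<close>.\<close>
  have "m = root_elt \<alpha> t ** (root_elt \<alpha> (- t) ** v) ** root_elt \<alpha> t"
    using t(3) by (simp add: root_elt_neg)
  also have "\<dots> = root_elt \<alpha> t ** (v' ** (root_elt \<alpha> (- t) ** (root_elt \<alpha> t ** mat 1)))"
    unfolding v'(2) matrix_mul_rid by (simp only: matrix_mul_assoc)
  also have "\<dots> = root_elt \<alpha> t ** v'" unfolding root_elt_neg by simp
  finally show "m \<in> root_grp k \<alpha> \<odot> root_span k R" using t(1) v'(1) by (auto simp: root_grp_def intro: smulI)
qed

text \<open>A semidirect product: letters from \<open>R\<close> are moved past the root group of
  \<open>\<alpha>\<close>, and letters for \<open>\<alpha>\<close> itself add up.\<close>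

lemma root_span_insert:
  assumes "normalizes k \<alpha> R"
  shows "root_span k (insert \<alpha> R) = root_grp k \<alpha> \<odot> root_span k R"
proof (intro equalityI subsetI)
  fix m assume "m \<in> root_grp k \<alpha> \<odot> root_span k R"
  then obtain t ws where "t \<in> params k \<alpha>" "valid k R ws" "m = root_elt \<alpha> t ** word ws (mat 1)"
    by (auto simp: smul_def root_grp_def root_span_def)
  moreover from this(2) have "valid k (insert \<alpha> R) ws" by (auto simp: valid_def)
  ultimately show "m \<in> root_span k (insert \<alpha> R)" using word_in_root_span[of k "insert \<alpha> R" "(\<alpha>, t) # ws"] by simp
next
  fix m assume "m \<in> root_span k (insert \<alpha> R)"
  then obtain ws where m: "m = word ws (mat 1)" "valid k (insert \<alpha> R) ws" by (auto simp: root_span_def)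
  have "word ws (mat 1) \<in> root_grp k \<alpha> \<odot> root_span k R" using m(2)
  proof (induction ws)
    case Nil
    have "root_elt \<alpha> 0 ** mat 1 \<in> root_grp k \<alpha> \<odot> root_span k R"
      by (intro smulI one_in_root_span) (auto simp: root_grp_def intro!: subfieldD(1) params_subfield)
    then show ?case by (simp add: root_elt_0)
  next
    case (Cons a ws)
    obtain \<beta> u where a: "a = (\<beta>, u)" by fastforce
    have IH: "word ws (mat 1) \<in> root_grp k \<alpha> \<odot> root_span k R" using Cons by (simp add: a)
    then obtain t v where tv: "t \<in> params k \<alpha>" "v \<in> root_span k R" "word ws (mat 1) = root_elt \<alpha> t ** v"
      by (auto simp: smul_def root_grp_def)
    show ?case
    proof (cases "\<beta> = \<alpha>")
      case True
      then have "word (a # ws) (mat 1) = root_elt \<alpha> (u + t) ** v"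
        by (simp add: a tv(3) root_elt_add_mult)
      moreover have "u + t \<in> params k \<alpha>"
        using True Cons.prems a tv(1) by (auto intro!: subfieldD(4) params_subfield)
      ultimately show ?thesis using tv(2) by (auto simp: root_grp_def intro!: smulI)
    next
      case False
      then have "root_elt \<beta> u \<in> root_span k R" using Cons.prems a by (auto intro: root_elt_in_root_span)
      then have "root_elt \<beta> u ** word ws (mat 1) \<in> root_span k R \<odot> (root_grp k \<alpha> \<odot> root_span k R)" using IH by (rule smulI)
      also have "\<dots> = root_grp k \<alpha> \<odot> root_span k R"
        by (simp add: smul_assoc[symmetric] root_grp_span_commute[OF assms, symmetric]) (simp add: smul_assoc root_span_smul)
      finally show ?thesis by (simp add: a)
    qed
  qed
  then show "m \<in> root_grp k \<alpha> \<odot> root_span k R" by (simp add: m(1))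
qed

text \<open>Four factors, as in \<open>sl2_factorization\<close>; they already exhaust the rank one
  group of \<open>\<alpha>\<close>.\<close>

definition levi :: "g2_root \<Rightarrow> 'a g2_matrix set" where
  "levi \<alpha> = root_grp k \<alpha> \<odot> root_grp k (opp \<alpha>) \<odot> root_grp k \<alpha> \<odot> root_grp k (opp \<alpha>)"

lemma levi_eq:
  assumes \<alpha>: "\<alpha> \<in> range ShortP \<union> range LongN"
  shows "levi \<alpha> = {sl2_mult \<alpha> p q r s (mat 1) | p q r s.
    p \<in> params k \<alpha> \<and> q \<in> params k \<alpha> \<and> r \<in> params k \<alpha> \<and> s \<in> params k \<alpha> \<and> p * s - q * r = 1}"
    (is "_ = ?M")
proof -
  note F = params_subfield[of \<alpha>]
  have eq: "root_elt \<alpha> a ** (root_elt (opp \<alpha>) b ** (root_elt \<alpha> c ** root_elt (opp \<alpha>) d)) =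
      sl2_mult \<alpha> (1 + a * b + ((1 + a * b) * c + a) * d) ((1 + a * b) * c + a) (b + (b * c + 1) * d) (b * c + 1) (mat 1)"
    for a b c d
  proof -
    have "root_elt \<alpha> a ** (root_elt (opp \<alpha>) b ** (root_elt \<alpha> c ** (root_elt (opp \<alpha>) d ** sl2_mult \<alpha> 1 0 0 1 (mat 1)))) =
      sl2_mult \<alpha> (1 + a * b + ((1 + a * b) * c + a) * d) ((1 + a * b) * c + a) (b + (b * c + 1) * d) (b * c + 1) (mat 1)"
      by (simp only: sl2_mult(1,2)[OF \<alpha>]) (simp add: algebra_simps)
    then show ?thesis by (simp add: sl2_mult(3)[OF \<alpha>])
  qed
  show ?thesis
  proof (intro equalityI subsetI)
    fix m assume "m \<in> levi \<alpha>"
    then obtain a b c d where abcd: "a \<in> params k \<alpha>" "b \<in> params k \<alpha>" "c \<in> params k \<alpha>" "d \<in> params k \<alpha>"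
      "m = root_elt \<alpha> a ** (root_elt (opp \<alpha>) b ** (root_elt \<alpha> c ** root_elt (opp \<alpha>) d))"
      by (auto simp: levi_def smul_def root_grp_def)
    show "m \<in> ?M" unfolding abcd(5) eq
    proof (rule CollectI, intro exI conjI, rule refl)
      show "(1 + a * b + ((1 + a * b) * c + a) * d) * (b * c + 1) - ((1 + a * b) * c + a) * (b + (b * c + 1) * d) = 1"
        by (simp add: algebra_simps)
    qed (intro subfieldD(2,4,6)[OF F] abcd)+
  next
    fix m assume "m \<in> ?M"
    then obtain p q r s where pqrs: "m = sl2_mult \<alpha> p q r s (mat 1)" "p \<in> params k \<alpha>" "q \<in> params k \<alpha>"
      "r \<in> params k \<alpha>" "s \<in> params k \<alpha>" "p * s - q * r = 1" by blast
    obtain a b c d where abcd: "a \<in> params k \<alpha>" "b \<in> params k \<alpha>" "c \<in> params k \<alpha>" "d \<in> params k \<alpha>"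
      "p = 1 + a * b + ((1 + a * b) * c + a) * d" "q = (1 + a * b) * c + a" "r = b + (b * c + 1) * d" "s = b * c + 1"
      by (rule sl2_factorization[OF F pqrs(2-6)])
    show "m \<in> levi \<alpha>" unfolding pqrs(1) abcd(5-8) eq[symmetric] levi_def
      using abcd(1-4) by (auto simp: root_grp_def intro!: smulI)
  qed
qed

lemma levi_closed:
  assumes \<alpha>: "\<alpha> \<in> range ShortP \<union> range LongN" and x: "x \<in> root_grp k \<alpha> \<union> root_grp k (opp \<alpha>)" and y: "y \<in> levi \<alpha>"
  shows "x ** y \<in> levi \<alpha>"
proof -
  note F = params_subfield[of \<alpha>]
  obtain p q r s where pqrs: "y = sl2_mult \<alpha> p q r s (mat 1)" "p \<in> params k \<alpha>" "q \<in> params k \<alpha>"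
      "r \<in> params k \<alpha>" "s \<in> params k \<alpha>" "p * s - q * r = 1" using y levi_eq[OF \<alpha>] by auto
  obtain t where t: "t \<in> params k \<alpha>" "x = root_elt \<alpha> t \<or> x = root_elt (opp \<alpha>) t"
    using x by (auto simp: root_grp_def)
  have 1: "(p + t * r) * s - (q + t * s) * r = 1" "p * (s + t * q) - q * (r + t * p) = 1"
    using pqrs(6) by (simp_all add: algebra_simps)
  from t(2) show ?thesis
  proof
    assume "x = root_elt \<alpha> t"
    then have "x ** y = sl2_mult \<alpha> (p + t * r) (q + t * s) r s (mat 1)" by (simp add: pqrs(1) sl2_mult[OF \<alpha>])
    then show ?thesis unfolding levi_eq[OF \<alpha>]
      by (intro CollectI exI conjI) (assumption, (intro subfieldD(4,6)[OF F] pqrs t 1)+)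
  next
    assume "x = root_elt (opp \<alpha>) t"
    then have "x ** y = sl2_mult \<alpha> p q (r + t * p) (s + t * q) (mat 1)" by (simp add: pqrs(1) sl2_mult[OF \<alpha>])
    then show ?thesis unfolding levi_eq[OF \<alpha>]
      by (intro CollectI exI conjI) (assumption, (intro subfieldD(4,6)[OF F] pqrs t 1)+)
  qed
qed

text \<open>Tavgen's argument: the rank one factors normalize both unipotent radicals, so they can all be
  moved to the left, where they form the rank one group.\<close>

lemma big_product_closed:
  assumes \<alpha>: "\<alpha> \<in> range ShortP \<union> range LongN" and x: "x \<in> root_grp k \<alpha> \<union> root_grp k (opp \<alpha>)"
    and n: "normalizes k \<alpha> R" "normalizes k (opp \<alpha>) R" "normalizes k \<alpha> R'" "normalizes k (opp \<alpha>) R'"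
    and Y: "Y = root_span k (insert \<alpha> R) \<odot> root_span k (insert (opp \<alpha>) R') \<odot> root_span k (insert \<alpha> R) \<odot> root_span k (insert (opp \<alpha>) R')"
    and y: "y \<in> Y"
  shows "x ** y \<in> Y"
proof -
  let ?U = "root_grp k \<alpha>" and ?U' = "root_grp k (opp \<alpha>)" and ?V = "root_span k R" and ?V' = "root_span k R'"
  have c: "?V \<odot> ?U = ?U \<odot> ?V" "?V \<odot> ?U' = ?U' \<odot> ?V" "?V' \<odot> ?U = ?U \<odot> ?V'" "?V' \<odot> ?U' = ?U' \<odot> ?V'"
    using root_grp_span_commute n by auto
  have c': "?V \<odot> (?U \<odot> X) = ?U \<odot> (?V \<odot> X)" "?V \<odot> (?U' \<odot> X) = ?U' \<odot> (?V \<odot> X)"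
    "?V' \<odot> (?U \<odot> X) = ?U \<odot> (?V' \<odot> X)" "?V' \<odot> (?U' \<odot> X) = ?U' \<odot> (?V' \<odot> X)" for X
    by (simp_all add: smul_assoc[symmetric] c)
  have "Y = levi \<alpha> \<odot> (?V \<odot> ?V' \<odot> ?V \<odot> ?V')"
    unfolding Y root_span_insert[OF n(1)] root_span_insert[OF n(4)] levi_def by (simp add: smul_assoc c')
  moreover obtain l v where "y = l ** v" "l \<in> levi \<alpha>" "v \<in> ?V \<odot> ?V' \<odot> ?V \<odot> ?V'"
    using y calculation unfolding smul_def[of "levi \<alpha>"] by blast
  moreover from this have "(x ** l) ** v \<in> levi \<alpha> \<odot> (?V \<odot> ?V' \<odot> ?V \<odot> ?V')"
    using levi_closed[OF \<alpha> x] by (intro smulI)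
  ultimately show ?thesis by (simp add: matrix_mul_assoc)
qed

end

text \<open>Together with the simple roots \<open>LongN 0\<close> and \<open>ShortP 1\<close>, respectively, these are the positive roots:
  they span the unipotent radicals of the two standard parabolic subgroups.\<close>

definition long_radical :: "g2_root list" where
  "long_radical = [ShortP 1, ShortP 2, LongN 2, LongP 1, ShortN 0]"

definition short_radical :: "g2_root list" where
  "short_radical = [LongN 0, ShortP 2, LongN 2, LongP 1, ShortN 0]"

text \<open>Each root normalizes the span of those after it, so the span of the whole list is the
  product of its root groups in this order.\<close>

primrec normal_list :: "'a::field set \<Rightarrow> g2_root list \<Rightarrow> bool" where
  "normal_list k [] \<longleftrightarrow> True"
| "normal_list k (\<alpha> # \<alpha>s) \<longleftrightarrow> normalizes k \<alpha> (set \<alpha>s) \<and> normal_list k \<alpha>s"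

text \<open>A simple root and its opposite form the rank one factor of a parabolic subgroup, and
  they permute the roots of both opposite radicals among themselves.\<close>

lemma normalizes_radicals:
  "normalizes k (LongN 0) (set long_radical)" "normalizes k (LongP 0) (set long_radical)"
  "normalizes k (LongN 0) (set (map opp long_radical))" "normalizes k (LongP 0) (set (map opp long_radical))"
  "normalizes k (ShortP 1) (set short_radical)" "normalizes k (ShortN 1) (set short_radical)"
  "normalizes k (ShortP 1) (set (map opp short_radical))" "normalizes k (ShortN 1) (set (map opp short_radical))"
  unfolding normalizes_def long_radical_def short_radical_def by (simp_all add: mod3_simps)

lemma normal_list_roots: "normal_list k (LongN 0 # long_radical)" "normal_list k (map opp (LongN 0 # long_radical))"
  unfolding long_radical_def normal_list.simps normalizes_def by (simp_all add: mod3_simps normalizes_def)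

text \<open>The two radicals arise by removing one or the other simple root from the same positive
  roots, so a single product can be decomposed along either parabolic.\<close>

lemma insert_roots:
  "insert (ShortP 1) (set short_radical) = insert (LongN 0) (set long_radical)"
  "insert (ShortN 1) (set (map opp short_radical)) = insert (LongP 0) (set (map opp long_radical))"
  by (auto simp: long_radical_def short_radical_def)

context
  fixes k :: "'a::field set"
  assumes char3: "CHAR('a) = 3" and k: "is_subfield k" and cubes: "\<forall>x. x ^ 3 \<in> k"
begin

text \<open>The reflections in the two simple roots lead from the negative simple roots to the
  remaining negative ones: \<open>ShortN 1\<close> to \<open>ShortN 2\<close> to
  \<open>ShortP 0\<close>, and \<open>LongP 0\<close> to \<open>LongP 2\<close> to
  \<open>LongN 1\<close>.\<close>

lemma weyl_root_elt:
  fixes A :: "'a g2_matrix"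
  shows "weyl (LongN 0) (root_elt (ShortN 1) t ** A) = root_elt (ShortN 2) t ** weyl (LongN 0) A"
    and "weyl (ShortP 1) (root_elt (LongP 0) t ** A) = root_elt (LongP 2) (- t) ** weyl (ShortP 1) A"
    and "weyl (ShortP 1) (root_elt (ShortN 2) t ** A) = root_elt (ShortP 0) (- t) ** weyl (ShortP 1) A"
    and "weyl (LongN 0) (root_elt (LongP 2) t ** A) = root_elt (LongN 1) t ** weyl (LongN 0) A"
proof -
  have "\<forall>r. weyl (LongN 0) (root_elt (ShortN 1) t ** A) $ r $ s = (root_elt (ShortN 2) t ** weyl (LongN 0) A) $ r $ s"
    "\<forall>r. weyl (ShortP 1) (root_elt (LongP 0) t ** A) $ r $ s = (root_elt (LongP 2) (- t) ** weyl (ShortP 1) A) $ r $ s"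
    "\<forall>r. weyl (ShortP 1) (root_elt (ShortN 2) t ** A) $ r $ s = (root_elt (ShortP 0) (- t) ** weyl (ShortP 1) A) $ r $ s"
    "\<forall>r. weyl (LongN 0) (root_elt (LongP 2) t ** A) $ r $ s = (root_elt (LongN 1) t ** weyl (LongN 0) A) $ r $ s" for s
    unfolding all_g2_weight weyl_def
    by (simp_all add: root_elt_mult mod3_simps two_eq[OF char3] algebra_simps power2_eq_square add_self[OF char3])
  then show "weyl (LongN 0) (root_elt (ShortN 1) t ** A) = root_elt (ShortN 2) t ** weyl (LongN 0) A"
    "weyl (ShortP 1) (root_elt (LongP 0) t ** A) = root_elt (LongP 2) (- t) ** weyl (ShortP 1) A"
    "weyl (ShortP 1) (root_elt (ShortN 2) t ** A) = root_elt (ShortP 0) (- t) ** weyl (ShortP 1) A"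
    "weyl (LongN 0) (root_elt (LongP 2) t ** A) = root_elt (LongN 1) t ** weyl (LongN 0) A"
    by (simp_all add: vec_eq_iff)
qed

lemma root_span_normal_list: "normal_list k \<alpha>s \<Longrightarrow> root_span k (set \<alpha>s) = prod_set k \<alpha>s"
proof (induction \<alpha>s)
  case Nil
  have "word ws (mat 1) = mat 1" if "valid k {} ws" for ws :: "(g2_root \<times> 'a) list" using that by (cases ws) auto
  then have "root_span k {} \<subseteq> {mat 1}" unfolding root_span_def by blast
  then show ?case using one_in_root_span[of k "{}"] by auto
next
  case (Cons \<alpha> \<alpha>s)
  then show ?case using root_span_insert[OF char3 k cubes] by simp
qed

definition tavgen_list :: "g2_root list" where
  "tavgen_list = (let p = LongN 0 # long_radical; n = map opp p in p @ n @ p @ n)"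

text \<open>The product \<open>Y\<close> of four alternating unipotent groups is stable under left
  multiplication by every root group: positive ones are absorbed by its first factor, negative
  simple ones by Tavgen's argument, and all others are conjugate to these by Weyl elements.\<close>

theorem root_span_UNIV: "root_span k UNIV = prod_set k tavgen_list"
proof -
  define P where "P = root_span k (insert (LongN 0) (set long_radical))"
  define N where "N = root_span k (insert (LongP 0) (set (map opp long_radical)))"
  define Y where "Y = P \<odot> N \<odot> P \<odot> N"
  have "P = prod_set k (LongN 0 # long_radical)"
    using root_span_normal_list[OF normal_list_roots(1)] by (simp add: P_def)
  moreover have "N = prod_set k (map opp (LongN 0 # long_radical))"
    using root_span_normal_list[OF normal_list_roots(2)] by (simp add: N_def)
  ultimately have Y_prod: "Y = prod_set k tavgen_list"
    by (simp add: Y_def tavgen_list_def Let_def prod_set_append smul_assoc)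
  \<comment> \<open>The left multipliers of \<open>Y\<close>. Since \<open>mat 1\<close> lies in
    \<open>Y\<close>, it is enough to find all root groups in \<open>T\<close>.\<close>
  define T where "T = {x. \<forall>y \<in> Y. x ** y \<in> Y}"
  have T_pos: "root_grp k \<alpha> \<subseteq> T" if "\<alpha> \<in> insert (LongN 0) (set long_radical)" for \<alpha>
  proof
    fix x assume "x \<in> root_grp k \<alpha>"
    then have "x \<in> P" using that by (auto simp: P_def root_grp_def intro: root_elt_in_root_span)
    then have "x ** y \<in> P \<odot> Y" if "y \<in> Y" for y using that by (rule smulI)
    moreover have "P \<odot> Y = Y" by (simp add: Y_def P_def smul_assoc[symmetric] root_span_smul)
    ultimately show "x \<in> T" by (simp add: T_def)
  qed
  have T_simple: "root_grp k (LongN 0) \<subseteq> T" "root_grp k (LongP 0) \<subseteq> T"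
    "root_grp k (ShortP 1) \<subseteq> T" "root_grp k (ShortN 1) \<subseteq> T"
  proof -
    have "x ** y \<in> Y" if "x \<in> root_grp k (LongN 0) \<union> root_grp k (opp (LongN 0))" "y \<in> Y" for x y
      by (rule big_product_closed[OF char3 k cubes _ that(1) _ _ _ _ _ that(2), of "set long_radical" "set (map opp long_radical)"])
        (simp_all add: normalizes_radicals[simplified] Y_def P_def N_def)
    then show "root_grp k (LongN 0) \<subseteq> T" "root_grp k (LongP 0) \<subseteq> T" by (auto simp: T_def)
    have "x ** y \<in> Y" if "x \<in> root_grp k (ShortP 1) \<union> root_grp k (opp (ShortP 1))" "y \<in> Y" for x y
      by (rule big_product_closed[OF char3 k cubes _ that(1) _ _ _ _ _ that(2), of "set short_radical" "set (map opp short_radical)"])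
        (simp_all add: normalizes_radicals[simplified] Y_def P_def N_def insert_roots[simplified])
    then show "root_grp k (ShortP 1) \<subseteq> T" "root_grp k (ShortN 1) \<subseteq> T" by (auto simp: T_def)
  qed
  have T_mult: "word ws y \<in> Y" if "\<And>\<alpha> t. (\<alpha>, t) \<in> set ws \<Longrightarrow> root_elt \<alpha> t \<in> T" "y \<in> Y" for ws y
    using that by (induction ws) (auto simp: T_def)
  \<comment> \<open>An element of the new root group is a conjugate under \<open>weyl\<close>. The
    letters of the Weyl word and of its inverse lie in \<open>T\<close>, so the factors of the
    conjugate preserve \<open>Y\<close> one after the other.\<close>
  have weyl_T: "root_grp k \<beta>' \<subseteq> T"
    if \<alpha>: "root_grp k \<alpha> \<subseteq> T" "root_grp k (opp \<alpha>) \<subseteq> T" and \<beta>: "root_grp k \<beta> \<subseteq> T"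
      and w: "\<And>t A. weyl \<alpha> (root_elt \<beta> (f t) ** A) = root_elt \<beta>' t ** weyl \<alpha> A"
      and p: "\<And>t. t \<in> params k \<beta>' \<Longrightarrow> f t \<in> params k \<beta>" for \<alpha> \<beta> \<beta>' f
  proof
    fix x assume "x \<in> root_grp k \<beta>'"
    then obtain t where t: "x = root_elt \<beta>' t" "t \<in> params k \<beta>'" by (auto simp: root_grp_def)
    have 1: "1 \<in> params k \<alpha>" "- 1 \<in> params k \<alpha>"
      using subfieldD[OF params_subfield[OF char3 k cubes]] by auto
    have wT: "root_elt \<gamma> c \<in> T" if "(\<gamma>, c) \<in> set [(\<alpha>, 1), (opp \<alpha>, - 1), (\<alpha>, 1)]
        \<union> set (inv_word [(\<alpha>, 1), (opp \<alpha>, - 1), (\<alpha>, 1)])" for \<gamma> c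
      using that \<alpha> 1 params_opp[of k \<alpha>] by (auto simp: root_grp_def inv_word_def image_subset_iff)
    have "x ** y \<in> Y" if y: "y \<in> Y" for y
    proof -
      define A where "A = word (inv_word [(\<alpha>, 1), (opp \<alpha>, - 1), (\<alpha>, 1)]) y"
      have wA: "weyl \<alpha> A = y" by (simp only: weyl_def A_def word_inv_word)
      have A: "A \<in> Y" unfolding A_def by (rule T_mult[OF wT y]) (erule UnI2)
      have bA: "root_elt \<beta> (f t) ** A \<in> Y" using \<beta> p[OF t(2)] A by (auto simp: T_def root_grp_def)
      have "weyl \<alpha> (root_elt \<beta> (f t) ** A) \<in> Y" unfolding weyl_def by (rule T_mult[OF wT bA]) (erule UnI1)
      then show ?thesis by (simp only: w t(1) wA)
    qed
    then show "x \<in> T" by (simp add: T_def)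
  qed
  note neg = subfieldD(3)[OF k]
  have T_SN2: "root_grp k (ShortN 2) \<subseteq> T"
    by (rule weyl_T[where \<alpha> = "LongN 0" and \<beta> = "ShortN 1" and f = "\<lambda>t. t"]) (simp_all add: T_simple weyl_root_elt)
  have T_LP2: "root_grp k (LongP 2) \<subseteq> T"
    by (rule weyl_T[where \<alpha> = "ShortP 1" and \<beta> = "LongP 0" and f = uminus]) (simp_all add: T_simple weyl_root_elt neg)
  have T_SP0: "root_grp k (ShortP 0) \<subseteq> T"
    by (rule weyl_T[where \<alpha> = "ShortP 1" and \<beta> = "ShortN 2" and f = uminus]) (simp_all add: T_simple T_SN2 weyl_root_elt)
  have T_LN1: "root_grp k (LongN 1) \<subseteq> T"
    by (rule weyl_T[where \<alpha> = "LongN 0" and \<beta> = "LongP 2" and f = "\<lambda>t. t"]) (simp_all add: T_simple T_LP2 weyl_root_elt)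
  have "\<forall>\<alpha>. root_grp k \<alpha> \<subseteq> T"
    unfolding all_g2_root all_mod3
    by (intro conjI T_simple T_SN2 T_LP2 T_SP0 T_LN1 T_pos) (simp_all add: long_radical_def)
  then have T: "root_elt \<alpha> t \<in> T" if "t \<in> params k \<alpha>" for \<alpha> t using that by (auto simp: root_grp_def)
  have one: "mat 1 \<in> Y"
  proof -
    have "mat 1 ** (mat 1 ** (mat 1 ** mat 1)) \<in> Y"
      unfolding Y_def P_def N_def by (intro smulI one_in_root_span)
    then show ?thesis by simp
  qed
  have "root_span k UNIV \<subseteq> Y"
  proof
    fix x assume "x \<in> root_span k UNIV"
    then obtain ws where "x = word ws (mat 1)" "valid k UNIV ws" by (auto simp: root_span_def)
    then show "x \<in> Y" using T_mult[OF T one, of ws] by (auto simp: valid_def)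
  qed
  moreover have "Y \<subseteq> root_span k UNIV \<odot> root_span k UNIV \<odot> root_span k UNIV \<odot> root_span k UNIV"
  proof -
    have "root_span k R \<subseteq> root_span k UNIV" for R by (force simp: root_span_def valid_def)
    then show ?thesis unfolding Y_def P_def N_def by (intro smul_mono)
  qed
  ultimately show ?thesis by (simp add: Y_prod root_span_smul)
qed

section \<open>The mixed group as the set of words in root elements\<close>

lemma invertible_root_elt: "invertible (root_elt \<alpha> t :: 'a g2_matrix)"
  unfolding invertible_def
  using root_elt_neg[of \<alpha> t "mat 1"] by (intro exI[of _ "root_elt \<alpha> (- t)"]) simp

lemma group_GL_g2: "group (GL_g2 :: 'a g2_matrix monoid)"
proof (rule groupI)
  fix x y z :: "'a g2_matrix" assume "x \<in> carrier GL_g2" "y \<in> carrier GL_g2"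
  then show "x \<otimes>\<^bsub>GL_g2\<^esub> y \<in> carrier GL_g2" by (simp add: GL_g2_def invertible_mult)
next
  fix x :: "'a g2_matrix" assume "x \<in> carrier GL_g2"
  then show "\<exists>y \<in> carrier GL_g2. y \<otimes>\<^bsub>GL_g2\<^esub> x = \<one>\<^bsub>GL_g2\<^esub>" by (auto simp: GL_g2_def invertible_def)
qed (auto simp: GL_g2_def matrix_mul_assoc invertible_def intro: exI[of _ "mat 1"])

lemma mult_one_mixed_G2 [simp]:
  "x \<otimes>\<^bsub>mixed_G2 k\<^esub> y = x ** y" "\<one>\<^bsub>mixed_G2 k\<^esub> = mat 1"
  by (simp_all add: mixed_G2_def G2_def subgroup_generated_def GL_g2_def)

lemma group_G2: "group (G2 :: 'a g2_matrix monoid)"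
  unfolding G2_def by (rule group.group_subgroup_generated[OF group_GL_g2])

lemma group_mixed_G2: "group (mixed_G2 k)"
  unfolding mixed_G2_def by (rule group.group_subgroup_generated[OF group_G2])

lemma root_elt_in_G2: "root_elt \<alpha> (t :: 'a) \<in> carrier G2"
  unfolding G2_def carrier_subgroup_generated
  by (rule generate.incl) (auto simp: GL_g2_def root_subgroup_def invertible_root_elt)

theorem carrier_mixed_G2: "carrier (mixed_G2 k) = root_span k UNIV"
proof -
  define S where "S = carrier G2 \<inter> ((\<Union>\<alpha> \<in> short_roots. root_subgroup \<alpha> UNIV) \<union> (\<Union>\<alpha> \<in> long_roots. root_subgroup \<alpha> k))"
  have S: "S = {root_elt \<alpha> t | \<alpha> t. t \<in> params k \<alpha>}"
  proof -
    have 1: "\<alpha> \<in> short_roots \<or> \<alpha> \<in> long_roots" for \<alpha> by (cases \<alpha>) (auto simp: short_roots_def long_roots_def)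
    have 2: "params k \<alpha> = UNIV" if "\<alpha> \<in> short_roots" for \<alpha> using that by (auto simp: short_roots_def)
    have 3: "params k \<alpha> = k" if "\<alpha> \<in> long_roots" for \<alpha> using that by (auto simp: long_roots_def)
    show ?thesis
    proof (intro equalityI subsetI)
      fix x assume "x \<in> S"
      then consider \<alpha> t where "\<alpha> \<in> short_roots" "x = root_elt \<alpha> t"
        | \<alpha> t where "\<alpha> \<in> long_roots" "t \<in> k" "x = root_elt \<alpha> t"
        by (auto simp: S_def root_subgroup_def)
      then show "x \<in> {root_elt \<alpha> t | \<alpha> t. t \<in> params k \<alpha>}" by cases (use 2 3 in blast)+
    next
      fix x assume "x \<in> {root_elt \<alpha> t | \<alpha> t. t \<in> params k \<alpha>}"
      then obtain \<alpha> t where x: "x = root_elt \<alpha> t" "t \<in> params k \<alpha>" by blast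
      have "x \<in> (\<Union>\<alpha> \<in> short_roots. root_subgroup \<alpha> UNIV) \<union> (\<Union>\<alpha> \<in> long_roots. root_subgroup \<alpha> k)"
        using 1[of \<alpha>] 3[of \<alpha>] x by (auto simp: root_subgroup_def)
      then show "x \<in> S" using root_elt_in_G2 x(1) by (simp add: S_def)
    qed
  qed
  have c: "carrier (mixed_G2 k) = generate G2 S" by (simp add: mixed_G2_def carrier_subgroup_generated S_def)
  have m: "x \<otimes>\<^bsub>G2\<^esub> y = x ** y" "\<one>\<^bsub>G2\<^esub> = mat 1" for x y :: "'a g2_matrix"
    by (simp_all add: G2_def subgroup_generated_def GL_g2_def)
  have "x \<in> root_span k UNIV" if "x \<in> generate G2 S" for x
    using that
  proof induction
    case one
    then show ?case by (simp add: m one_in_root_span)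
  next
    case (incl h)
    then show ?case using root_elt_in_root_span[of _ UNIV] by (auto simp: S)
  next
    case (inv h)
    then obtain \<alpha> t where h: "h = root_elt \<alpha> t" "t \<in> params k \<alpha>" by (auto simp: S)
    have "inv\<^bsub>G2\<^esub> h = root_elt \<alpha> (- t)"
      unfolding h(1) using root_elt_neg[of \<alpha> t "mat 1"]
      by (intro group.inv_equality[OF group_G2]) (auto simp: m root_elt_in_G2)
    then show ?case using h(2) subfieldD(3)[OF params_subfield[OF char3 k cubes]] by (auto intro!: root_elt_in_root_span)
  next
    case (eng h1 h2)
    then show ?case by (simp add: m root_span_mult)
  qed
  moreover have "word ws (mat 1) \<in> generate G2 S" if "valid k UNIV ws" for ws
    using that
  proof (induction ws)
    case Nil
    show ?case using generate.one[of G2 S] by (simp add: m)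
  next
    case (Cons a ws)
    obtain \<alpha> t where a: "a = (\<alpha>, t)" by fastforce
    then have "root_elt \<alpha> t \<in> generate G2 S" using Cons.prems by (intro generate.incl) (auto simp: S)
    then show ?case using generate.eng[of "root_elt \<alpha> t" G2 S "word ws (mat 1)"] Cons by (simp add: a m)
  qed
  ultimately show ?thesis unfolding c by (auto simp: root_span_def)
qed

end

subsection \<open>An invariant Lie ring\<close>

text \<open>\<open>a\<close>, \<open>b\<close>, \<open>c\<close>, \<open>d\<close> are the coordinates at the roots \<open>ShortP\<close>, \<open>ShortN\<close>, \<open>LongP\<close>, \<open>LongN\<close>, and \<open>h\<close> is the
  toral part.\<close>

fun lie_entry :: "(3 \<Rightarrow> 'a::field) \<Rightarrow> (3 \<Rightarrow> 'a) \<Rightarrow> (3 \<Rightarrow> 'a) \<Rightarrow> (3 \<Rightarrow> 'a) \<Rightarrow> (3 \<Rightarrow> 'a) \<Rightarrow>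
    g2_weight \<Rightarrow> g2_weight \<Rightarrow> 'a" where
  "lie_entry a b c d h Wt0 Wt0 = 0"
| "lie_entry a b c d h Wt0 (WtP i) = b i"
| "lie_entry a b c d h Wt0 (WtN i) = a i"
| "lie_entry a b c d h (WtP i) Wt0 = 2 * a i"
| "lie_entry a b c d h (WtN i) Wt0 = 2 * b i"
| "lie_entry a b c d h (WtP i) (WtP j) = (if i = j then h i else if i = j + 2 then c (j + 1) else d (j + 2))"
| "lie_entry a b c d h (WtN i) (WtN j) = (if i = j then - h i else if i = j + 1 then - c (j + 2) else - d (j + 1))"
| "lie_entry a b c d h (WtN i) (WtP j) = (if i = j then 0 else if i = j + 1 then a (j + 2) else - a (j + 1))"
| "lie_entry a b c d h (WtP i) (WtN j) = (if i = j then 0 else if i = j + 1 then - b (j + 2) else b (j + 1))"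

definition lie :: "(3 \<Rightarrow> 'a::field) \<Rightarrow> (3 \<Rightarrow> 'a) \<Rightarrow> (3 \<Rightarrow> 'a) \<Rightarrow> (3 \<Rightarrow> 'a) \<Rightarrow> (3 \<Rightarrow> 'a) \<Rightarrow> 'a g2_matrix" where
  "lie a b c d h = (\<chi> r s. lie_entry a b c d h r s)"

text \<open>Normalized by the mixed group because in characteristic 3 a short root element with parameter \<open>t\<close> changes
  the long root coordinates only by multiples of \<open>t ^ 3\<close> with other long root coordinates.\<close>

definition lie_ring :: "'a::field set \<Rightarrow> 'a g2_matrix set" where
  "lie_ring k = {lie a b c d h | a b c d h.
     (\<forall>i. c i \<in> k) \<and> (\<forall>i. d i \<in> k) \<and> h 2 = - h 0 - h 1 \<and> (\<forall>i j. h i - h j \<in> k)}"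

context
  fixes k :: "'a::field set"
  assumes char3: "CHAR('a) = 3" and k: "is_subfield k" and cubes: "\<forall>x. x ^ 3 \<in> k"
begin

text \<open>The adjoint action, with the group element kept on the right instead of inverting it. In
  characteristic 3 the long coordinates change only by multiples of \<open>t ^ 3\<close>, and all
  toral entries are shifted by the same amount.\<close>

lemma lie_ShortP:
  assumes "h 2 = - h 0 - h (1 :: 3)"
  shows "root_elt (ShortP i) t ** lie a b c d h = lie
    (a(i := a i - b i * t\<^sup>2 - h i * t, i + 1 := a (i + 1) - d (i + 2) * t, i + 2 := a (i + 2) - c (i + 1) * t))
    (b(i + 1 := b (i + 1) + a (i + 2) * t + c (i + 1) * t\<^sup>2, i + 2 := b (i + 2) - a (i + 1) * t - d (i + 2) * t\<^sup>2))
    (c(i + 2 := c (i + 2) + c (i + 1) * t ^ 3)) (d(i + 1 := d (i + 1) - d (i + 2) * t ^ 3))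
    (\<lambda>j. h j - b i * t) ** root_elt (ShortP i) (t :: 'a)"
proof -
  have "\<forall>i r s. (root_elt (ShortP i) t ** lie a b c d h) $ r $ s = (lie
    (a(i := a i - b i * t\<^sup>2 - h i * t, i + 1 := a (i + 1) - d (i + 2) * t, i + 2 := a (i + 2) - c (i + 1) * t))
    (b(i + 1 := b (i + 1) + a (i + 2) * t + c (i + 1) * t\<^sup>2, i + 2 := b (i + 2) - a (i + 1) * t - d (i + 2) * t\<^sup>2))
    (c(i + 2 := c (i + 2) + c (i + 1) * t ^ 3)) (d(i + 1 := d (i + 1) - d (i + 2) * t ^ 3))
    (\<lambda>j. h j - b i * t) ** root_elt (ShortP i) t) $ r $ s"
    unfolding all_mod3 all_g2_weight root_elt_mult mult_root_elt
    by (simp add: lie_def mod3_simps two_eq[OF char3] algebra_simps power2_eq_square power3_eq_cube add_self[OF char3] assms)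
  then show ?thesis by (simp add: vec_eq_iff)
qed

text \<open>The coordinate at the root itself picks up a difference of toral entries. This is why
  \<open>lie_ring\<close> puts those differences into \<open>k\<close>.\<close>

lemma lie_LongP:
  assumes "h 2 = - h 0 - h (1 :: 3)"
  shows "root_elt (LongP i) t ** lie a b c d h = lie
    (a(i + 1 := a (i + 1) + a (i + 2) * t)) (b(i + 2 := b (i + 2) - b (i + 1) * t))
    (c(i := c i - d i * t\<^sup>2 + (h (i + 1) - h i) * t)) (d(i + 1 := d (i + 1) - c (i + 2) * t, i + 2 := d (i + 2) + c (i + 1) * t))
    (h(i + 1 := h (i + 1) + d i * t, i + 2 := h (i + 2) - d i * t)) ** root_elt (LongP i) (t :: 'a)"
proof -
  have "\<forall>i r s. (root_elt (LongP i) t ** lie a b c d h) $ r $ s = (lie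
    (a(i + 1 := a (i + 1) + a (i + 2) * t)) (b(i + 2 := b (i + 2) - b (i + 1) * t))
    (c(i := c i - d i * t\<^sup>2 + (h (i + 1) - h i) * t)) (d(i + 1 := d (i + 1) - c (i + 2) * t, i + 2 := d (i + 2) + c (i + 1) * t))
    (h(i + 1 := h (i + 1) + d i * t, i + 2 := h (i + 2) - d i * t)) ** root_elt (LongP i) t) $ r $ s"
    unfolding all_mod3 all_g2_weight root_elt_mult mult_root_elt
    by (simp add: lie_def mod3_simps two_eq[OF char3] algebra_simps power2_eq_square power3_eq_cube add_self[OF char3] assms)
  then show ?thesis by (simp add: vec_eq_iff)
qed

lemma lie_ShortN:
  assumes "h 2 = - h 0 - h (1 :: 3)"
  shows "root_elt (ShortN i) t ** lie a b c d h = lie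
    (a(i + 1 := a (i + 1) - b (i + 2) * t + d (i + 1) * t\<^sup>2, i + 2 := a (i + 2) + b (i + 1) * t - c (i + 2) * t\<^sup>2))
    (b(i := b i - a i * t\<^sup>2 + h i * t, i + 1 := b (i + 1) + c (i + 2) * t, i + 2 := b (i + 2) + d (i + 1) * t))
    (c(i + 1 := c (i + 1) + c (i + 2) * t ^ 3)) (d(i + 2 := d (i + 2) - d (i + 1) * t ^ 3))
    (\<lambda>j. h j + a i * t) ** root_elt (ShortN i) (t :: 'a)"
proof -
  have "\<forall>i r s. (root_elt (ShortN i) t ** lie a b c d h) $ r $ s = (lie
    (a(i + 1 := a (i + 1) - b (i + 2) * t + d (i + 1) * t\<^sup>2, i + 2 := a (i + 2) + b (i + 1) * t - c (i + 2) * t\<^sup>2))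
    (b(i := b i - a i * t\<^sup>2 + h i * t, i + 1 := b (i + 1) + c (i + 2) * t, i + 2 := b (i + 2) + d (i + 1) * t))
    (c(i + 1 := c (i + 1) + c (i + 2) * t ^ 3)) (d(i + 2 := d (i + 2) - d (i + 1) * t ^ 3))
    (\<lambda>j. h j + a i * t) ** root_elt (ShortN i) t) $ r $ s"
    unfolding all_mod3 all_g2_weight root_elt_mult mult_root_elt
    by (simp add: lie_def mod3_simps two_eq[OF char3] algebra_simps power2_eq_square power3_eq_cube add_self[OF char3] assms)
  then show ?thesis by (simp add: vec_eq_iff)
qed

lemma lie_LongN:
  assumes "h 2 = - h 0 - h (1 :: 3)"
  shows "root_elt (LongN i) t ** lie a b c d h = lie
    (a(i + 2 := a (i + 2) + a (i + 1) * t)) (b(i + 1 := b (i + 1) - b (i + 2) * t))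
    (c(i + 1 := c (i + 1) + d (i + 2) * t, i + 2 := c (i + 2) - d (i + 1) * t)) (d(i := d i - c i * t\<^sup>2 - (h (i + 1) - h i) * t))
    (h(i + 1 := h (i + 1) - c i * t, i + 2 := h (i + 2) + c i * t)) ** root_elt (LongN i) (t :: 'a)"
proof -
  have "\<forall>i r s. (root_elt (LongN i) t ** lie a b c d h) $ r $ s = (lie
    (a(i + 2 := a (i + 2) + a (i + 1) * t)) (b(i + 1 := b (i + 1) - b (i + 2) * t))
    (c(i + 1 := c (i + 1) + d (i + 2) * t, i + 2 := c (i + 2) - d (i + 1) * t)) (d(i := d i - c i * t\<^sup>2 - (h (i + 1) - h i) * t))
    (h(i + 1 := h (i + 1) - c i * t, i + 2 := h (i + 2) + c i * t)) ** root_elt (LongN i) t) $ r $ s"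
    unfolding all_mod3 all_g2_weight root_elt_mult mult_root_elt
    by (simp add: lie_def mod3_simps two_eq[OF char3] algebra_simps power2_eq_square power3_eq_cube add_self[OF char3] assms)
  then show ?thesis by (simp add: vec_eq_iff)
qed

lemma lie_ringI:
  assumes "\<And>i. c i \<in> k" "\<And>i. d i \<in> k" "h 2 = - h 0 - h 1" "\<And>i j. h i - h j \<in> k"
  shows "lie a b c d h \<in> lie_ring k"
  using assms unfolding lie_ring_def by blast

lemma root_elt_lie_ring:
  assumes t: "t \<in> params k \<alpha>" and X: "X \<in> lie_ring k"
  shows "\<exists>X' \<in> lie_ring k. root_elt \<alpha> t ** X = X' ** root_elt \<alpha> t"
proof -
  obtain a b c d h where X_eq: "X = lie a b c d h" and cd: "\<And>i. c i \<in> k" "\<And>i. d i \<in> k"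
    and h: "h 2 = - h 0 - h 1" and hk: "\<And>i j. h i - h j \<in> k" using X unfolding lie_ring_def by blast
  note F = subfieldD[OF k]
  have t3: "u * t ^ 3 \<in> k" if "u \<in> k" for u using that cubes F(6) by blast
  \<comment> \<open>A common shift of the toral entries changes their sum by
    \<open>3 * u = 0\<close> and leaves the differences alone.\<close>
  have shift: "(\<lambda>j. h j + u) 2 = - (\<lambda>j. h j + u) 0 - (\<lambda>j. h j + u) 1" for u
    by (simp add: h algebra_simps three_eq_0[OF char3])
  \<comment> \<open>The effect of a long root element on the toral part: some \<open>u\<close> in
    \<open>k\<close> is added to one entry and subtracted from another.\<close>
  have upd: "(h(i + 1 := h (i + 1) + u, i + 2 := h (i + 2) - u)) 2 =
      - (h(i + 1 := h (i + 1) + u, i + 2 := h (i + 2) - u)) 0 - (h(i + 1 := h (i + 1) + u, i + 2 := h (i + 2) - u)) 1"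
    "(h(i + 1 := h (i + 1) + u, i + 2 := h (i + 2) - u)) p - (h(i + 1 := h (i + 1) + u, i + 2 := h (i + 2) - u)) q \<in> k"
    if "u \<in> k" for u i p q
  proof -
    have "\<forall>i. (h(i + 1 := h (i + 1) + u, i + 2 := h (i + 2) - u)) 2 =
      - (h(i + 1 := h (i + 1) + u, i + 2 := h (i + 2) - u)) 0 - (h(i + 1 := h (i + 1) + u, i + 2 := h (i + 2) - u)) 1"
      unfolding all_mod3 using h by (simp add: mod3_simps)
    then show "(h(i + 1 := h (i + 1) + u, i + 2 := h (i + 2) - u)) 2 =
      - (h(i + 1 := h (i + 1) + u, i + 2 := h (i + 2) - u)) 0 - (h(i + 1 := h (i + 1) + u, i + 2 := h (i + 2) - u)) 1" by blast
    define v where "v = ((\<lambda>_. 0)(i + 1 := u, i + 2 := - u))"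
    have v: "v p \<in> k" "v q \<in> k" using that F by (auto simp: v_def)
    have "(h(i + 1 := h (i + 1) + u, i + 2 := h (i + 2) - u)) j = h j + v j" for j by (simp add: v_def)
    then have "(h(i + 1 := h (i + 1) + u, i + 2 := h (i + 2) - u)) p - (h(i + 1 := h (i + 1) + u, i + 2 := h (i + 2) - u)) q
        = (h p - h q) + (v p - v q)" by simp
    then show "(h(i + 1 := h (i + 1) + u, i + 2 := h (i + 2) - u)) p - (h(i + 1 := h (i + 1) + u, i + 2 := h (i + 2) - u)) q \<in> k"
      using F(4)[OF hk F(5)[OF v]] by simp
  qed
  show ?thesis
  proof (cases \<alpha>)
    case (ShortP i)
    show ?thesis unfolding ShortP X_eq lie_ShortP[OF h]
      by (rule bexI, rule refl, rule lie_ringI)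
        (use cd t3 F hk shift[of "- b i * t"] in auto)
  next
    case (ShortN i)
    show ?thesis unfolding ShortN X_eq lie_ShortN[OF h]
      by (rule bexI, rule refl, rule lie_ringI)
        (use cd t3 F hk shift[of "a i * t"] in auto)
  next
    case (LongP i)
    then have t: "t \<in> k" using t by simp
    have u: "d i * t \<in> k" using F(6) cd t by blast
    show ?thesis unfolding LongP X_eq lie_LongP[OF h]
      by (rule bexI, rule refl, rule lie_ringI)
        (use cd t F hk in simp, use cd t F in simp, rule upd(1)[OF u], rule upd(2)[OF u])
  next
    case (LongN i)
    then have t: "t \<in> k" using t by simp
    have u: "- (c i * t) \<in> k" using F(3,6) cd t by blast
    show ?thesis unfolding LongN X_eq lie_LongN[OF h]
      by (rule bexI, rule refl, rule lie_ringI)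
        (use cd t F in simp, use cd t F hk in simp, use upd(1)[OF u] in simp, use upd(2)[OF u] in simp)
  qed
qed

lemma root_span_lie_ring:
  assumes "z \<in> root_span k UNIV" "X \<in> lie_ring k"
  shows "\<exists>X' \<in> lie_ring k. z ** X = X' ** z"
proof -
  obtain ws where ws: "z = word ws (mat 1)" "valid k UNIV ws" using assms(1) by (auto simp: root_span_def)
  have "\<exists>X' \<in> lie_ring k. word ws (mat 1) ** X = X' ** word ws (mat 1)" using ws(2)
  proof (induction ws)
    case Nil
    then show ?case using assms(2) by auto
  next
    case (Cons a ws)
    obtain \<alpha> t where a: "a = (\<alpha>, t)" by fastforce
    obtain X1 where X1: "X1 \<in> lie_ring k" "word ws (mat 1) ** X = X1 ** word ws (mat 1)"
      using Cons by (auto simp: a)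
    obtain X2 where X2: "X2 \<in> lie_ring k" "root_elt \<alpha> t ** X1 = X2 ** root_elt \<alpha> t"
      using root_elt_lie_ring[OF _ X1(1)] Cons.prems by (auto simp: a)
    have "(root_elt \<alpha> t ** word ws (mat 1)) ** X = (root_elt \<alpha> t ** X1) ** word ws (mat 1)"
      by (simp only: matrix_mul_assoc[symmetric] X1(2))
    also have "\<dots> = X2 ** (root_elt \<alpha> t ** word ws (mat 1))" by (simp only: X2(2) matrix_mul_assoc)
    finally show ?case using X2(1) by (auto simp: a)
  qed
  then show ?thesis by (simp add: ws(1))
qed

end

subsection \<open>Centralizers of root subgroups\<close>

lemma mat_mult: "mat a ** (A :: 'a::field ^ 'n ^ 'n::finite) = (\<chi> r s. a * A $ r $ s)"
proof -
  have "(\<Sum>q \<in> UNIV. (if r = q then a else 0) * A $ q $ s) = a * A $ r $ s" for r s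
    by (subst sum.cong[OF refl, of _ _ "\<lambda>q. if r = q then a * A $ q $ s else 0"]) auto
  then show ?thesis by (simp add: mat_def matrix_matrix_mult_def vec_eq_iff)
qed

lemma mult_mat: "(A :: 'a::field ^ 'n ^ 'n::finite) ** mat a = mat a ** A"
proof -
  have "(\<Sum>q \<in> UNIV. A $ r $ q * (if q = s then a else 0)) = a * A $ r $ s" for r s
    by (subst sum.cong[OF refl, of _ _ "\<lambda>q. if q = s then a * A $ r $ q else 0"]) auto
  then show ?thesis unfolding mat_mult by (simp add: mat_def matrix_matrix_mult_def vec_eq_iff)
qed

text \<open>Weights named relative to \<open>i\<close> let one computation serve all three roots
  \<open>ShortP i\<close>.\<close>

lemma all_g2_weight_shift:
  "(\<forall>w. P w) \<longleftrightarrow> P Wt0 \<and> P (WtP i) \<and> P (WtP (i + 1)) \<and> P (WtP (i + 2)) \<and> P (WtN i) \<and> P (WtN (i + 1)) \<and> P (WtN (i + 2))"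
proof -
  have "\<forall>i. (\<forall>w. P w) \<longleftrightarrow> P Wt0 \<and> P (WtP i) \<and> P (WtP (i + 1)) \<and> P (WtP (i + 2)) \<and> P (WtN i) \<and> P (WtN (i + 1)) \<and> P (WtN (i + 2))"
    unfolding all_mod3 all_g2_weight by (auto simp: mod3_simps)
  then show ?thesis by blast
qed

lemma sum_g2_weight_shift:
  fixes f :: "g2_weight \<Rightarrow> 'a::field"
  shows "(\<Sum>w \<in> UNIV. f w) = f Wt0 + f (WtP i) + f (WtP (i + 1)) + f (WtP (i + 2)) + f (WtN i) + f (WtN (i + 1)) + f (WtN (i + 2))"
proof -
  have "\<forall>i. (\<Sum>w \<in> UNIV. f w) = f Wt0 + f (WtP i) + f (WtP (i + 1)) + f (WtP (i + 2)) + f (WtN i) + f (WtN (i + 1)) + f (WtN (i + 2))"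
    unfolding all_mod3 sum_g2_weight by (simp add: mod3_simps ac_simps)
  then show ?thesis by blast
qed

context
  fixes k :: "'a::field set"
  assumes char3: "CHAR('a) = 3" and k: "is_subfield k" and cubes: "\<forall>x. x ^ 3 \<in> k"
begin

text \<open>Commutation is a linear condition on \<open>z\<close> and leaves three entries open: the
  common diagonal entry, the one at \<open>WtP i\<close>, \<open>Wt0\<close>, and the corner at
  \<open>WtP i\<close>, \<open>WtN i\<close>. For a multiple of a root element the corner has to be
  quadratic in the parameter. This relation comes from the invariance of the Lie ring, tested on the
  root vector of the opposite root \<open>ShortN i\<close>.\<close>

lemma centralizer_short:
  assumes z: "\<And>\<delta>. \<delta> \<in> {ShortP i, ShortN (i + 1), ShortN (i + 2), LongP i, LongN i, LongP (i + 2), LongN (i + 1)} \<Longrightarrow>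
    root_elt \<delta> 1 ** z = z ** root_elt \<delta> (1 :: 'a)"
    and lie: "\<exists>X \<in> lie_ring k. z ** lie (\<lambda>_. 0) (\<lambda>j. if j = i then 1 else 0) (\<lambda>_. 0) (\<lambda>_. 0) (\<lambda>_. 0) =
      X ** z"
    and z0: "z \<noteq> 0"
  shows "\<exists>a t. a \<noteq> 0 \<and> z = mat a ** root_elt (ShortP i) t"
proof -
  have e: "row_op \<delta> 1 (\<lambda>q. z $ q $ s) r = col_op \<delta> 1 (\<lambda>q. z $ r $ q) s"
    if "\<delta> \<in> {ShortP i, ShortN (i + 1), ShortN (i + 2), LongP i, LongN i, LongP (i + 2), LongN (i + 1)}" for \<delta> r s
    using z[OF that] by (metis root_elt_mult mult_root_elt)
  \<comment> \<open>The equations are single matrix entries of the commutation relations, solved in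
    three rounds that each use the previous results.\<close>
  have l1: "z $ (WtN i) $ (WtP i) = 0" "z $ (WtN i) $ (WtN (i + 2)) = 0" "z $ (WtN i) $ (WtN (i + 1)) = 0"
    "z $ (WtP (i + 2)) $ (WtP i) = 0" "z $ (WtP (i + 2)) $ (WtN (i + 1)) = 0"
    "z $ (WtP (i + 2)) $ (WtN (i + 2)) = 0" "z $ (WtP (i + 1)) $ (WtP i) = 0"
    "z $ (WtP (i + 1)) $ (WtN (i + 1)) = 0" "z $ (WtP (i + 1)) $ (WtN (i + 2)) = 0"
    "z $ (WtP (i + 2)) $ (WtP (i + 1)) = 0" "z $ (WtN (i + 1)) $ (WtP i) = 0"
    "z $ (WtN (i + 1)) $ (WtP (i + 1)) = 0" "z $ (WtN (i + 1)) $ (WtN (i + 2)) = 0"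
    "z $ (WtN i) $ (WtP (i + 1)) = 0" "z $ (WtP (i + 1)) $ (WtP (i + 2)) = 0"
    "z $ (WtN i) $ (WtP (i + 2)) = 0" "z $ (WtN (i + 2)) $ (WtP (i + 2)) = 0"
    "z $ (WtN (i + 2)) $ (WtP i) = 0" "z $ (WtN (i + 2)) $ (WtN (i + 1)) = 0" "z $ Wt0 $ (WtP i) = 0"
    "z $ Wt0 $ (WtN (i + 1)) = 0" "z $ (WtP (i + 1)) $ Wt0 = 0" "z $ (WtN i) $ Wt0 = 0"
    "z $ Wt0 $ (WtP (i + 1)) = 0" "z $ Wt0 $ (WtN (i + 2)) = 0" "z $ (WtP i) $ (WtP (i + 1)) = 0"
    "z $ (WtP i) $ (WtN (i + 2)) = 0" "z $ (WtP (i + 2)) $ Wt0 = 0" "z $ (WtP (i + 2)) $ (WtN i) = 0"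
    "z $ (WtN (i + 1)) $ Wt0 = 0" "z $ (WtN (i + 1)) $ (WtN i) = 0" "z $ Wt0 $ (WtP (i + 2)) = 0"
    "z $ (WtP (i + 1)) $ (WtN i) = 0" "z $ (WtP i) $ (WtP (i + 2)) = 0" "z $ (WtP i) $ (WtN (i + 1)) = 0"
    "z $ (WtN (i + 2)) $ Wt0 = 0" "z $ (WtN (i + 2)) $ (WtN i) = 0"
    using e[of "ShortP i" "WtP i" "Wt0"] e[of "ShortP i" "WtN (i + 2)" "Wt0"]
      e[of "ShortP i" "WtN (i + 1)" "Wt0"] e[of "ShortP i" "Wt0" "WtP (i + 2)"]
      e[of "ShortP i" "WtP (i + 2)" "WtP (i + 2)"] e[of "ShortP i" "WtP (i + 1)" "WtP (i + 2)"]
      e[of "ShortP i" "Wt0" "WtP (i + 1)"] e[of "ShortP i" "WtP (i + 2)" "WtP (i + 1)"]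
      e[of "ShortP i" "WtP (i + 1)" "WtP (i + 1)"] e[of "ShortN (i + 2)" "WtP (i + 1)" "Wt0"]
      e[of "ShortN (i + 2)" "WtP i" "WtP i"] e[of "ShortN (i + 2)" "WtP (i + 1)" "WtP i"]
      e[of "ShortN (i + 2)" "WtN (i + 2)" "WtP i"]
      e[of "ShortN (i + 2)" "WtP (i + 1)" "WtP (i + 1)"] e[of "ShortN (i + 1)" "WtP (i + 2)" "Wt0"]
      e[of "ShortN (i + 1)" "WtP (i + 2)" "WtP (i + 2)"]
      e[of "ShortN (i + 1)" "WtP (i + 2)" "WtP i"] e[of "ShortN (i + 1)" "WtP i" "WtP i"]
      e[of "ShortN (i + 1)" "WtN (i + 1)" "WtP i"] e[of "LongP (i + 2)" "WtP (i + 1)" "Wt0"]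
      e[of "LongP (i + 2)" "WtN i" "Wt0"] e[of "LongP (i + 2)" "Wt0" "WtP i"]
      e[of "LongP (i + 2)" "Wt0" "WtN (i + 1)"] e[of "LongP i" "WtP (i + 2)" "Wt0"]
      e[of "LongP i" "WtN (i + 1)" "Wt0"] e[of "LongP i" "WtP (i + 2)" "WtP i"]
      e[of "LongP i" "WtN (i + 1)" "WtP i"] e[of "LongP i" "Wt0" "WtP (i + 1)"]
      e[of "LongP i" "WtN i" "WtP (i + 1)"] e[of "LongP i" "Wt0" "WtN (i + 2)"]
      e[of "LongP i" "WtN i" "WtN (i + 2)"] e[of "LongN i" "WtP (i + 1)" "Wt0"]
      e[of "LongN i" "WtN i" "WtP (i + 2)"] e[of "LongN i" "WtP (i + 1)" "WtP i"]
      e[of "LongN i" "WtN (i + 2)" "WtP i"] e[of "LongN i" "Wt0" "WtN (i + 1)"]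
      e[of "LongN i" "WtN i" "WtN (i + 1)"]
    by (simp_all add: mod3_simps two_eq[OF char3] add.assoc)
  have l2: "z $ (WtN i) $ (WtN i) = z $ Wt0 $ Wt0" "z $ (WtP i) $ (WtP i) = z $ Wt0 $ Wt0"
    "z $ (WtP (i + 2)) $ (WtP (i + 2)) = z $ Wt0 $ Wt0"
    "z $ (WtN (i + 1)) $ (WtP (i + 2)) = z $ (WtP i) $ Wt0"
    "z $ (WtN (i + 2)) $ (WtN (i + 2)) = z $ Wt0 $ Wt0" "z $ (WtP (i + 1)) $ (WtP (i + 1)) = z $ Wt0 $ Wt0"
    "z $ (WtN (i + 2)) $ (WtP (i + 1)) = - z $ (WtP i) $ Wt0"
    "z $ (WtN (i + 1)) $ (WtN (i + 1)) = z $ Wt0 $ Wt0"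
    using e[of "ShortP i" "WtN i" "Wt0"] e[of "ShortP i" "Wt0" "WtP i"]
      e[of "ShortN (i + 2)" "WtP (i + 2)" "Wt0"] e[of "ShortN (i + 2)" "WtP (i + 2)" "WtP i"]
      e[of "ShortN (i + 2)" "Wt0" "WtN (i + 2)"] e[of "ShortN (i + 1)" "WtP (i + 1)" "Wt0"]
      e[of "ShortN (i + 1)" "WtP (i + 1)" "WtP i"] e[of "ShortN (i + 1)" "Wt0" "WtN (i + 1)"]
    by (simp_all add: l1 mod3_simps two_eq[OF char3] add.assoc) (metis minus_minus)
  have l3: "z $ Wt0 $ (WtN i) = - z $ (WtP i) $ Wt0"
    using e[of "ShortN (i + 2)" "WtN i" "WtN (i + 2)"]
    by (simp_all add: l1 l2 mod3_simps two_eq[OF char3] add.assoc) (metis minus_minus)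
  define a where "a = z $ Wt0 $ Wt0"
  define b where "b = z $ WtP i $ Wt0"
  obtain X where X: "z ** lie (\<lambda>_. 0) (\<lambda>j. if j = i then 1 else 0) (\<lambda>_. 0) (\<lambda>_. 0) (\<lambda>_. 0) = X ** z" "X \<in> lie_ring k"
    using lie by blast
  then obtain a' b' c' d' h' where X': "X = lie a' b' c' d' h'" by (auto simp: lie_ring_def)
  have X_entry: "(\<Sum>q \<in> UNIV. z $ r $ q * lie_entry (\<lambda>_. 0) (\<lambda>j. if j = i then 1 else 0) (\<lambda>_. 0) (\<lambda>_. 0) (\<lambda>_. 0) q s) =
      (\<Sum>q \<in> UNIV. lie_entry a' b' c' d' h' r q * z $ q $ s)" for r s
    using arg_cong[OF X(1), of "\<lambda>m. m $ r $ s"] by (simp add: X' matrix_matrix_mult_def lie_def)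
  note E = X_entry[unfolded sum_g2_weight_shift[where i = i]]
  \<comment> \<open>Four entries of the invariance equation involve only the three open entries of
    \<open>z\<close> and the coordinates \<open>a' i\<close>, \<open>b' i\<close>,
    \<open>h' i\<close> of the conjugate.\<close>
  have eqs: "a = b' i * a" "z $ WtP i $ WtN i * 2 = 2 * a' i * a + h' i * b"
    "b' i * z $ WtP i $ WtN i + a' i * a = 0" "b = h' i * a"
    using E[of Wt0 "WtP i"] E[of "WtP i" Wt0] E[of Wt0 "WtN i"] E[of "WtP i" "WtP i"]
    by (simp_all add: l1 l2 l3 mod3_simps add.assoc a_def b_def two_eq[OF char3])
  have "a \<noteq> 0"
  proof
    assume a: "a = 0"
    then have "b = 0" "z $ WtP i $ WtN i = 0" using eqs by (simp_all add: two_eq[OF char3])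
    then have "\<forall>r s. z $ r $ s = 0"
      unfolding all_g2_weight_shift[where i = i] using a by (simp add: l1 l2 l3 flip: a_def b_def)
    then show False using z0 by (simp add: vec_eq_iff)
  qed
  \<comment> \<open>The corresponding entry of \<open>root_elt (ShortP i) t\<close> is
    \<open>2 * t = - t\<close>.\<close>
  define t where "t = - b / a"
  have b: "b = - (a * t)" using \<open>a \<noteq> 0\<close> by (simp add: t_def)
  have "b' i = 1" "h' i = - t" using eqs(1,4) \<open>a \<noteq> 0\<close> by (simp_all add: t_def)
  then have "a' i * a = - z $ WtP i $ WtN i" using eqs(3) by (simp add: eq_neg_iff_add_eq_0 add.commute)
  \<comment> \<open>Eliminating \<open>a' i\<close> and \<open>h' i\<close> gives four times the
    corner entry as \<open>a * t\<^sup>2\<close>, and \<open>4 = 1\<close> here.\<close>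
  then have c: "z $ WtP i $ WtN i = a * t\<^sup>2"
    using eqs(2) \<open>h' i = - t\<close> b by (simp add: two_eq[OF char3] power2_eq_square mult.assoc add_self[OF char3])
      (simp add: algebra_simps eq_neg_iff_add_eq_0 add_self[OF char3])
  have "\<forall>r s. z $ r $ s = a * (root_elt (ShortP i) t ** mat 1) $ r $ s"
    unfolding all_g2_weight_shift[where i = i] root_elt_mult
    by (simp add: l1 l2 l3 c b mod3_simps add.assoc mat_def two_eq[OF char3] flip: a_def b_def)
  then have "z = mat a ** root_elt (ShortP i) t" by (simp add: mat_mult vec_eq_iff)
  then show ?thesis using \<open>a \<noteq> 0\<close> by blast
qed

text \<open>The square of a long root vector vanishes, and commutation alone makes \<open>z\<close>
  a scalar multiple of a root element. Its entries show only \<open>a\<close> and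
  \<open>a * t\<close>. To separate them, the root vector of \<open>LongN 1\<close> is conjugated:
  its image has coordinate \<open>- t\<close> at \<open>LongP 2\<close>, and long coordinates in the
  Lie ring lie in \<open>k\<close>.\<close>

lemma centralizer_long:
  assumes z: "\<And>\<delta>. \<delta> \<in> {ShortP 0, ShortP 2, ShortN 0, ShortN 1, LongP 1, LongP 2, LongN 0} \<Longrightarrow>
    root_elt \<delta> 1 ** z = z ** root_elt \<delta> (1 :: 'a)"
    and lie: "\<exists>X \<in> lie_ring k. z ** lie (\<lambda>_. 0) (\<lambda>_. 0) (\<lambda>_. 0) (\<lambda>j. if j = 1 then 1 else 0) (\<lambda>_. 0) = X ** z"
    and inv: "z ** y = mat 1"
  shows "\<exists>a t. a \<noteq> 0 \<and> t \<in> k \<and> z = mat a ** root_elt (LongN 0) t"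
proof -
  have e: "row_op \<delta> 1 (\<lambda>q. z $ q $ s) r = col_op \<delta> 1 (\<lambda>q. z $ r $ q) s"
    if "\<delta> \<in> {ShortP 0, ShortP 2, ShortN 0, ShortN 1, LongP 1, LongP 2, LongN 0}" for \<delta> r s
    using z[OF that] by (metis root_elt_mult mult_root_elt)
  have l1: "z $ (WtN 0) $ (WtP 0) = 0" "z $ (WtN 0) $ (WtN 1) = 0" "z $ (WtN 0) $ (WtN 2) = 0"
    "z $ (WtP 1) $ (WtP 0) = 0" "z $ (WtP 1) $ (WtN 2) = 0" "z $ (WtP 1) $ (WtN 1) = 0"
    "z $ (WtP 2) $ (WtP 0) = 0" "z $ (WtP 2) $ (WtN 2) = 0" "z $ (WtP 2) $ (WtN 1) = 0"
    "z $ (WtN 2) $ (WtP 2) = 0" "z $ (WtN 2) $ (WtN 0) = 0" "z $ (WtN 2) $ (WtN 1) = 0"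
    "z $ (WtP 0) $ (WtP 2) = 0" "z $ (WtP 0) $ (WtN 1) = 0" "z $ (WtP 0) $ (WtN 0) = 0"
    "z $ (WtP 1) $ (WtP 2) = 0" "z $ (WtP 1) $ (WtN 0) = 0" "z $ (WtP 0) $ (WtP 1) = 0"
    "z $ (WtN 2) $ (WtP 1) = 0" "z $ (WtN 1) $ (WtP 1) = 0" "z $ (WtN 1) $ (WtP 2) = 0"
    "z $ (WtN 1) $ (WtN 0) = 0" "z $ (WtN 2) $ (WtP 0) = 0" "z $ (WtN 0) $ (WtP 2) = 0"
    "z $ Wt0 $ (WtP 2) = 0" "z $ Wt0 $ (WtN 0) = 0" "z $ (WtP 0) $ Wt0 = 0" "z $ (WtN 2) $ Wt0 = 0"
    "z $ Wt0 $ (WtP 0) = 0" "z $ Wt0 $ (WtN 1) = 0" "z $ (WtP 1) $ Wt0 = 0" "z $ (WtN 0) $ Wt0 = 0"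
    "z $ (WtN 1) $ (WtN 2) = - z $ (WtP 2) $ (WtP 1)"
    using e[of "ShortP 0" "WtP 0" "Wt0"] e[of "ShortP 0" "WtN 1" "Wt0"] e[of "ShortP 0" "WtN 2" "Wt0"]
      e[of "ShortP 0" "Wt0" "WtP 1"] e[of "ShortP 0" "WtP 1" "WtP 1"]
      e[of "ShortP 0" "WtP 2" "WtP 1"] e[of "ShortP 0" "Wt0" "WtP 2"]
      e[of "ShortP 0" "WtP 1" "WtP 2"] e[of "ShortP 0" "WtP 2" "WtP 2"]
      e[of "ShortP 2" "WtP 2" "Wt0"] e[of "ShortP 2" "WtN 0" "Wt0"] e[of "ShortP 2" "WtN 1" "Wt0"]
      e[of "ShortP 2" "Wt0" "WtP 0"] e[of "ShortP 2" "WtP 0" "WtP 0"]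
      e[of "ShortP 2" "WtP 1" "WtP 0"] e[of "ShortP 2" "Wt0" "WtP 1"]
      e[of "ShortP 2" "WtP 1" "WtP 1"] e[of "ShortN 0" "WtP 1" "Wt0"]
      e[of "ShortN 0" "WtP 1" "WtP 1"] e[of "ShortN 0" "WtP 1" "WtP 2"]
      e[of "ShortN 0" "WtP 2" "WtP 2"] e[of "ShortN 0" "WtN 0" "WtP 2"]
      e[of "ShortN 1" "WtP 0" "WtP 0"] e[of "ShortN 1" "WtP 2" "WtP 2"]
      e[of "LongP 1" "WtP 0" "Wt0"] e[of "LongP 1" "WtN 2" "Wt0"] e[of "LongP 1" "Wt0" "WtP 2"]
      e[of "LongP 1" "Wt0" "WtN 0"] e[of "LongP 2" "WtP 1" "Wt0"] e[of "LongP 2" "WtN 0" "Wt0"]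
      e[of "LongP 2" "Wt0" "WtP 0"] e[of "LongP 2" "Wt0" "WtN 1"]
      e[of "ShortP 0" "WtP 1" "WtN 1"]
    by (simp_all add: mod3_simps two_eq[OF char3] add.assoc)
  have l2: "z $ Wt0 $ (WtN 2) = 0" "z $ (WtP 2) $ Wt0 = 0" "z $ Wt0 $ (WtP 1) = 0" "z $ (WtN 1) $ Wt0 = 0"
    "z $ (WtN 0) $ (WtN 0) = z $ Wt0 $ Wt0" "z $ (WtP 0) $ (WtP 0) = z $ Wt0 $ Wt0"
    "z $ (WtN 2) $ (WtN 2) = z $ Wt0 $ Wt0" "z $ (WtP 2) $ (WtP 2) = z $ Wt0 $ Wt0"
    "z $ (WtP 1) $ (WtP 1) = z $ Wt0 $ Wt0" "z $ (WtN 1) $ (WtN 1) = z $ Wt0 $ Wt0"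
    using e[of "ShortP 0" "WtN 2" "WtP 0"] e[of "ShortP 0" "WtN 0" "WtP 2"]
      e[of "ShortN 0" "WtP 1" "WtN 0"] e[of "ShortN 0" "WtP 0" "WtN 1"]
      e[of "ShortP 0" "WtN 0" "Wt0"] e[of "ShortP 0" "Wt0" "WtP 0"] e[of "ShortP 2" "WtN 2" "Wt0"]
      e[of "ShortP 2" "Wt0" "WtP 2"] e[of "ShortN 1" "WtP 1" "Wt0"] e[of "ShortN 1" "Wt0" "WtN 1"]
    by (simp_all add: l1 mod3_simps two_eq[OF char3] add.assoc)
  have l3: "z $ (WtN 0) $ (WtP 1) = 0" "z $ (WtN 1) $ (WtP 0) = 0" "z $ (WtP 0) $ (WtN 2) = 0"
    "z $ (WtP 2) $ (WtN 0) = 0"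
    using e[of "ShortP 0" "WtP 1" "Wt0"] e[of "ShortP 0" "Wt0" "WtN 1"] e[of "ShortN 0" "WtN 2" "Wt0"]
      e[of "ShortN 0" "Wt0" "WtP 2"]
    by (simp_all add: l1 l2 mod3_simps two_eq[OF char3] add.assoc)
  define a where "a = z $ Wt0 $ Wt0"
  have "(z ** y) $ Wt0 $ Wt0 = a * y $ Wt0 $ Wt0"
    by (simp add: matrix_matrix_mult_def sum_g2_weight l1 l2 l3 a_def)
  then have a: "a \<noteq> 0" by (auto simp: inv mat_def)
  define t where "t = z $ WtP 2 $ WtP 1 / a"
  have t: "z $ WtP 2 $ WtP 1 = a * t" using a by (simp add: t_def)
  have "\<forall>r s. z $ r $ s = a * (root_elt (LongN 0) t ** mat 1) $ r $ s"
    unfolding all_g2_weight root_elt_mult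
    by (simp add: l1 l2 l3 t mod3_simps mat_def flip: a_def)
  then have z_eq: "z = mat a ** root_elt (LongN 0) t" by (simp add: mat_mult vec_eq_iff)
  obtain X where X: "z ** lie (\<lambda>_. 0) (\<lambda>_. 0) (\<lambda>_. 0) (\<lambda>j. if j = 1 then 1 else 0) (\<lambda>_. 0) = X ** z" "X \<in> lie_ring k"
    using lie by blast
  then obtain a' b' c' d' h' where X': "X = lie a' b' c' d' h'" "\<forall>i. c' i \<in> k" by (auto simp: lie_ring_def)
  \<comment> \<open>At \<open>WtN 1\<close>, \<open>WtN 0\<close> a Lie ring element has the entry
    \<open>- c' 2\<close>, and both sides of the comparison carry the factor
    \<open>a\<close>.\<close>
  have "(\<Sum>q \<in> UNIV. z $ WtN 1 $ q * lie_entry (\<lambda>_. 0) (\<lambda>_. 0) (\<lambda>_. 0) (\<lambda>j. if j = 1 then 1 else 0) (\<lambda>_. 0) q (WtN 0)) =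
      (\<Sum>q \<in> UNIV. lie_entry a' b' c' d' h' (WtN 1) q * z $ q $ WtN 0)"
    using arg_cong[OF X(1), of "\<lambda>m. m $ WtN 1 $ WtN 0"] by (simp add: X' matrix_matrix_mult_def lie_def)
  then have "a * t = - (c' 2 * a)"
    unfolding sum_g2_weight by (simp add: l1 l2 l3 t mod3_simps flip: a_def)
  then have "a * t = a * (- c' 2)" by (simp add: mult.commute)
  then have "t = - c' 2" using a by (simp only: mult_cancel_left) simp
  then have "t \<in> k" using X'(2) subfieldD(3)[OF k] by simp
  then show ?thesis using a z_eq by blast
qed

end

text \<open>The element \<open>coord t\<close> of a short root subgroup represents \<open>t\<close>.  The sign turns the commutator
  relation of the short roots \<open>\<epsilon>\<^sub>1\<close>, \<open>\<epsilon>\<^sub>2\<close> into \<open>[x(t), x(u)] = coord (t u)\<close>.\<close>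

definition coord :: "'a::field \<Rightarrow> 'a g2_matrix" where
  "coord t = root_elt (ShortN 0) (- t)"

lemma coord_add: "coord t ** coord u = coord (t + u)"
  using root_elt_add_mult[of "ShortN 0" "- t" "- u" "mat 1"] by (simp add: coord_def)

lemma coord_0: "coord 0 = mat 1"
  by (simp add: coord_def root_elt_0)

lemma coord_inject: "coord t = coord u \<longleftrightarrow> t = u"
proof
  assume "coord t = coord u"
  then have "(root_elt (ShortN 0) (- t) ** mat 1) $ Wt0 $ WtP 0 = (root_elt (ShortN 0) (- u) ** mat 1) $ Wt0 $ WtP 0"
    by (simp add: coord_def)
  then show "t = u" unfolding root_elt_mult by (simp add: mat_def)
qed simp

context
  fixes k :: "'a::field set"
  assumes char3: "CHAR('a) = 3" and k: "is_subfield k" and cubes: "\<forall>x. x ^ 3 \<in> k"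
begin

lemma root_span_inverse:
  assumes "z \<in> root_span k UNIV"
  shows "\<exists>y \<in> root_span k UNIV. z ** y = mat 1 \<and> y ** z = mat 1"
proof -
  obtain ws where ws: "z = word ws (mat 1)" "valid k UNIV ws" using assms by (auto simp: root_span_def)
  show ?thesis
  proof (intro bexI conjI)
    show "z ** word (inv_word ws) (mat 1) = mat 1" by (simp add: ws(1) word_mult word_inv_word)
    show "word (inv_word ws) (mat 1) ** z = mat 1" by (simp add: ws(1) word_mult word_inv_word)
    show "word (inv_word ws) (mat 1) \<in> root_span k UNIV"
      by (intro word_in_root_span valid_inv_word[OF char3 k cubes] ws(2))
  qed
qed

lemma root_span_cancel:
  assumes "z \<in> root_span k UNIV" "x ** z = y ** z"
  shows "x = y"
proof -
  obtain z' where "z ** z' = mat 1" using root_span_inverse[OF assms(1)] by blast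
  moreover have "x ** (z ** z') = y ** (z ** z')" using assms(2) by (simp add: matrix_mul_assoc)
  ultimately show ?thesis by simp
qed

lemma lie_const_in_ring:
  assumes "\<And>i. c i \<in> k"
  shows "lie (\<lambda>_. 0) b (\<lambda>_. 0) c (\<lambda>_. 0) \<in> lie_ring k"
  by (rule lie_ringI[OF char3 k cubes]) (use assms subfieldD(1)[OF k] in auto)

lemma centralizer_short_span:
  assumes z: "z \<in> root_span k UNIV"
    and c: "\<And>\<delta>. \<delta> \<in> {ShortP i, ShortN (i + 1), ShortN (i + 2), LongP i, LongN i, LongP (i + 2), LongN (i + 1)} \<Longrightarrow>
      root_elt \<delta> 1 ** z = z ** root_elt \<delta> 1"
  shows "\<exists>a t. a \<noteq> 0 \<and> z = mat a ** root_elt (ShortP i) t"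
proof -
  obtain y where y: "z ** y = mat 1" using root_span_inverse[OF z] by blast
  show ?thesis
  proof (rule centralizer_short[OF char3 k cubes c])
    show "\<exists>X \<in> lie_ring k. z ** lie (\<lambda>_. 0) (\<lambda>j. if j = i then 1 else 0) (\<lambda>_. 0) (\<lambda>_. 0) (\<lambda>_. 0) = X ** z"
      by (rule root_span_lie_ring[OF char3 k cubes z lie_const_in_ring]) (rule subfieldD(1)[OF k])
    show "z \<noteq> 0"
    proof
      assume "z = 0"
      then have "(z ** y) $ Wt0 $ Wt0 = 0" by (simp add: matrix_matrix_mult_def)
      then show False by (simp add: y mat_def)
    qed
  qed
qed

lemma centralizer_long_span:
  assumes z: "z \<in> root_span k UNIV"
    and c: "\<And>\<delta>. \<delta> \<in> {ShortP 0, ShortP 2, ShortN 0, ShortN 1, LongP 1, LongP 2, LongN 0} \<Longrightarrow>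
      root_elt \<delta> 1 ** z = z ** root_elt \<delta> 1"
  shows "\<exists>a t. a \<noteq> 0 \<and> t \<in> k \<and> z = mat a ** root_elt (LongN 0) t"
proof -
  obtain y where y: "z ** y = mat 1" using root_span_inverse[OF z] by blast
  show ?thesis
  proof (rule centralizer_long[OF char3 k cubes c _ y])
    show "\<exists>X \<in> lie_ring k. z ** lie (\<lambda>_. 0) (\<lambda>_. 0) (\<lambda>_. 0) (\<lambda>j. if j = 1 then 1 else 0) (\<lambda>_. 0) = X ** z"
      by (rule root_span_lie_ring[OF char3 k cubes z lie_const_in_ring]) (use subfieldD(1,2)[OF k] in auto)
  qed
qed

lemma root_elt_commute:
  assumes "\<alpha> \<noteq> \<beta>" "opp \<alpha> \<noteq> \<beta>" "comm \<alpha> \<beta> t u = []"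
  shows "root_elt \<alpha> t ** root_elt \<beta> u = root_elt \<beta> u ** root_elt \<alpha> (t :: 'a)"
  using root_elt_comm[OF char3 assms(1,2), of t u "mat 1"] assms(3) by simp

lemma centralizer_shortI:
  assumes "\<delta> \<in> {ShortP i, ShortN (i + 1), ShortN (i + 2), LongP i, LongN i, LongP (i + 2), LongN (i + 1)}"
  shows "root_elt \<delta> 1 ** root_elt (ShortP i) t = root_elt (ShortP i) (t :: 'a) ** root_elt \<delta> 1"
proof (cases "\<delta> = ShortP i")
  case True
  then show ?thesis using root_elt_add_mult[of "ShortP i" 1 t "mat 1"] root_elt_add_mult[of "ShortP i" t 1 "mat 1"]
    by (simp add: add.commute)
next
  case False
  have "comm \<delta> (ShortP i) 1 t = []" using assms False by (auto simp: mod3_simps add.assoc)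
  then show ?thesis using assms False by (intro root_elt_commute) (auto simp: mod3_simps)
qed

lemma centralizer_longI:
  assumes "\<delta> \<in> {ShortP 0, ShortP 2, ShortN 0, ShortN 1, LongP 1, LongP 2, LongN 0}"
  shows "root_elt \<delta> 1 ** root_elt (LongN 0) t = root_elt (LongN 0) (t :: 'a) ** root_elt \<delta> 1"
proof (cases "\<delta> = LongN 0")
  case True
  then show ?thesis using root_elt_add_mult[of "LongN 0" 1 t "mat 1"] root_elt_add_mult[of "LongN 0" t 1 "mat 1"]
    by (simp add: add.commute)
next
  case False
  have "comm \<delta> (LongN 0) 1 t = []" using assms False by (auto simp: mod3_simps)
  then show ?thesis using assms False by (intro root_elt_commute) auto
qed

lemma coord_mult: "root_elt (ShortP 1) (t :: 'a) ** root_elt (ShortP 2) u = coord (t * u) ** (root_elt (ShortP 2) u ** root_elt (ShortP 1) t)"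
  using root_elt_comm[OF char3, of "ShortP 1" "ShortP 2" t u "mat 1"] by (simp add: coord_def mod3_simps)

text \<open>Of the four factors in the commutator of \<open>root_elt (LongN 0) s\<close> with
  \<open>root_elt (ShortP 1) 1\<close>, only the one at \<open>ShortP 2\<close>, with parameter
  \<open>s\<close>, fails to commute with \<open>root_elt (ShortP 1) 1\<close>. The second
  commutator is thus \<open>root_elt (ShortN 0) s\<close>. Both commutators \<open>u\<close> and
  \<open>z\<close> are given by equations without inverses, the form in which the formulas state
  them.\<close>

lemma coord_double:
  assumes "u ** (root_elt (ShortP 1) 1 ** root_elt (LongN 0) s) = root_elt (LongN 0) s ** root_elt (ShortP 1) 1"
    and "u ** root_elt (ShortP 1) 1 = z ** (root_elt (ShortP 1) 1 ** u)" and "u \<in> root_span k UNIV" "s \<in> k"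
  shows "z = coord (- s)"
proof -
  define v where "v = word (comm (LongN 0) (ShortP 1) s 1) (mat 1)"
  have sp: "root_elt (ShortP 1) 1 \<in> root_span k UNIV" "root_elt (LongN 0) s \<in> root_span k UNIV"
    using assms(4) by (auto intro!: root_elt_in_root_span)
  have v: "v ** A = root_elt (ShortP 2) s ** (root_elt (ShortN 0) s ** (root_elt (LongN 2) s ** (root_elt (LongP 1) (- s\<^sup>2) ** A)))" for A
    by (simp add: v_def word_mult mod3_simps matrix_mul_assoc[symmetric])
  have "root_elt (LongN 0) s ** root_elt (ShortP 1) 1 = v ** (root_elt (ShortP 1) 1 ** root_elt (LongN 0) s)"
    using root_elt_comm[OF char3, of "LongN 0" "ShortP 1" s 1 "mat 1"] unfolding v by (simp add: mod3_simps)
  then have "u ** (root_elt (ShortP 1) 1 ** root_elt (LongN 0) s) = v ** (root_elt (ShortP 1) 1 ** root_elt (LongN 0) s)"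
    by (simp only: assms(1))
  then have uv: "u = v" by (rule root_span_cancel[OF root_span_mult[OF sp]])
  have c: "root_elt (ShortN 0) s ** (root_elt (ShortP 1) 1 ** A) = root_elt (ShortP 1) 1 ** (root_elt (ShortN 0) s ** A)"
    "root_elt (LongN 2) s ** (root_elt (ShortP 1) 1 ** A) = root_elt (ShortP 1) 1 ** (root_elt (LongN 2) s ** A)"
    "root_elt (LongP 1) (- s\<^sup>2) ** (root_elt (ShortP 1) 1 ** A) = root_elt (ShortP 1) 1 ** (root_elt (LongP 1) (- s\<^sup>2) ** A)"
    "root_elt (ShortP 2) s ** (root_elt (ShortP 1) 1 ** A) =
      root_elt (ShortN 0) s ** (root_elt (ShortP 1) 1 ** (root_elt (ShortP 2) s ** A))" for A :: "'a g2_matrix"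
    using root_elt_comm[OF char3, of "ShortN 0" "ShortP 1" s 1 A] root_elt_comm[OF char3, of "LongN 2" "ShortP 1" s 1 A]
      root_elt_comm[OF char3, of "LongP 1" "ShortP 1" "- s\<^sup>2" 1 A] root_elt_comm[OF char3, of "ShortP 2" "ShortP 1" s 1 A]
    by (simp_all add: mod3_simps)
  have "v ** (root_elt (ShortP 1) 1 ** A) = root_elt (ShortN 0) s ** (root_elt (ShortP 1) 1 ** (v ** A))"
    for A :: "'a g2_matrix"
    by (simp only: v c)
  from this[of "mat 1"] have "v ** root_elt (ShortP 1) 1 = root_elt (ShortN 0) s ** (root_elt (ShortP 1) 1 ** v)"
    by simp
  then have "z ** (root_elt (ShortP 1) 1 ** u) = root_elt (ShortN 0) s ** (root_elt (ShortP 1) 1 ** u)"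
    using assms(2) uv by simp
  then show ?thesis using root_span_cancel[OF root_span_mult[OF sp(1) assms(3)]] by (simp add: coord_def)
qed

end

instance group_fun :: countable by countable_datatype
instance ring_fun :: countable by countable_datatype
instance pair_rel :: countable by countable_datatype

subsection \<open>The group inside the pair of fields\<close>

fun weight_code :: "g2_weight \<Rightarrow> nat" where
  "weight_code Wt0 = 0"
| "weight_code (WtP i) = (if i = 0 then 1 else if i = 1 then 2 else 3)"
| "weight_code (WtN i) = (if i = 0 then 4 else if i = 1 then 5 else 6)"

definition weight_of :: "nat \<Rightarrow> g2_weight" where
  "weight_of l = [Wt0, WtP 0, WtP 1, WtP 2, WtN 0, WtN 1, WtN 2] ! l"

lemma weight_of_code [simp]: "weight_of (weight_code w) = w"
proof -
  have "\<forall>w. weight_of (weight_code w) = w"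
    unfolding all_g2_weight by (simp add: weight_of_def mod3_simps eval_nat_numeral)
  then show ?thesis by blast
qed

lemma weight_code_less [simp]: "weight_code w < 7"
  by (cases w) auto

lemma weight_code_pair_less: "7 * weight_code r + weight_code s < 49"
  using weight_code_less[of r] weight_code_less[of s] by linarith

lemma weight_code_of [simp]: "l < 7 \<Longrightarrow> weight_code (weight_of l) = l"
  unfolding weight_of_def by (simp add: eval_nat_numeral less_Suc_eq) (auto simp: mod3_simps)

definition enc_matrix :: "'a g2_matrix \<Rightarrow> 'a list" where
  "enc_matrix A = map (\<lambda>l. A $ weight_of (l div 7) $ weight_of (l mod 7)) [0..<49]"

text \<open>The matrix stored row by row in the variables \<open>49 * j\<close> to
  \<open>49 * j + 48\<close>, which form block \<open>j\<close> for dimension 49 and no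
  parameters.\<close>

definition env_matrix :: "(nat \<Rightarrow> 'a) \<Rightarrow> nat \<Rightarrow> 'a g2_matrix" where
  "env_matrix e j = (\<chi> r s. e (49 * j + (7 * weight_code r + weight_code s)))"

lemma block_enc_matrix: "block 0 49 e j = enc_matrix A \<longleftrightarrow> env_matrix e j = A"
proof
  assume *: "block 0 49 e j = enc_matrix A"
  have "e (49 * j + (7 * weight_code r + weight_code s)) = A $ r $ s" for r s
  proof -
    let ?l = "7 * weight_code r + weight_code s"
    note l = weight_code_pair_less[of r s]
    have "?l div 7 = weight_code r" "?l mod 7 = weight_code s" using weight_code_less[of s] by simp_all
    then show ?thesis using arg_cong[OF *, of "\<lambda>xs. xs ! ?l"] l by (simp add: block_def enc_matrix_def)
  qed
  then show "env_matrix e j = A" by (simp add: env_matrix_def vec_eq_iff)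
next
  assume *: "env_matrix e j = A"
  have "e (49 * j + l) = A $ weight_of (l div 7) $ weight_of (l mod 7)" if "l < 49" for l
  proof -
    have "l div 7 < 7" using that by auto
    then have "7 * weight_code (weight_of (l div 7)) + weight_code (weight_of (l mod 7)) = l" by simp
    then show ?thesis using * by (auto simp: env_matrix_def)
  qed
  then show "block 0 49 e j = enc_matrix A" by (simp add: block_def enc_matrix_def)
qed

context
  fixes k :: "'a::field set"
begin

abbreviation "KK \<equiv> field_pair k"

text \<open>Functions and relations on environments given by terms and formulas of the pair; closure
  properties take the place of explicit formulas.\<close>

definition definable_fun :: "((nat \<Rightarrow> 'a) \<Rightarrow> 'a) \<Rightarrow> bool" where
  "definable_fun F \<longleftrightarrow> (\<exists>t. wf_trm field_pair_language t \<and> (\<forall>e. val KK e t = F e))"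

definition definable :: "((nat \<Rightarrow> 'a) \<Rightarrow> bool) \<Rightarrow> bool" where
  "definable P \<longleftrightarrow> (\<exists>\<phi>. wf_form field_pair_language \<phi> \<and> (\<forall>e. sat KK e \<phi> \<longleftrightarrow> P e))"

lemma definable_fun_var: "definable_fun (\<lambda>e. e i)"
  unfolding definable_fun_def by (rule exI[of _ "Var i"]) simp

lemma definable_fun_const: "definable_fun (\<lambda>_. 0)" "definable_fun (\<lambda>_. 1)"
  unfolding definable_fun_def
  by (rule exI[of _ "App RZero []"], simp add: field_pair_language_def field_pair_def,
      rule exI[of _ "App ROne []"], simp add: field_pair_language_def field_pair_def)

lemma definable_fun_uminus: "definable_fun F \<Longrightarrow> definable_fun (\<lambda>e. - F e)"
  unfolding definable_fun_def
proof (elim exE conjE)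
  fix t assume "wf_trm field_pair_language t" "\<forall>e. val KK e t = F e"
  then show "\<exists>t. wf_trm field_pair_language t \<and> (\<forall>e. val KK e t = - F e)"
    by (intro exI[of _ "App RUminus [t]"]) (simp add: field_pair_language_def, simp add: field_pair_def)
qed

lemma definable_fun_add:
  assumes "definable_fun F" "definable_fun G"
  shows "definable_fun (\<lambda>e. F e + G e)"
proof -
  obtain s t where "wf_trm field_pair_language s" "\<forall>e. val KK e s = F e" "wf_trm field_pair_language t" "\<forall>e. val KK e t = G e"
    using assms unfolding definable_fun_def by blast
  then show ?thesis unfolding definable_fun_def
    by (intro exI[of _ "App RPlus [s, t]"]) (simp add: field_pair_language_def, simp add: field_pair_def)
qed

lemma definable_fun_mult:
  assumes "definable_fun F" "definable_fun G"
  shows "definable_fun (\<lambda>e. F e * G e)"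
proof -
  obtain s t where "wf_trm field_pair_language s" "\<forall>e. val KK e s = F e" "wf_trm field_pair_language t" "\<forall>e. val KK e t = G e"
    using assms unfolding definable_fun_def by blast
  then show ?thesis unfolding definable_fun_def
    by (intro exI[of _ "App RTimes [s, t]"]) (simp add: field_pair_language_def, simp add: field_pair_def)
qed

lemma definable_fun_if: "definable_fun F \<Longrightarrow> definable_fun G \<Longrightarrow> definable_fun (\<lambda>e. if b then F e else G e)"
  by (cases b) simp_all

lemma definable_fun_two: "definable_fun (\<lambda>_. 2)"
  using definable_fun_add[OF definable_fun_const(2) definable_fun_const(2)] by simp

lemmas definable_fun_intros = definable_fun_var definable_fun_const definable_fun_two definable_fun_uminus
  definable_fun_add definable_fun_mult definable_fun_if

lemma definable_eq:
  assumes "definable_fun F" "definable_fun G"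
  shows "definable (\<lambda>e. F e = G e)"
proof -
  obtain s t where "wf_trm field_pair_language s" "\<forall>e. val KK e s = F e" "wf_trm field_pair_language t" "\<forall>e. val KK e t = G e"
    using assms unfolding definable_fun_def by blast
  then show ?thesis unfolding definable_def by (intro exI[of _ "Eq s t"]) simp
qed

lemma definable_subfield:
  assumes "definable_fun F"
  shows "definable (\<lambda>e. F e \<in> k)"
proof -
  obtain s where "wf_trm field_pair_language s" "\<forall>e. val KK e s = F e" using assms unfolding definable_fun_def by blast
  then show ?thesis unfolding definable_def
    by (intro exI[of _ "Atom InSubfield [s]"]) (simp add: field_pair_language_def, simp add: field_pair_def)
qed

lemma definable_conj: "definable P \<Longrightarrow> definable Q \<Longrightarrow> definable (\<lambda>e. P e \<and> Q e)"
  unfolding definable_def by (elim exE conjE, rule_tac x = "And \<phi> \<phi>'" in exI) simp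

lemma definable_True: "definable (\<lambda>_. True)"
  using definable_eq[OF definable_fun_var definable_fun_var, of 0 0] by simp

lemma definable_ball:
  assumes "finite I" "\<And>i. i \<in> I \<Longrightarrow> definable (P i)"
  shows "definable (\<lambda>e. \<forall>i \<in> I. P i e)"
  using assms by (induction I rule: finite_induct) (simp_all add: definable_True definable_conj)

lemma definable_ex:
  assumes "definable P" "finite V"
  shows "definable (\<lambda>e. \<exists>e'. (\<forall>i. i \<notin> V \<longrightarrow> e' i = e i) \<and> P e')"
proof -
  obtain \<phi> where "wf_form field_pair_language \<phi>" "\<forall>e. sat KK e \<phi> \<longleftrightarrow> P e" using assms(1) unfolding definable_def by blast
  moreover have "dom KK = UNIV" by (simp add: field_pair_def)
  ultimately show ?thesis unfolding definable_def
    by (intro exI[of _ "exs V \<phi>"]) (simp add: sat_exs[OF assms(2)])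
qed

lemma definable_rename: "definable P \<Longrightarrow> definable (\<lambda>e. P (\<lambda>i. e (f i)))"
  unfolding definable_def by (elim exE conjE, rule_tac x = "ren \<phi> f" in exI) (simp add: sat_ren comp_def)

lemma definable_matrix_eq:
  assumes "\<And>r s. definable_fun (\<lambda>e. F e r s)" "\<And>r s. definable_fun (\<lambda>e. G e r s)"
  shows "definable (\<lambda>e. \<forall>r s. F e r s = G e (r :: g2_weight) (s :: g2_weight))"
proof -
  have "definable (\<lambda>e. \<forall>r \<in> UNIV. \<forall>s \<in> UNIV. F e r s = G e r s)"
    by (intro definable_ball definable_eq assms) simp_all
  then show ?thesis by simp
qed

lemma definable_fun_env_matrix: "definable_fun (\<lambda>e. env_matrix e j $ r $ s)"
  by (simp add: env_matrix_def definable_fun_var)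

lemma definable_fun_row_op:
  assumes "definable_fun T" "\<And>q. definable_fun (\<lambda>e. V e q)"
  shows "definable_fun (\<lambda>e. row_op \<alpha> (T e) (V e) r)"
  by (cases \<alpha>; cases r; simp only: row_op.simps power2_eq_square;
      intro definable_fun_intros assms)

lemma definable_fun_matrix_mult:
  "definable_fun (\<lambda>e. (env_matrix e i ** env_matrix e j) $ r $ s)"
  unfolding matrix_matrix_mult_def
  by (simp add: sum_g2_weight) (intro definable_fun_intros definable_fun_env_matrix)

text \<open>Each factor costs one quantified parameter and one quantified intermediate matrix, so a
  list of fixed length yields a formula.\<close>

lemma definable_prod_set: "definable (\<lambda>e. env_matrix e 0 \<in> prod_set k \<alpha>s)"
proof (induction \<alpha>s)
  case Nil
  have "definable (\<lambda>e. \<forall>r s. env_matrix e 0 $ r $ s = (if r = s then 1 else 0))"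
    by (intro definable_matrix_eq definable_fun_env_matrix definable_fun_intros)
  then show ?case by (simp add: vec_eq_iff mat_def)
next
  case (Cons \<alpha> \<alpha>s)
  \<comment> \<open>Variables 49 to 97 hold the remaining product \<open>env_matrix e 1\<close>,
    variable 98 the parameter of the first factor.\<close>
  have P: "definable (\<lambda>e. e 98 \<in> params k \<alpha>)"
    by (cases \<alpha>) (simp_all add: definable_True definable_subfield definable_fun_var)
  have 1: "definable (\<lambda>e. env_matrix e 1 \<in> prod_set k \<alpha>s)"
  proof -
    have "env_matrix (\<lambda>i. e (i + 49)) 0 = env_matrix e 1" for e :: "nat \<Rightarrow> 'a"
      by (simp add: env_matrix_def algebra_simps)
    then show ?thesis using definable_rename[OF Cons.IH, of "\<lambda>i. i + 49"] by simp
  qed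
  have 2: "definable (\<lambda>e. \<forall>r s. env_matrix e 0 $ r $ s = row_op \<alpha> (e 98) (\<lambda>q. env_matrix e 1 $ q $ s) r)"
    by (intro definable_matrix_eq definable_fun_env_matrix definable_fun_row_op definable_fun_var)
  let ?Q = "\<lambda>e. e 98 \<in> params k \<alpha> \<and> env_matrix e 1 \<in> prod_set k \<alpha>s \<and>
      (\<forall>r s. env_matrix e 0 $ r $ s = row_op \<alpha> (e 98) (\<lambda>q. env_matrix e 1 $ q $ s) r)"
  have "definable (\<lambda>e. \<exists>e'. (\<forall>i. i \<notin> {49..<99} \<longrightarrow> e' i = e i) \<and> ?Q e')"
    by (intro definable_ex definable_conj P 1 2) simp
  moreover have "(\<exists>e'. (\<forall>i. i \<notin> {49..<99} \<longrightarrow> e' i = e i) \<and> ?Q e') \<longleftrightarrow> env_matrix e 0 \<in> prod_set k (\<alpha> # \<alpha>s)" for e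
  proof
    assume "\<exists>e'. (\<forall>i. i \<notin> {49..<99} \<longrightarrow> e' i = e i) \<and> ?Q e'"
    then obtain e' where e': "\<forall>i. i \<notin> {49..<99} \<longrightarrow> e' i = e i" "?Q e'" by blast
    have "\<not> 49 \<le> 7 * weight_code r + weight_code s" for r s
      using weight_code_pair_less[of r s] by linarith
    then have "env_matrix e' 0 = env_matrix e 0" using e'(1) by (simp add: env_matrix_def)
    moreover have "env_matrix e' 0 = root_elt \<alpha> (e' 98) ** env_matrix e' 1"
      using e'(2) by (simp add: vec_eq_iff root_elt_mult)
    moreover have "root_elt \<alpha> (e' 98) ** env_matrix e' 1 \<in> prod_set k (\<alpha> # \<alpha>s)"
      using e'(2) unfolding prod_set_simps by (intro smulI) (auto simp: root_grp_def)
    ultimately show "env_matrix e 0 \<in> prod_set k (\<alpha> # \<alpha>s)" by simp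
  next
    assume "env_matrix e 0 \<in> prod_set k (\<alpha> # \<alpha>s)"
    then obtain t A where tA: "t \<in> params k \<alpha>" "A \<in> prod_set k \<alpha>s" "env_matrix e 0 = root_elt \<alpha> t ** A"
      by (auto simp: root_grp_def smul_def)
    define e' where "e' i = (if i = 98 then t else if 49 \<le> i \<and> i < 98
      then A $ weight_of ((i - 49) div 7) $ weight_of ((i - 49) mod 7) else e i)" for i
    have l: "\<not> 49 \<le> 7 * weight_code r + weight_code s" "7 * weight_code r + weight_code s \<noteq> 98"
      "49 + (7 * weight_code r + weight_code s) \<noteq> 98" "49 + (7 * weight_code r + weight_code s) < 98" for r s
      using weight_code_pair_less[of r s] by linarith+
    have "env_matrix e' 0 = env_matrix e 0" using l by (simp add: env_matrix_def e'_def)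
    moreover have "env_matrix e' 1 = A" using l by (simp add: env_matrix_def e'_def vec_eq_iff)
    moreover have "e' 98 = t" by (simp add: e'_def)
    ultimately have "?Q e'" using tA by (simp add: root_elt_mult)
    moreover have "\<forall>i. i \<notin> {49..<99} \<longrightarrow> e' i = e i" by (auto simp: e'_def)
    ultimately show "\<exists>e'. (\<forall>i. i \<notin> {49..<99} \<longrightarrow> e' i = e i) \<and> ?Q e'" by blast
  qed
  ultimately show ?case by simp
qed

end

lemma is_struct_field_pair: "is_struct field_pair_language (field_pair k)"
  by (simp add: is_struct_def field_pair_def)

context
  fixes k :: "'a::field set"
  assumes char3: "CHAR('a) = 3" and k: "is_subfield k" and cubes: "\<forall>x. x ^ 3 \<in> k"
begin

lemma group_struct_simps [simp]:
  "dom (group_struct (mixed_G2 k)) = root_span k UNIV"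
  "fn (group_struct (mixed_G2 k)) GMult as = as ! 0 ** as ! 1"
  "fn (group_struct (mixed_G2 k)) GOne as = mat 1"
  by (simp_all add: group_struct_def carrier_mixed_G2[OF char3 k cubes] mult_one_mixed_G2[OF char3 k cubes])

lemma group_struct_inv:
  assumes "as ! 0 \<in> root_span k UNIV"
  shows "fn (group_struct (mixed_G2 k)) GInv as \<in> root_span k UNIV"
    and "a \<in> root_span k UNIV \<Longrightarrow> fn (group_struct (mixed_G2 k)) GInv as = a \<longleftrightarrow> as ! 0 ** a = mat 1"
proof -
  interpret group "mixed_G2 k" by (rule group_mixed_G2[OF char3 k cubes])
  note c = carrier_mixed_G2[OF char3 k cubes] and m = mult_one_mixed_G2[OF char3 k cubes]
  show "fn (group_struct (mixed_G2 k)) GInv as \<in> root_span k UNIV"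
    using inv_closed[of "as ! 0"] assms by (simp add: group_struct_def c)
  show "fn (group_struct (mixed_G2 k)) GInv as = a \<longleftrightarrow> as ! 0 ** a = mat 1" if "a \<in> root_span k UNIV"
    using assms that r_inv[of "as ! 0"] inv_equality[of a "as ! 0"] inv_comm[of "as ! 0" a]
    by (auto simp: group_struct_def c m)
qed

lemma is_struct_group: "is_struct group_language (group_struct (mixed_G2 k))"
  unfolding is_struct_def
proof (intro conjI)
  show "dom (group_struct (mixed_G2 k)) \<noteq> {}" using one_in_root_span[of k UNIV] by auto
  show "\<forall>(f, n) \<in> funs group_language. \<forall>as. length as = n \<and> set as \<subseteq> dom (group_struct (mixed_G2 k)) \<longrightarrow>
      fn (group_struct (mixed_G2 k)) f as \<in> dom (group_struct (mixed_G2 k))"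
    by (auto simp: group_language_def one_in_root_span subset_iff intro!: root_span_mult group_struct_inv(1))
qed

text \<open>A matrix is coded by its 49 entries. The domain formula is the one for
  \<open>tavgen_list\<close>, and the operations are polynomial in the entries.\<close>

theorem group_interpretable_in_pair:
  "interpretable group_language (group_struct (mixed_G2 k)) field_pair_language (field_pair k) enc_matrix 49 []"
proof
  let ?G = "group_struct (mixed_G2 k)"
  show "is_struct group_language ?G" by (rule is_struct_group)
  show "is_struct field_pair_language (field_pair k)" by (rule is_struct_field_pair)
  show "set [] \<subseteq> dom (field_pair k)" by simp
  show "enc_matrix a \<in> tuples (field_pair k) 49" for a by (simp add: tuples_def enc_matrix_def field_pair_def)
  show "inj_on enc_matrix (dom ?G)"
  proof (rule inj_onI)
    fix A B :: "'a g2_matrix" assume AB: "enc_matrix A = enc_matrix B"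
    define e where "e l = A $ weight_of (l div 7) $ weight_of (l mod 7)" for l
    have "block 0 49 e 0 = enc_matrix A" by (simp add: block_def enc_matrix_def e_def)
    then have "env_matrix e 0 = A" "env_matrix e 0 = B" using AB block_enc_matrix by metis+
    then show "A = B" by simp
  qed
  show "\<exists>\<delta>. wf_form field_pair_language \<delta> \<and>
      (\<forall>e \<in> envs (field_pair k) []. sat (field_pair k) e \<delta> \<longleftrightarrow> block (length []) 49 e 0 \<in> enc_matrix ` dom ?G)"
  proof -
    obtain \<delta> where "wf_form field_pair_language \<delta>"
      "\<forall>e. sat (field_pair k) e \<delta> \<longleftrightarrow> env_matrix e 0 \<in> prod_set k tavgen_list"
      using definable_prod_set unfolding definable_def by blast
    moreover have "block 0 49 e 0 \<in> enc_matrix ` dom ?G \<longleftrightarrow> env_matrix e 0 \<in> prod_set k tavgen_list" for e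
      using block_enc_matrix by (auto simp: root_span_UNIV[OF char3 k cubes, symmetric] image_iff)
    ultimately show ?thesis by (intro exI[of _ \<delta>]) simp
  qed
  show "\<exists>\<psi>. wf_form field_pair_language \<psi> \<and>
      (\<forall>e \<in> envs (field_pair k) []. \<forall>as a. length as = n \<longrightarrow> set as \<subseteq> dom ?G \<longrightarrow> a \<in> dom ?G \<longrightarrow>
         (\<forall>i < n. block (length []) 49 e i = enc_matrix (as ! i)) \<longrightarrow> block (length []) 49 e n = enc_matrix a \<longrightarrow>
         (sat (field_pair k) e \<psi> \<longleftrightarrow> fn ?G f as = a))"
    if f: "(f, n) \<in> funs group_language" for f n
  proof -
    obtain P where P: "definable k P" and eq: "\<And>e as a. length as = n \<Longrightarrow> set as \<subseteq> root_span k UNIV \<Longrightarrow> a \<in> root_span k UNIV \<Longrightarrow>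
      (\<And>i. i < n \<Longrightarrow> env_matrix e i = as ! i) \<Longrightarrow> env_matrix e n = a \<Longrightarrow> P e \<longleftrightarrow> fn ?G f as = a"
    proof -
      \<comment> \<open>The graphs of the three operations; the inverse is characterized by a
        product equal to the identity.\<close>
      have "definable k (\<lambda>e. \<forall>r s. (env_matrix e 0 ** env_matrix e 1) $ r $ s = env_matrix e 2 $ r $ s)"
        "definable k (\<lambda>e. \<forall>r s. (env_matrix e 0 ** env_matrix e 1) $ r $ s = (if r = s then 1 else 0))"
        "definable k (\<lambda>e. \<forall>r s. (if r = s then 1 else 0) = env_matrix e 0 $ r $ s)"
        by (intro definable_matrix_eq definable_fun_matrix_mult definable_fun_env_matrix definable_fun_intros)+
      then have 1: "definable k (\<lambda>e. env_matrix e 0 ** env_matrix e 1 = env_matrix e 2)"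
        and 2: "definable k (\<lambda>e. env_matrix e 0 ** env_matrix e 1 = mat 1)"
        and 3: "definable k (\<lambda>e. mat 1 = env_matrix e 0)"
        by (simp_all add: vec_eq_iff mat_def)
      consider "f = GMult" "n = 2" | "f = GInv" "n = 1" | "f = GOne" "n = 0"
        using f by (auto simp: group_language_def)
      then show ?thesis
      proof cases
        case 1
        then show ?thesis by (intro that[OF \<open>definable k (\<lambda>e. env_matrix e 0 ** env_matrix e 1 = env_matrix e 2)\<close>]) auto
      next
        case 2
        have "env_matrix e 0 ** env_matrix e 1 = mat 1 \<longleftrightarrow> fn ?G f as = a"
          if "length as = n" "set as \<subseteq> root_span k UNIV" "a \<in> root_span k UNIV"
            "\<And>i. i < n \<Longrightarrow> env_matrix e i = as ! i" "env_matrix e n = a" for e as a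
        proof -
          have "as ! 0 \<in> root_span k UNIV" using that(1,2) 2 by auto
          then show ?thesis using group_struct_inv(2)[OF _ that(3)] that(4)[of 0] that(5) 2 by simp
        qed
        then show ?thesis by (rule that[OF \<open>definable k (\<lambda>e. env_matrix e 0 ** env_matrix e 1 = mat 1)\<close>])
      next
        case 3
        then show ?thesis by (intro that[OF \<open>definable k (\<lambda>e. mat 1 = env_matrix e 0)\<close>]) auto
      qed
    qed
    obtain \<psi> where \<psi>: "wf_form field_pair_language \<psi>" "\<forall>e. sat (field_pair k) e \<psi> \<longleftrightarrow> P e"
      using P unfolding definable_def by blast
    show ?thesis
      by (rule exI[of _ \<psi>]) (use \<psi> eq in \<open>simp add: block_enc_matrix\<close>)
  qed
qed (simp add: group_language_def)

end

subsection \<open>The pair of fields inside the group\<close>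

lemma mat_mult_cancel: "a \<noteq> 0 \<Longrightarrow> mat a ** A = mat a ** (B :: 'a::field ^ 'n ^ 'n::finite) \<Longrightarrow> A = B"
  by (simp add: mat_mult vec_eq_iff)

lemma mult_mat_left: "(A :: 'a::field ^ 'n ^ 'n::finite) ** (mat a ** B) = mat a ** (A ** B)"
  by (metis mult_mat matrix_mul_assoc)

definition param_roots :: "g2_root list" where
  "param_roots = [ShortP 0, ShortP 1, ShortP 2, ShortN 0, ShortN 1, ShortN 2,
     LongP 0, LongP 1, LongP 2, LongN 0, LongN 1, LongN 2]"

text \<open>The parameters of the interpretation, held by the variables 0 to 11. Variables 1 and 2
  carry the elements used in commutators, and variable 3 is \<open>coord (- 1)\<close>.\<close>

definition frame :: "'a::field g2_matrix list" where
  "frame = map (\<lambda>\<delta>. root_elt \<delta> 1) param_roots"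

lemma length_frame [simp]: "length frame = 12"
  by (simp add: frame_def param_roots_def)

abbreviation gmult :: "group_fun trm \<Rightarrow> group_fun trm \<Rightarrow> group_fun trm" where
  "gmult s t \<equiv> App GMult [s, t]"

definition centralizes :: "nat list \<Rightarrow> nat \<Rightarrow> (group_fun, unit) form" where
  "centralizes is v = Conj (map (\<lambda>i. Eq (gmult (Var i) (Var v)) (gmult (Var v) (Var i))) is)"

lemma wf_gmult: "wf_trm group_language (gmult s t) \<longleftrightarrow> wf_trm group_language s \<and> wf_trm group_language t"
  by (auto simp: group_language_def)

lemma wf_gone: "wf_trm group_language (App GOne [])"
  by (simp add: group_language_def)

lemma wf_centralizes: "wf_form group_language (centralizes is v)"
  by (auto simp: centralizes_def wf_gmult simp del: wf_trm.simps(2))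

text \<open>The positions in \<open>param_roots\<close> of the roots whose root subgroups commute with that of \<open>\<epsilon>\<^sub>1\<close>,
  \<open>\<epsilon>\<^sub>2\<close> and \<open>\<epsilon>\<^sub>2 - \<epsilon>\<^sub>1\<close>, respectively.\<close>

definition "centr_1 = [1, 5, 3, 7, 10, 6, 11 :: nat]"
definition "centr_2 = [2, 3, 4, 8, 11, 7, 9 :: nat]"
definition "centr_long = [0, 2, 3, 4, 7, 8, 9 :: nat]"

context
  fixes k :: "'a::field set"
  assumes char3: "CHAR('a) = 3" and k: "is_subfield k" and cubes: "\<forall>x. x ^ 3 \<in> k"
begin

abbreviation "GG \<equiv> group_struct (mixed_G2 k)"
abbreviation "G \<equiv> root_span k UNIV"

lemma val_gmult [simp]: "val GG e (gmult s t) = val GG e s ** val GG e t"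
  by (simp add: group_struct_simps[OF char3 k cubes])

lemma val_gone [simp]: "val GG e (App GOne []) = mat 1"
  by (simp add: group_struct_simps[OF char3 k cubes])

lemma dom_GG [simp]: "dom GG = G"
  by (simp add: group_struct_simps[OF char3 k cubes])

lemma sat_centralizes: "sat GG e (centralizes is v) \<longleftrightarrow> (\<forall>i \<in> set is. e i ** e v = e v ** e i)"
  by (simp add: centralizes_def del: val.simps(2))

lemma frame_entries:
  assumes "e \<in> envs GG frame"
  shows "e 0 = root_elt (ShortP 0) 1" "e 1 = root_elt (ShortP 1) 1" "e 2 = root_elt (ShortP 2) 1"
    "e 3 = root_elt (ShortN 0) 1" "e 4 = root_elt (ShortN 1) 1" "e 5 = root_elt (ShortN 2) 1"
    "e 6 = root_elt (LongP 0) 1" "e 7 = root_elt (LongP 1) 1" "e 8 = root_elt (LongP 2) 1"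
    "e 9 = root_elt (LongN 0) 1" "e 10 = root_elt (LongN 1) 1" "e 11 = root_elt (LongN 2) 1"
    "e (Suc 0) = root_elt (ShortP 1) 1"
  using assms by (simp_all add: envs_def frame_def param_roots_def)

lemma centr_1:
  assumes "e \<in> envs GG frame" "y \<in> G"
  shows "(\<forall>i \<in> set centr_1. e i ** y = y ** e i) \<longleftrightarrow> (\<exists>a t. a \<noteq> 0 \<and> y = mat a ** root_elt (ShortP 1) t)"
proof
  assume "\<forall>i \<in> set centr_1. e i ** y = y ** e i"
  then show "\<exists>a t. a \<noteq> 0 \<and> y = mat a ** root_elt (ShortP 1) t"
    by (intro centralizer_short_span[OF char3 k cubes assms(2)])
      (auto simp: centr_1_def frame_entries[OF assms(1)] mod3_simps)
next
  assume "\<exists>a t. a \<noteq> 0 \<and> y = mat a ** root_elt (ShortP 1) t"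
  then obtain a t where y: "y = mat a ** root_elt (ShortP 1) t" by blast
  have "root_elt \<delta> 1 ** y = y ** root_elt \<delta> 1"
    if "\<delta> \<in> {ShortP 1, ShortN (1 + 1), ShortN (1 + 2), LongP 1, LongN 1, LongP (1 + 2), LongN (1 + 1)}" for \<delta>
    using centralizer_shortI[OF char3 k cubes that, of t] by (simp add: y mult_mat_left matrix_mul_assoc[symmetric])
  then show "\<forall>i \<in> set centr_1. e i ** y = y ** e i"
    by (simp add: centr_1_def frame_entries[OF assms(1)] mod3_simps)
qed

lemma centr_2:
  assumes "e \<in> envs GG frame" "y \<in> G"
  shows "(\<forall>i \<in> set centr_2. e i ** y = y ** e i) \<longleftrightarrow> (\<exists>a t. a \<noteq> 0 \<and> y = mat a ** root_elt (ShortP 2) t)"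
proof
  assume "\<forall>i \<in> set centr_2. e i ** y = y ** e i"
  then show "\<exists>a t. a \<noteq> 0 \<and> y = mat a ** root_elt (ShortP 2) t"
    by (intro centralizer_short_span[OF char3 k cubes assms(2)])
      (auto simp: centr_2_def frame_entries[OF assms(1)] mod3_simps)
next
  assume "\<exists>a t. a \<noteq> 0 \<and> y = mat a ** root_elt (ShortP 2) t"
  then obtain a t where y: "y = mat a ** root_elt (ShortP 2) t" by blast
  have "root_elt \<delta> 1 ** y = y ** root_elt \<delta> 1"
    if "\<delta> \<in> {ShortP 2, ShortN (2 + 1), ShortN (2 + 2), LongP 2, LongN 2, LongP (2 + 2), LongN (2 + 1)}" for \<delta>
    using centralizer_shortI[OF char3 k cubes that, of t] by (simp add: y mult_mat_left matrix_mul_assoc[symmetric])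
  then show "\<forall>i \<in> set centr_2. e i ** y = y ** e i"
    by (simp add: centr_2_def frame_entries[OF assms(1)] mod3_simps)
qed

lemma centr_long:
  assumes "e \<in> envs GG frame" "y \<in> G"
  shows "(\<forall>i \<in> set centr_long. e i ** y = y ** e i) \<longleftrightarrow> (\<exists>a t. a \<noteq> 0 \<and> t \<in> k \<and> y = mat a ** root_elt (LongN 0) t)"
proof
  assume "\<forall>i \<in> set centr_long. e i ** y = y ** e i"
  then show "\<exists>a t. a \<noteq> 0 \<and> t \<in> k \<and> y = mat a ** root_elt (LongN 0) t"
    by (intro centralizer_long_span[OF char3 k cubes assms(2)])
      (auto simp: centr_long_def frame_entries[OF assms(1)] mod3_simps)
next
  assume "\<exists>a t. a \<noteq> 0 \<and> t \<in> k \<and> y = mat a ** root_elt (LongN 0) t"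
  then obtain a t where y: "y = mat a ** root_elt (LongN 0) t" by blast
  have "root_elt \<delta> 1 ** y = y ** root_elt \<delta> 1"
    if "\<delta> \<in> {ShortP 0, ShortP 2, ShortN 0, ShortN 1, LongP 1, LongP 2, LongN 0}" for \<delta>
    using centralizer_longI[OF char3 k cubes that, of t] by (simp add: y mult_mat_left matrix_mul_assoc[symmetric])
  then show "\<forall>i \<in> set centr_long. e i ** y = y ** e i"
    by (simp add: centr_long_def frame_entries[OF assms(1)] mod3_simps)
qed

lemma short_in_G: "root_elt (ShortP i) t \<in> G" "root_elt (ShortN i) t \<in> G" "coord t \<in> G"
  by (auto simp: coord_def intro!: root_elt_in_root_span)

text \<open>The scalar in \<open>y\<close> stands on both sides and cancels, so the commutator of
  \<open>y\<close> with \<open>root_elt (ShortP 2) 1\<close> depends on \<open>t\<close>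
  only.\<close>

lemma coord_1_iff:
  assumes "z \<in> G" "y = mat a ** root_elt (ShortP 1) t" "a \<noteq> 0" "y \<in> G"
  shows "y ** root_elt (ShortP 2) 1 = z ** (root_elt (ShortP 2) 1 ** y) \<longleftrightarrow> z = coord t"
proof -
  have "y ** root_elt (ShortP 2) 1 = coord t ** (root_elt (ShortP 2) 1 ** y)"
    using coord_mult[OF char3 k cubes, of t 1] by (simp add: assms(2) mult_mat_left matrix_mul_assoc[symmetric])
  then show ?thesis using root_span_cancel[OF char3 k cubes root_span_mult[OF short_in_G(1) assms(4)]] by metis
qed

lemma coord_2_iff:
  assumes "z \<in> G" "y = mat a ** root_elt (ShortP 2) t" "a \<noteq> 0" "y \<in> G"
  shows "root_elt (ShortP 1) 1 ** y = z ** (y ** root_elt (ShortP 1) 1) \<longleftrightarrow> z = coord t"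
proof -
  have "root_elt (ShortP 1) 1 ** y = coord t ** (y ** root_elt (ShortP 1) 1)"
    using coord_mult[OF char3 k cubes, of 1 t] by (simp add: assms(2) mult_mat_left matrix_mul_assoc[symmetric])
  then show ?thesis using root_span_cancel[OF char3 k cubes root_span_mult[OF assms(4) short_in_G(1)]] by metis
qed

text \<open>Links a parameter in the root subgroup of \<open>ShortP 1\<close>, known there up to
  scalars, with \<open>coord\<close>: \<open>z\<close> is the commutator of \<open>y\<close> with
  the frame element of \<open>ShortP 2\<close>, stated without inverses.\<close>

definition coord_form :: "nat \<Rightarrow> nat \<Rightarrow> (group_fun, unit) form" where
  "coord_form y z = And (centralizes centr_1 y)
     (Eq (gmult (Var y) (Var 2)) (gmult (Var z) (gmult (Var 2) (Var y))))"

definition coord_form' :: "nat \<Rightarrow> nat \<Rightarrow> (group_fun, unit) form" where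
  "coord_form' y z = And (centralizes centr_2 y)
     (Eq (gmult (Var 1) (Var y)) (gmult (Var z) (gmult (Var y) (Var 1))))"

lemma sat_coord_form:
  assumes "e \<in> envs GG frame"
  shows "sat GG e (coord_form y z) \<longleftrightarrow> (\<exists>a t. a \<noteq> 0 \<and> e y = mat a ** root_elt (ShortP 1) t \<and> e z = coord t)"
proof -
  have G: "e y \<in> G" "e z \<in> G" using assms by (auto simp: envs_def)
  have "sat GG e (coord_form y z) \<longleftrightarrow> (\<exists>a t. a \<noteq> 0 \<and> e y = mat a ** root_elt (ShortP 1) t) \<and>
      e y ** root_elt (ShortP 2) 1 = e z ** (root_elt (ShortP 2) 1 ** e y)"
    using centr_1[OF assms G(1)]
    by (simp only: coord_form_def sat.simps sat_centralizes val_gmult val.simps(1) frame_entries[OF assms])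
  then show ?thesis using coord_1_iff[OF G(2) _ _ G(1)] by blast
qed

lemma sat_coord_form':
  assumes "e \<in> envs GG frame"
  shows "sat GG e (coord_form' y z) \<longleftrightarrow> (\<exists>a t. a \<noteq> 0 \<and> e y = mat a ** root_elt (ShortP 2) t \<and> e z = coord t)"
proof -
  have G: "e y \<in> G" "e z \<in> G" using assms by (auto simp: envs_def)
  have "sat GG e (coord_form' y z) \<longleftrightarrow> (\<exists>a t. a \<noteq> 0 \<and> e y = mat a ** root_elt (ShortP 2) t) \<and>
      root_elt (ShortP 1) 1 ** e y = e z ** (e y ** root_elt (ShortP 1) 1)"
    using centr_2[OF assms G(1)]
    by (simp only: coord_form'_def sat.simps sat_centralizes val_gmult val.simps(1) frame_entries[OF assms])
  then show ?thesis using coord_2_iff[OF G(2) _ _ G(1)] by blast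
qed

lemma envs_upd: "e \<in> envs GG frame \<Longrightarrow> y \<in> G \<Longrightarrow> 12 \<le> v \<Longrightarrow> e(v := y) \<in> envs GG frame"
  by (auto simp: envs_def)

text \<open>Variables 12 and 13 hold the codes of the factors and 14 that of the product. The
  factors are copied to the root subgroups of \<open>ShortP 1\<close> and \<open>ShortP 2\<close>,
  and the commutator of the copies codes the product.\<close>

abbreviation "mult_form \<equiv> Ex 15 (Ex 16 (And (coord_form 15 12) (And (coord_form' 16 13)
      (Eq (gmult (Var 15) (Var 16)) (gmult (Var 14) (gmult (Var 16) (Var 15)))))))"

lemma sat_mult_form:
  assumes e: "e \<in> envs GG frame" and z: "e 12 = coord t" "e 13 = coord u" "e 14 = coord v"
  shows "sat GG e mult_form \<longleftrightarrow> t * u = v"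
proof -
  \<comment> \<open>Both scalars are central and cancel, which leaves a comparison of
    \<open>coord (t * u)\<close> with \<open>coord v\<close>.\<close>
  have key: "y ** y' = coord v ** (y' ** y) \<longleftrightarrow> t * u = v"
    if y: "y = mat a ** root_elt (ShortP 1) t" "a \<noteq> 0" "y' = mat a' ** root_elt (ShortP 2) u" "a' \<noteq> 0" "y \<in> G" "y' \<in> G"
    for y y' a a'
  proof -
    let ?x = "root_elt (ShortP 1) t" and ?x' = "root_elt (ShortP 2) u"
    have "y ** y' = mat a ** (mat a' ** (?x ** ?x'))"
      by (simp only: y(1,3) matrix_mul_assoc[symmetric] mult_mat_left[of ?x a'])
    also have "\<dots> = mat a ** (mat a' ** (coord (t * u) ** (?x' ** ?x)))"
      by (simp only: coord_mult[OF char3 k cubes])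
    also have "\<dots> = coord (t * u) ** (mat a ** (mat a' ** (?x' ** ?x)))"
      by (simp only: mult_mat_left[of "coord (t * u)"])
    also have "mat a ** (mat a' ** (?x' ** ?x)) = y' ** y"
      by (simp only: y(1,3) matrix_mul_assoc[symmetric] mult_mat_left[of ?x' a] mult_mat_left[of "mat a'" a])
    finally have "y ** y' = coord (t * u) ** (y' ** y)" .
    then have "y ** y' = coord v ** (y' ** y) \<longleftrightarrow> coord (t * u) = coord v"
      using root_span_cancel[OF char3 k cubes root_span_mult[OF y(6,5)]] by metis
    then show ?thesis by (simp add: coord_inject)
  qed
  have "sat GG e mult_form \<longleftrightarrow>
    (\<exists>y \<in> G. \<exists>y' \<in> G. (\<exists>a. a \<noteq> 0 \<and> y = mat a ** root_elt (ShortP 1) t) \<and>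
      (\<exists>a. a \<noteq> 0 \<and> y' = mat a ** root_elt (ShortP 2) u) \<and> y ** y' = coord v ** (y' ** y))"
  proof -
    have "e(15 := y, 16 := y') \<in> envs GG frame" if "y \<in> G" "y' \<in> G" for y y'
      using e that by (intro envs_upd) auto
    then have "sat GG (e(15 := y, 16 := y')) (coord_form 15 12) \<longleftrightarrow> (\<exists>a. a \<noteq> 0 \<and> y = mat a ** root_elt (ShortP 1) t)"
      "sat GG (e(15 := y, 16 := y')) (coord_form' 16 13) \<longleftrightarrow> (\<exists>a. a \<noteq> 0 \<and> y' = mat a ** root_elt (ShortP 2) u)"
      if "y \<in> G" "y' \<in> G" for y y'
      using that by (simp_all add: sat_coord_form sat_coord_form' z coord_inject)
    then show ?thesis by (simp add: z del: val.simps(2))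
  qed
  also have "\<dots> \<longleftrightarrow> t * u = v"
  proof
    assume "t * u = v"
    then have "root_elt (ShortP 1) t ** root_elt (ShortP 2) u = coord v ** (root_elt (ShortP 2) u ** root_elt (ShortP 1) t)"
      using coord_mult[OF char3 k cubes, of t u] by simp
    then show "\<exists>y \<in> G. \<exists>y' \<in> G. (\<exists>a. a \<noteq> 0 \<and> y = mat a ** root_elt (ShortP 1) t) \<and>
      (\<exists>a. a \<noteq> 0 \<and> y' = mat a ** root_elt (ShortP 2) u) \<and> y ** y' = coord v ** (y' ** y)"
      by (intro bexI[OF _ short_in_G(1)[of 1 t]] bexI[OF _ short_in_G(1)[of 2 u]] conjI exI[of _ 1]) simp_all
  qed (use key in blast)
  finally show ?thesis .
qed

text \<open>If \<open>w\<close> is the element of the root subgroup of \<open>LongN 0\<close> with parameter \<open>s\<close> and \<open>p = root_elt (ShortP 1) 1\<close>,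
  then \<open>[[w, p], p] = coord (- s)\<close>.\<close>

abbreviation "subfield_form \<equiv> Ex 13 (Ex 14 (And (centralizes centr_long 13)
      (And (Eq (gmult (Var 13) (Var 1)) (gmult (Var 14) (gmult (Var 1) (Var 13))))
        (Eq (gmult (Var 14) (Var 1)) (gmult (Var 12) (gmult (Var 1) (Var 14)))))))"

lemma sat_subfield_form:
  assumes e: "e \<in> envs GG frame" and z: "e 12 = coord t"
  shows "sat GG e subfield_form \<longleftrightarrow> t \<in> k"
proof -
  let ?p = "root_elt (ShortP 1) 1 :: 'a g2_matrix"
  have "sat GG e subfield_form \<longleftrightarrow>
    (\<exists>w \<in> G. \<exists>u \<in> G. (\<exists>a s. a \<noteq> 0 \<and> s \<in> k \<and> w = mat a ** root_elt (LongN 0) s) \<and>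
      w ** ?p = u ** (?p ** w) \<and> u ** ?p = coord t ** (?p ** u))"
  proof -
    have "sat GG (e(13 := w, 14 := u)) (centralizes centr_long 13) \<longleftrightarrow>
        (\<exists>a s. a \<noteq> 0 \<and> s \<in> k \<and> w = mat a ** root_elt (LongN 0) s)" if "w \<in> G" "u \<in> G" for w u
    proof -
      have "e(13 := w, 14 := u) \<in> envs GG frame" using e that by (intro envs_upd) auto
      from centr_long[OF this that(1)] show ?thesis unfolding sat_centralizes by simp
    qed
    then show ?thesis using frame_entries(2)[OF e] by (simp add: z del: val.simps(2))
  qed
  also have "\<dots> \<longleftrightarrow> t \<in> k"
  proof
    assume "\<exists>w \<in> G. \<exists>u \<in> G. (\<exists>a s. a \<noteq> 0 \<and> s \<in> k \<and> w = mat a ** root_elt (LongN 0) s) \<and>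
      w ** ?p = u ** (?p ** w) \<and> u ** ?p = coord t ** (?p ** u)"
    then obtain w u a s where wu: "u \<in> G" "a \<noteq> 0" "s \<in> k" "w = mat a ** root_elt (LongN 0) s"
      "w ** ?p = u ** (?p ** w)" "u ** ?p = coord t ** (?p ** u)" by blast
    have "mat a ** (u ** (?p ** root_elt (LongN 0) s)) = mat a ** (root_elt (LongN 0) s ** ?p)"
      using wu(5) by (simp add: wu(4) mult_mat_left matrix_mul_assoc[symmetric])
    then have "u ** (?p ** root_elt (LongN 0) s) = root_elt (LongN 0) s ** ?p"
      by (rule mat_mult_cancel[OF wu(2)])
    then have "coord t = coord (- s)" by (rule coord_double[OF char3 k cubes _ wu(6,1,3)])
    then show "t \<in> k" using wu(3) subfieldD(3)[OF k] by (simp add: coord_inject)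
  next
    assume t: "t \<in> k"
    \<comment> \<open>The sign makes up for the one in \<open>coord_double\<close>.\<close>
    let ?w = "root_elt (LongN 0) (- t)"
    have s: "- t \<in> k" using t subfieldD(3)[OF k] by simp
    have w: "?w \<in> G" using s by (auto intro!: root_elt_in_root_span)
    obtain x where x: "x \<in> G" "x ** (?p ** ?w) = mat 1"
      using root_span_inverse[OF char3 k cubes root_span_mult[OF short_in_G(1) w]] by blast
    define u where "u = (?w ** ?p) ** x"
    have u: "u \<in> G" unfolding u_def by (intro root_span_mult w short_in_G x)
    have 1: "u ** (?p ** ?w) = ?w ** ?p" by (simp add: u_def matrix_mul_assoc[symmetric] x(2))
    \<comment> \<open>With the inverse of \<open>?p ** u\<close> the second equation is solved for
      its left factor, which \<open>coord_double\<close> then identifies.\<close>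
    obtain x' where x': "x' \<in> G" "x' ** (?p ** u) = mat 1"
      using root_span_inverse[OF char3 k cubes root_span_mult[OF short_in_G(1) u]] by blast
    have 2: "u ** ?p = ((u ** ?p) ** x') ** (?p ** u)"
      by (simp only: matrix_mul_assoc[symmetric] x'(2) matrix_mul_rid)
    have "(u ** ?p) ** x' = coord (- (- t))" by (rule coord_double[OF char3 k cubes 1 2 u s])
    then have 3: "u ** ?p = coord t ** (?p ** u)" using 2 by simp
    show "\<exists>w \<in> G. \<exists>u \<in> G. (\<exists>a s. a \<noteq> 0 \<and> s \<in> k \<and> w = mat a ** root_elt (LongN 0) s) \<and>
      w ** ?p = u ** (?p ** w) \<and> u ** ?p = coord t ** (?p ** u)"
      using s 1[symmetric] 3 by (intro bexI[OF _ w] bexI[OF _ u] conjI exI[of _ 1] exI[of _ "- t"]) simp_all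
  qed
  finally show ?thesis .
qed

text \<open>An element of \<open>K\<close> is coded by a single group element. Multiplication of
  codes is addition in \<open>K\<close>, since the root subgroup is additive; field multiplication
  and the predicate for \<open>k\<close> come from commutators.\<close>

theorem pair_interpretable_in_group:
  "interpretable field_pair_language (field_pair k) group_language GG (\<lambda>t. [coord t]) 1 frame"
proof
  show "is_struct field_pair_language (field_pair k)" by (rule is_struct_field_pair)
  show "is_struct group_language GG" by (rule is_struct_group[OF char3 k cubes])
  show "set frame \<subseteq> dom GG"
    using subfieldD(2)[OF params_subfield[OF char3 k cubes]]
    by (auto simp: frame_def intro!: root_elt_in_root_span)
  show "[coord a] \<in> tuples GG 1" for a by (simp add: tuples_def short_in_G)
  show "inj_on (\<lambda>t. [coord t]) (dom (field_pair k))" by (simp add: inj_on_def coord_inject)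
  have blk: "block (length frame) 1 e j = [e (12 + j)]" for e :: "nat \<Rightarrow> 'a g2_matrix" and j by (simp add: block_def)
  have wf: "wf_form group_language (coord_form y z)" "wf_form group_language (coord_form' y z)" for y z
    by (auto simp: coord_form_def coord_form'_def wf_centralizes wf_gmult simp del: wf_trm.simps(2))
  \<comment> \<open>A centralizer would determine codes only up to scalars; commutators are free of
    scalars, so the codes are described as commutators.\<close>
  show "\<exists>\<delta>. wf_form group_language \<delta> \<and>
      (\<forall>e \<in> envs GG frame. sat GG e \<delta> \<longleftrightarrow> block (length frame) 1 e 0 \<in> (\<lambda>t. [coord t]) ` dom (field_pair k))"
  proof (intro exI[of _ "Ex 13 (coord_form 13 12)"] conjI ballI)
    fix e assume e: "e \<in> envs GG frame"
    have "sat GG e (Ex 13 (coord_form 13 12)) \<longleftrightarrow> (\<exists>y \<in> G. \<exists>a t. a \<noteq> 0 \<and> y = mat a ** root_elt (ShortP 1) t \<and> e 12 = coord t)"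
      using envs_upd[OF e] by (simp add: sat_coord_form)
    also have "\<dots> \<longleftrightarrow> (\<exists>t. e 12 = coord t)"
    proof
      assume "\<exists>t. e 12 = coord t"
      then obtain t where "e 12 = coord t" ..
      then show "\<exists>y \<in> G. \<exists>a t. a \<noteq> 0 \<and> y = mat a ** root_elt (ShortP 1) t \<and> e 12 = coord t"
        by (intro bexI[OF _ short_in_G(1)[of 1 t]] exI[of _ 1] exI[of _ t]) simp
    qed blast
    finally show "sat GG e (Ex 13 (coord_form 13 12)) \<longleftrightarrow> block (length frame) 1 e 0 \<in> (\<lambda>t. [coord t]) ` dom (field_pair k)"
      unfolding blk by (auto simp: field_pair_def)
  qed (simp add: wf)
  show "\<exists>\<psi>. wf_form group_language \<psi> \<and>
      (\<forall>e \<in> envs GG frame. \<forall>as a. length as = n \<longrightarrow> set as \<subseteq> dom (field_pair k) \<longrightarrow> a \<in> dom (field_pair k) \<longrightarrow>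
         (\<forall>i < n. block (length frame) 1 e i = [coord (as ! i)]) \<longrightarrow> block (length frame) 1 e n = [coord a] \<longrightarrow>
         (sat GG e \<psi> \<longleftrightarrow> fn (field_pair k) f as = a))"
    if f: "(f, n) \<in> funs field_pair_language" for f n
  proof -
    note simps = coord_add coord_inject coord_0[symmetric]
    consider "f = RPlus" "n = 2" | "f = RTimes" "n = 2" | "f = RUminus" "n = 1" | "f = RZero" "n = 0" | "f = ROne" "n = 0"
      using f by (auto simp: field_pair_language_def)
    then show ?thesis
    proof cases
      case 1
      show ?thesis unfolding blk
        by (rule exI[of _ "Eq (gmult (Var 12) (Var 13)) (Var 14)"])
          (use 1 in \<open>auto simp: wf_gmult field_pair_def simps less_Suc_eq numeral_2_eq_2 simp del: wf_trm.simps(2) val.simps(2)\<close>)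
    next
      case 2
      show ?thesis unfolding blk
      proof (intro exI[of _ mult_form] conjI ballI allI impI)
        fix e as a assume e: "e \<in> envs GG frame" and as: "\<forall>i < n. [e (12 + i)] = [coord (as ! i)]" "[e (12 + n)] = [coord a]"
        have "e 12 = coord (as ! 0)" "e 13 = coord (as ! 1)" "e 14 = coord a"
          using as(1)[THEN spec, of 0] as(1)[THEN spec, of 1] as(2) \<open>n = 2\<close> by simp_all
        from sat_mult_form[OF e this]
        show "sat GG e mult_form \<longleftrightarrow> fn (field_pair k) f as = a"
          using \<open>f = RTimes\<close> by (simp add: field_pair_def del: sat.simps)
      qed (simp add: wf wf_gmult del: wf_trm.simps(2))
    next
      case 3
      show ?thesis unfolding blk
        by (rule exI[of _ "Eq (gmult (Var 12) (Var 13)) (App GOne [])"])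
          (use 3 in \<open>auto simp: wf_gmult wf_gone field_pair_def simps add_eq_0_iff simp del: wf_trm.simps(2) val.simps(2)\<close>)
    next
      case 4
      show ?thesis unfolding blk
        by (rule exI[of _ "Eq (Var 12) (App GOne [])"])
          (use 4 in \<open>auto simp: wf_gone field_pair_def simps simp del: wf_trm.simps(2) val.simps(2)\<close>)
    next
      case 5
      show ?thesis unfolding blk
      \<comment> \<open>The frame element in variable 3 is \<open>coord (- 1)\<close>, so a code
        represents 1 when its product with this element is the identity.\<close>
      proof (intro exI[of _ "Eq (gmult (Var 12) (Var 3)) (App GOne [])"] conjI ballI allI impI)
        fix e as a assume e: "e \<in> envs GG frame" and a: "[e (12 + n)] = [coord a]"
        have "e 3 = coord (- 1)" using frame_entries(4)[OF e] by (simp add: coord_def)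
        moreover have "e 12 = coord a" using a 5 by simp
        ultimately show "sat GG e (Eq (gmult (Var 12) (Var 3)) (App GOne [])) \<longleftrightarrow> fn (field_pair k) f as = a"
          using 5 by (auto simp: field_pair_def simps simp del: val.simps(2))
      qed (simp add: wf_gmult wf_gone del: wf_trm.simps(2))
    qed
  qed
  show "\<exists>\<psi>. wf_form group_language \<psi> \<and>
      (\<forall>e \<in> envs GG frame. \<forall>as. length as = n \<longrightarrow> set as \<subseteq> dom (field_pair k) \<longrightarrow>
         (\<forall>i < n. block (length frame) 1 e i = [coord (as ! i)]) \<longrightarrow> (sat GG e \<psi> \<longleftrightarrow> rel (field_pair k) r as))"
    if r: "(r, n) \<in> rels field_pair_language" for r n
    unfolding blk
  proof (intro exI[of _ subfield_form] conjI ballI allI impI)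
    fix e as assume e: "e \<in> envs GG frame" and as: "\<forall>i < n. [e (12 + i)] = [coord (as ! i)]"
    have "n = 1" using r by (simp add: field_pair_language_def)
    then have "e 12 = coord (as ! 0)" using as[THEN spec, of 0] by simp
    from sat_subfield_form[OF e this]
    show "sat GG e subfield_form \<longleftrightarrow> rel (field_pair k) r as"
      by (simp add: field_pair_def del: sat.simps)
  qed (simp add: wf_centralizes wf_gmult del: wf_trm.simps(2))
qed

theorem finitely_realized_iff:
  "finitely_realized group_language GG Nm Cs \<longleftrightarrow> finitely_realized field_pair_language (field_pair k) Nm Cs"
  using interpretable.finitely_realized_transfer[OF group_interpretable_in_pair[OF char3 k cubes]]
    interpretable.finitely_realized_transfer[OF pair_interpretable_in_group] by blast

end

theorem theorem6p5:
  fixes k :: "'a::field set"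
  assumes "CHAR('a) = 3"
    and "is_subfield k"
    and "\<forall>x. x ^ 3 \<in> k"
  shows "(stable_theory TYPE('u::infinite) group_language (complete_theory group_language (group_struct (mixed_G2 k)))
           \<longleftrightarrow> stable_theory TYPE('u) field_pair_language (complete_theory field_pair_language (field_pair k)))
    \<and> (simple_theory TYPE('u) group_language (complete_theory group_language (group_struct (mixed_G2 k)))
           \<longleftrightarrow> simple_theory TYPE('u) field_pair_language (complete_theory field_pair_language (field_pair k)))
    \<and> (NTP2_theory TYPE('u) group_language (complete_theory group_language (group_struct (mixed_G2 k)))
           \<longleftrightarrow> NTP2_theory TYPE('u) field_pair_language (complete_theory field_pair_language (field_pair k)))
    \<and> (NSOP1_theory TYPE('u) group_language (complete_theory group_language (group_struct (mixed_G2 k)))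
           \<longleftrightarrow> NSOP1_theory TYPE('u) field_pair_language (complete_theory field_pair_language (field_pair k)))"
  using is_struct_group[OF assms] is_struct_field_pair[of k]
  by (simp add: stable_theory_iff simple_theory_iff NTP2_theory_iff NSOP1_theory_iff finitely_realized_iff[OF assms])

end
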